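(* Assume (H1), (H2), (H3). Then for every $t>0$, $$\lim_{z\to\infty}\sup_{x>0}\Big|\frac{r(t,\infty,x)}{r(t,z,x)}-1\Big|=0.$$
   Context: Let $q\in C^1([0,\infty))$ and $X$ the diffusion $dX_t=dB_t-q(X_t)dt$ stopped at $0$. $\gamma(y)=2\int_0^yq$, $\mu(dx)=2e^{-\gamma(x)}dx$, $\mathcal Lu=\frac12u''-qu'$. (H1): $\int_0^\infty e^{\gamma(y)}\int_y^\infty e^{-\gamma(\xi)}d\xi\,dy<\infty$. (H2): $q(x)\to\infty$ and $q'(x)/q(x)^2\to0$. (H3): there exist $a>0$, $x_0\ge0$ with $\inf\{q(y):y\ge x\}\ge a\,q(x)$ for all $x\ge x_0$. Known spectral facts under (H1),(H2): the generator on $L^2(\mu)$ of $X$ killed at $0$ has discrete simple spectrum with eigenvalues $-\lambda_k$, $0<\lambda_1<\lambda_2<\cdots$, and $L^2(\mu)$-orthonormal eigenfunctions $\psi_k$ ($\mathcal L\psi_k=-\lambda_k\psi_k$, $\psi_k(0)=0$), each bounded with a finite limit $\psi_k(\infty)$ at infinity. For $y\in(0,\infty]$, $r(t,y,x)=\sum_{k\ge1}e^{-\lambda_kt}\psi_k(y)\psi_k(x)$; for finite $y$, $r(t,y,x)2e^{-\gamma(x)}dx=\mathbb P_y(X_t\in dx,\mathbb T_0>t)$, and $r(t,\infty,x)2e^{-\gamma(x)}dx$ is the corresponding density for the process started from infinity. *)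

theory Defs
  imports "HOL-Analysis.Analysis"
begin

definition gam :: "(real \<Rightarrow> real) \<Rightarrow> real \<Rightarrow> real" where
  "gam q y = 2 * integral {0..y} q"

definition mu_dens :: "(real \<Rightarrow> real) \<Rightarrow> real \<Rightarrow> real" where
  "mu_dens q x = 2 * exp (- gam q x)"

definition H1 :: "(real \<Rightarrow> real) \<Rightarrow> bool" where
  "H1 q \<longleftrightarrow>
     (\<integral>\<^sup>+ y. indicator {0..} y * ennreal (exp (gam q y)) *
        (\<integral>\<^sup>+ \<xi>. indicator {y..} \<xi> * ennreal (exp (- gam q \<xi>)) \<partial>lborel) \<partial>lborel) < \<infinity>"

definition H2 :: "(real \<Rightarrow> real) \<Rightarrow> (real \<Rightarrow> real) \<Rightarrow> bool" where
  "H2 q q' \<longleftrightarrow> filterlim q at_top at_top \<and> ((\<lambda>x. q' x / (q x)\<^sup>2) \<longlongrightarrow> 0) at_top"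

text \<open>(H3): inf over y >= x of q y is >= a q x, written out pointwise\<close>
definition H3 :: "(real \<Rightarrow> real) \<Rightarrow> bool" where
  "H3 q \<longleftrightarrow> (\<exists>a>0. \<exists>x0\<ge>0. \<forall>x\<ge>x0. \<forall>y\<ge>x. q y \<ge> a * q x)"

definition C1_deriv :: "(real \<Rightarrow> real) \<Rightarrow> (real \<Rightarrow> real) \<Rightarrow> bool" where
  "C1_deriv q q' \<longleftrightarrow> (\<forall>x\<ge>0. (q has_real_derivative q' x) (at x within {0..})) \<and> continuous_on {0..} q'"

text \<open>(lam, psi) is the spectral system of the generator L u = u''/2 - q u' on L2(mu),
  killed at 0: lam strictly increasing and positive, each psi k solves
  L psi = - lam psi on (0,oo) with psi(0)=0, the family is orthonormal and complete in L2(mu).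
  Index k = 0,1,2,... corresponds to the paper's 1,2,3,...\<close>
definition spectral_system ::
  "(real \<Rightarrow> real) \<Rightarrow> (nat \<Rightarrow> real) \<Rightarrow> (nat \<Rightarrow> real \<Rightarrow> real) \<Rightarrow> bool" where
  "spectral_system q lam psi \<longleftrightarrow>
     0 < lam 0 \<and> strict_mono lam \<and>
     (\<forall>k. continuous_on {0..} (psi k) \<and> psi k 0 = 0 \<and>
        (\<exists>d1 d2. \<forall>x>0. (psi k has_real_derivative d1 x) (at x) \<and>
                        (d1 has_real_derivative d2 x) (at x) \<and>
                        d2 x / 2 - q x * d1 x = - lam k * psi k x)) \<and>
     (\<forall>j k. set_integrable lborel {0<..} (\<lambda>x. mu_dens q x * psi j x * psi k x) \<and>
        (LINT x:{0<..}|lborel. mu_dens q x * psi j x * psi k x) = (if j = k then 1 else 0)) \<and>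
     (\<forall>f. f \<in> borel_measurable lborel \<longrightarrow>
          set_integrable lborel {0<..} (\<lambda>x. mu_dens q x * (f x)\<^sup>2) \<longrightarrow>
          (\<forall>k. (LINT x:{0<..}|lborel. mu_dens q x * f x * psi k x) = 0) \<longrightarrow>
          (AE x in lborel. x > 0 \<longrightarrow> f x = 0))"

definition psi_inf :: "(nat \<Rightarrow> real \<Rightarrow> real) \<Rightarrow> nat \<Rightarrow> real" where
  "psi_inf psi k = Lim at_top (psi k)"

definition rker :: "(nat \<Rightarrow> real) \<Rightarrow> (nat \<Rightarrow> real \<Rightarrow> real) \<Rightarrow> real \<Rightarrow> real \<Rightarrow> real \<Rightarrow> real" where
  "rker lam psi t y x = (\<Sum>k. exp (- lam k * t) * psi k y * psi k x)"

definition rker_inf :: "(nat \<Rightarrow> real) \<Rightarrow> (nat \<Rightarrow> real \<Rightarrow> real) \<Rightarrow> real \<Rightarrow> real \<Rightarrow> real" where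
  "rker_inf lam psi t x = (\<Sum>k. exp (- lam k * t) * psi_inf psi k * psi k x)"

end

theory Submission
  imports Defs "HOL-Complex_Analysis.Conformal_Mappings"
begin

text \<open>Let \<open>T x\<close> be the integral over \<open>[0, x]\<close> of \<open>2 e^\<gamma>(y)\<close> times the tail of \<open>e^-\<gamma>\<close> beyond \<open>y\<close>,
  so that \<open>L T = -1\<close>; by (H1) it has a finite limit \<open>T(\<infinity>)\<close>. Integrating the eigenvalue equation twice
  gives \<open>|\<psi>\<^sub>k(x)| \<le> \<lambda>\<^sub>k M\<^sub>k T(x)\<close> and \<open>|\<psi>\<^sub>k(\<infinity>) - \<psi>\<^sub>k(z)| \<le> \<lambda>\<^sub>k M\<^sub>k (T(\<infinity>) - T(z))\<close> with \<open>M\<^sub>k\<close> the sup norm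
  of \<open>\<psi>\<^sub>k\<close>. Hence the numerator of the relative error is at most \<open>C T(x) (T(\<infinity>) - T(z))\<close> as soon as
  \<open>\<Sum> e^(-\<lambda>\<^sub>k t) \<lambda>\<^sub>k\<^sup>2 M\<^sub>k\<^sup>2\<close> converges, and it remains to bound \<open>r(t,\<infinity>,x)\<close> below by a multiple of \<open>T(x)\<close>.

  Convergence: Bessel's inequality for the energy form gives \<open>\<Sum> \<psi>\<^sub>k(x)\<^sup>2 / \<lambda>\<^sub>k \<le> \<Lambda>(x)\<close>, the integral
  of \<open>e^\<gamma>\<close> over \<open>[0, x]\<close>, and after integration \<open>\<Sum> 1 / \<lambda>\<^sub>k \<le> T(\<infinity>)\<close>. Beyond a point \<open>X\<close> where \<open>q\<^sup>2\<close> dominates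
  \<open>\<lambda>\<^sub>k\<close>, the supersolution \<open>exp (2 \<lambda>\<^sub>k T)\<close> controls \<open>\<psi>\<^sub>k\<close> by its value at \<open>X\<close>, and (H3) makes \<open>\<Lambda>(X)\<close>
  subexponential in \<open>\<lambda>\<^sub>k\<close>; so \<open>M\<^sub>k\<close> is subexponential in \<open>\<lambda>\<^sub>k\<close>.

  Lower bound: a maximum principle and Mercer's expansion of the Green kernel \<open>\<Lambda>(min x y)\<close> give \<open>r \<ge> 0\<close>.
  If \<open>r(t,\<infinity>,x) = 0\<close>, where \<open>x\<close> may also be \<open>0\<close> (after division by \<open>T\<close>) or \<open>\<infinity>\<close>, then the semigroup property and
  \<open>r(s,\<infinity>,\<infinity>) > 0\<close> give \<open>r(s,\<infinity>,x) = 0\<close> for all \<open>s < t\<close>, hence for all \<open>s\<close> by analyticity in time, against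
  \<open>e^(\<lambda>\<^sub>1 s) r(s,\<infinity>,x) \<rightarrow> \<psi>\<^sub>1(\<infinity>) \<psi>\<^sub>1(x)\<close>. Compactness of \<open>[0, \<infinity>]\<close> yields the uniform bound.\<close>

section \<open>Primitives and integrals on the half-line\<close>

lemma primitive_deriv:
  fixes f :: "real \<Rightarrow> real"
  assumes f: "continuous_on {0..} f" and x: "x > 0"
  shows "((\<lambda>x. integral {0..x} f) has_real_derivative f x) (at x)"
proof -
  have "continuous_on {0..x+1} f"
    by (rule continuous_on_subset[OF f]) auto
  then have "((\<lambda>x. integral {0..x} f) has_real_derivative f x) (at x within {0..x+1})"
    using x by (intro integral_has_real_derivative) auto
  moreover have "at x within {0..x+1} = at x"
    using x by (intro at_within_interior) auto
  ultimately show ?thesis by simp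
qed

text \<open>For negative \<open>x\<close> the interval is empty and the primitive vanishes.\<close>

lemma primitive_cont:
  fixes f :: "real \<Rightarrow> real"
  assumes f: "continuous_on {0..} f"
  shows "continuous_on UNIV (\<lambda>x. integral {0..x} f)"
proof -
  have "continuous_on {0..} (\<lambda>x. integral {0..x} f)"
    unfolding continuous_on_eq_continuous_within
  proof
    fix x :: real assume x: "x \<in> {0..}"
    have int: "f integrable_on {0..x+1}"
      by (intro integrable_continuous_interval continuous_on_subset[OF f]) auto
    have "continuous_on {0..x+1} (\<lambda>x. integral {0..x} f)"
      by (rule indefinite_integral_continuous_1[OF int])
    then have "continuous (at x within {0..x+1}) (\<lambda>x. integral {0..x} f)"
      using x by (auto simp: continuous_on_eq_continuous_within)
    moreover have "at x within {0..x+1} = at x within {0..}"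
      by (rule at_within_nhd[of _ "{x-1<..<x+1}"]) auto
    ultimately show "continuous (at x within {0..}) (\<lambda>x. integral {0..x} f)" by simp
  qed
  moreover have "continuous_on {..0} (\<lambda>x. integral {0..x} f)"
  proof -
    have "integral {0..x} f = 0" if "x \<in> {..0}" for x :: real
      using that by (cases "x = 0") auto
    then show ?thesis
      by (subst continuous_on_cong[OF refl, of _ _ "\<lambda>_. 0"]) auto
  qed
  ultimately have "continuous_on ({..0} \<union> {0..}) (\<lambda>x. integral {0..x} f)"
    by (intro continuous_on_closed_Un) auto
  moreover have "{..0} \<union> {0..} = (UNIV :: real set)" by auto
  ultimately show ?thesis by metis
qed

lemma isCont_halfline:
  fixes f :: "real \<Rightarrow> real"
  assumes "continuous_on {0..} f" "x > 0"
  shows "isCont f x"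
  using continuous_on_interior[OF assms(1), of x] assms(2) by simp

text \<open>Connects gauge integrals over \<open>{0..R}\<close>, which the fundamental theorem
  produces, with Lebesgue integrals over \<open>{0<..}\<close>, in which orthonormality is stated.
  The endpoint 0 contributes only a function that vanishes almost everywhere.\<close>

lemma primitive_tendsto_LINT:
  fixes f :: "real \<Rightarrow> real"
  assumes "set_integrable lborel {0<..} f"
  shows "((\<lambda>R. integral {0..R} f) \<longlongrightarrow> (LINT x:{0<..}|lborel. f x)) at_top"
proof -
  have eq: "(\<lambda>x. indicat_real {0..} x *\<^sub>R f x) = (\<lambda>x. indicat_real {0<..} x *\<^sub>R f x + (if x = 0 then f 0 else 0))"
    by (auto simp: indicator_def)
  have 0: "(\<lambda>x::real. if x = 0 then f 0 else 0) \<in> borel_measurable lborel" by simp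
  have z: "AE x in lborel. (if x = (0::real) then f 0 else 0) = 0"
    by (rule AE_mp[OF AE_lborel_singleton[of 0]]) auto
  have i0: "integrable lborel (\<lambda>x::real. if x = 0 then f 0 else 0)"
    using integrable_cong_AE[OF 0 _ z] by simp
  have si: "set_integrable lborel {0..} f"
    unfolding set_integrable_def eq using assms i0 by (simp add: set_integrable_def)
  have "(LINT x:{0..}|lborel. f x) = (LINT x:{0<..}|lborel. f x)"
    unfolding set_lebesgue_integral_def eq
    using assms i0 integral_cong_AE[OF 0 _ z] by (simp add: set_integrable_def)
  moreover have "((\<lambda>R. LINT x:{0..R}|lborel. f x) \<longlongrightarrow> (LINT x:{0..}|lborel. f x)) at_top"
    using si by (intro tendsto_set_lebesgue_integral_at_top) auto
  moreover have "(LINT x:{0..R}|lborel. f x) = integral {0..R} f" for R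
    by (rule set_borel_integral_eq_integral, rule set_integrable_subset[OF si]) auto
  ultimately show ?thesis by simp
qed

lemma mono_bounded_convergent_at_top:
  fixes f :: "real \<Rightarrow> real"
  assumes mono: "\<And>x y. a \<le> x \<Longrightarrow> x \<le> y \<Longrightarrow> f x \<le> f y" and B: "\<And>x. a \<le> x \<Longrightarrow> f x \<le> B"
  shows "\<exists>L. (f \<longlongrightarrow> L) at_top"
proof -
  have bdd: "bdd_above (f ` {a..})" using B by (auto intro!: bdd_aboveI2[of _ _ B])
  have "(f \<longlongrightarrow> (SUP x\<in>{a..}. f x)) at_top"
  proof (rule order_tendstoI)
    fix c assume "c < (SUP x\<in>{a..}. f x)"
    then have "\<exists>x\<in>{a..}. c < f x" using bdd by (subst (asm) less_cSUP_iff) auto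
    then obtain x where x: "x \<ge> a" "c < f x" by auto
    show "eventually (\<lambda>x. c < f x) at_top"
    proof (rule eventually_mono[OF eventually_ge_at_top[of x]])
      fix y assume "x \<le> y"
      then show "c < f y" using mono[of x y] x by simp
    qed
  next
    fix c assume c: "(SUP x\<in>{a..}. f x) < c"
    show "eventually (\<lambda>x. f x < c) at_top"
    proof (rule eventually_mono[OF eventually_ge_at_top[of a]])
      fix y :: real assume "a \<le> y"
      then have "f y \<le> (SUP x\<in>{a..}. f x)" by (intro cSUP_upper bdd) auto
      then show "f y < c" using c by simp
    qed
  qed
  then show ?thesis by blast
qed

text \<open>The primitive is monotone and bounded, so it converges at infinity; the fundamental
  theorem for nonnegative integrands turns its finite limits at both ends into
  integrability.\<close>

lemma nonneg_bounded_set_integrable: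
  fixes f :: "real \<Rightarrow> real"
  assumes f: "continuous_on {0..} f" and nn: "\<And>x. x \<ge> 0 \<Longrightarrow> f x \<ge> 0"
    and B: "\<And>R. R \<ge> 0 \<Longrightarrow> integral {0..R} f \<le> B"
  shows "set_integrable lborel {0<..} f"
proof -
  let ?F = "\<lambda>x. integral {0..x} f"
  have mono: "?F x \<le> ?F y" if "0 \<le> x" "x \<le> y" for x y
    using that nn by (intro integral_subset_le integrable_continuous_interval continuous_on_subset[OF f]) auto
  have "\<exists>L. (?F \<longlongrightarrow> L) at_top"
    by (rule mono_bounded_convergent_at_top[of 0 ?F B]) (use mono B in auto)
  then obtain L where L: "(?F \<longlongrightarrow> L) at_top" by blast
  have 0: "(?F \<longlongrightarrow> ?F 0) (at_right 0)"
  proof -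
    have "isCont ?F 0"
      using primitive_cont[OF f] by (simp add: continuous_on_eq_continuous_at)
    then show ?thesis unfolding isCont_def by (rule filterlim_mono) (auto intro: at_le)
  qed
  have "set_integrable lborel (einterval 0 \<infinity>) f"
    using primitive_deriv[OF f] isCont_halfline[OF f] nn 0 L
    by (intro interval_integral_FTC_nonneg(1)[where F = ?F and A="?F 0" and B=L])
       (auto simp: zero_ereal_def ereal_tendsto_simps)
  moreover have "einterval 0 \<infinity> = {0<..}" by (auto simp: einterval_def)
  ultimately show ?thesis by simp
qed

text \<open>Derivatives are known only on the open half-line, so energy arguments start from a limit
  at 0 instead of a derivative there.\<close>

lemma nondecreasing_nonneg_at_right:
  fixes f :: "real \<Rightarrow> real"
  assumes f: "\<And>x. x > 0 \<Longrightarrow> (f has_real_derivative f' x) (at x)" "\<And>x. x > 0 \<Longrightarrow> f' x \<ge> 0"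
    and lim: "(f \<longlongrightarrow> L) (at_right 0)" and x: "x > 0"
  shows "L \<le> f x"
proof (rule tendsto_upperbound[OF lim])
  have "f y \<le> f x" if "y \<in> {0<..<x}" for y
    by (rule DERIV_nonneg_imp_nondecreasing) (use that in \<open>auto intro!: exI[of _ "f' _"] f\<close>)
  then show "\<forall>\<^sub>F y in at_right 0. f y \<le> f x"
    using eventually_at_right_real[OF x] by (rule eventually_mono[rotated])
qed simp

lemma nondecreasing_le_at_top:
  fixes f :: "real \<Rightarrow> real"
  assumes f: "\<And>x. x \<ge> a \<Longrightarrow> (f has_real_derivative f' x) (at x)" "\<And>x. x \<ge> a \<Longrightarrow> f' x \<ge> 0"
    and lim: "(f \<longlongrightarrow> L) at_top" and x: "x \<ge> a"
  shows "f x \<le> L"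
proof (rule tendsto_lowerbound[OF lim])
  have "f x \<le> f y" if "x \<le> y" for y
    by (rule DERIV_nonneg_imp_nondecreasing) (use that x in \<open>auto intro!: exI[of _ "f' _"] f\<close>)
  then show "\<forall>\<^sub>F y in at_top. f x \<le> f y"
    by (rule eventually_mono[OF eventually_ge_at_top[of x]])
qed simp

text \<open>The set where \<open>f\<close> is positive is open and null, hence empty. Completeness
  and vanishing integrals give only almost-everywhere statements; this makes them pointwise.\<close>

lemma AE_le_imp_le:
  fixes f :: "real \<Rightarrow> real"
  assumes f: "continuous_on {0<..} f" and ae: "AE x in lborel. x > 0 \<longrightarrow> f x \<le> 0" and x: "x > 0"
  shows "f x \<le> 0"
proof (rule ccontr)
  assume "\<not> f x \<le> 0"
  let ?U = "{0<..} \<inter> f -` {0<..}"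
  have "open ?U" using f by (rule continuous_open_preimage) auto
  moreover have "?U \<noteq> {}" using x \<open>\<not> f x \<le> 0\<close> by auto
  moreover have "negligible ?U"
  proof -
    have "AE x in lebesgue. x \<notin> ?U"
      by (rule AE_mp[OF AE_completion[OF ae]]) auto
    then have "?U \<in> null_sets lebesgue"
      using \<open>open ?U\<close> by (subst AE_iff_null_sets) auto
    then show ?thesis by (simp add: negligible_iff_null_sets)
  qed
  ultimately show False using open_not_negligible by blast
qed

lemma less_of_deriv_pos:
  fixes f :: "real \<Rightarrow> real"
  assumes "a < b" "continuous_on {a..b} f"
    and "\<And>x. a < x \<Longrightarrow> x < b \<Longrightarrow> (f has_real_derivative f' x) (at x)"
    and "\<And>x. a < x \<Longrightarrow> x < b \<Longrightarrow> f' x > 0"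
  shows "f a < f b"
proof (rule DERIV_pos_imp_increasing_open[OF assms(1) _ assms(2)])
  fix x assume "a < x" "x < b"
  then show "\<exists>y. (f has_real_derivative y) (at x) \<and> 0 < y"
    using assms(3,4)[of x] by (intro exI[of _ "f' x"] conjI)
qed

lemma le_of_deriv_nonneg:
  fixes f :: "real \<Rightarrow> real"
  assumes "a \<le> b" "continuous_on {a..b} f"
    and "\<And>x. a < x \<Longrightarrow> x < b \<Longrightarrow> (f has_real_derivative f' x) (at x)"
    and "\<And>x. a < x \<Longrightarrow> x < b \<Longrightarrow> f' x \<ge> 0"
  shows "f a \<le> f b"
proof (rule DERIV_nonneg_imp_increasing_open[OF assms(1) _ assms(2)])
  fix x assume "a < x" "x < b"
  then show "\<exists>y. (f has_real_derivative y) (at x) \<and> 0 \<le> y"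
    using assms(3,4)[of x] by (intro exI[of _ "f' x"] conjI)
qed

lemma le_of_deriv_nonneg':
  fixes f :: "real \<Rightarrow> real"
  assumes "a \<le> b"
    and "\<And>x. a \<le> x \<Longrightarrow> x \<le> b \<Longrightarrow> (f has_real_derivative f' x) (at x)"
    and "\<And>x. a \<le> x \<Longrightarrow> x \<le> b \<Longrightarrow> f' x \<ge> 0"
  shows "f a \<le> f b"
proof (rule DERIV_nonneg_imp_nondecreasing[OF assms(1)])
  fix x assume "a \<le> x" "x \<le> b"
  then show "\<exists>y. (f has_real_derivative y) (at x) \<and> 0 \<le> y"
    using assms(2,3)[of x] by (intro exI[of _ "f' x"] conjI)
qed

section \<open>Scale function, tail integrals and the mean entrance time\<close>

locale entrance_drift =
  fixes q q' :: "real \<Rightarrow> real"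
  assumes C1: "C1_deriv q q'" and h1: "H1 q" and h2: "H2 q q'" and h3: "H3 q"
begin

abbreviation g :: "real \<Rightarrow> real" where "g \<equiv> gam q"

text \<open>The tail integral of \<open>exp (- g y)\<close> beyond \<open>x\<close>, encoded as
  total mass minus primitive so that its continuity and derivative are those of a primitive.\<close>

definition K :: "real \<Rightarrow> real" where
  "K x = (LINT y:{0<..}|lborel. exp (- g y)) - integral {0..x} (\<lambda>y. exp (- g y))"

text \<open>Probabilistically the expected time to reach 0 from \<open>x\<close>. It is the
  yardstick for the eigenfunctions near 0 and near infinity.\<close>

definition T :: "real \<Rightarrow> real" where
  "T x = integral {0..x} (\<lambda>y. 2 * exp (g y) * K y)"

text \<open>The scale function normalised at 0, harmonic for the generator;
  \<open>Lam (min x y)\<close> is the Green kernel with respect to \<open>mu_dens q\<close>.\<close>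

definition Lam :: "real \<Rightarrow> real" where
  "Lam x = integral {0..x} (\<lambda>y. exp (g y))"

definition Tinf :: real where "Tinf = Lim at_top T"

lemma q_cont: "continuous_on {0..} q"
  using C1 unfolding C1_deriv_def
  by (intro DERIV_continuous_on[where D = q']) auto

lemma q_deriv: "x > 0 \<Longrightarrow> (q has_real_derivative q' x) (at x)"
  using C1 unfolding C1_deriv_def
  by (metis at_within_interior greaterThan_iff interior_real_atLeast less_imp_le)

lemma g_cont: "continuous_on UNIV g"
  unfolding gam_def using primitive_cont[OF q_cont] by (intro continuous_intros)

lemma g_cont' [continuous_intros]:
  "continuous_on A f \<Longrightarrow> continuous_on A (\<lambda>x. g (f x))"
  by (rule continuous_on_compose2[OF g_cont]) auto

lemma g_deriv: "x > 0 \<Longrightarrow> (g has_real_derivative 2 * q x) (at x)"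
  unfolding gam_def using primitive_deriv[OF q_cont]
  by (auto intro!: derivative_eq_intros)

lemma g_deriv' [derivative_intros]:
  "(f has_real_derivative D) (at x) \<Longrightarrow> f x > 0 \<Longrightarrow> E = 2 * q (f x) * D \<Longrightarrow>
    ((\<lambda>x. g (f x)) has_real_derivative E) (at x)"
  using DERIV_chain2[OF g_deriv] by metis

lemma g_measurable [measurable]: "g \<in> borel_measurable borel"
  using g_cont by (rule borel_measurable_continuous_onI)

lemma q_at_top: "filterlim q at_top at_top"
  using h2 by (simp add: H2_def)

lemma g_at_top: "filterlim g at_top at_top"
proof -
  obtain X where X: "X > 0" "\<And>x. x \<ge> X \<Longrightarrow> q x \<ge> 1"
  proof -
    have "\<forall>\<^sub>F x in at_top. q x \<ge> 1 \<and> x > 0"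
      using q_at_top eventually_gt_at_top[of 0] by (auto simp: filterlim_at_top intro: eventually_conj)
    then show ?thesis using that unfolding eventually_at_top_linorder
      by (metis order_refl)
  qed
  have "g x - 2 * x \<ge> g X - 2 * X" if "x \<ge> X" for x
  proof (rule le_of_deriv_nonneg'[where f = "\<lambda>x. g x - 2 * x" and f' = "\<lambda>x. 2 * q x - 2"])
    fix y assume "X \<le> y"
    then show "((\<lambda>x. g x - 2 * x) has_real_derivative 2 * q y - 2) (at y)" "0 \<le> 2 * q y - 2"
      using X by (auto intro!: derivative_eq_intros)
  qed (use that in auto)
  then have "\<forall>\<^sub>F x in at_top. g X - 2 * X + 2 * x \<le> g x"
    by (intro eventually_mono[OF eventually_ge_at_top[of X]]) force
  moreover have "filterlim (\<lambda>x. g X - 2 * X + 2 * x) at_top at_top"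
    by (intro filterlim_tendsto_add_at_top[OF tendsto_const] filterlim_tendsto_pos_mult_at_top[OF tendsto_const] filterlim_ident) auto
  ultimately show ?thesis by (rule filterlim_at_top_mono[rotated])
qed

text \<open>On a bounded interval the integral is finite, so an infinite tail from 0 would make
  every tail infinite. The outer integrand of (H1) would then be infinite on
  \<open>{0..1}\<close>.\<close>

lemma exp_minus_g_integrable: "set_integrable lborel {0<..} (\<lambda>y. exp (- g y))"
proof -
  let ?I = "\<lambda>y. \<integral>\<^sup>+ \<xi>. indicator {y..} \<xi> * ennreal (exp (- g \<xi>)) \<partial>lborel"
  have fin: "(\<integral>\<^sup>+ \<xi>. indicator {0..y} \<xi> * ennreal (exp (- g \<xi>)) \<partial>lborel) < \<infinity>" for y
  proof -
    have "set_integrable lborel {0..y} (\<lambda>\<xi>. exp (- g \<xi>))"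
      by (intro borel_integrable_atLeastAtMost') (intro continuous_intros)
    then have "integrable lborel (\<lambda>\<xi>. indicator {0..y} \<xi> * exp (- g \<xi>))"
      by (simp add: set_integrable_def)
    then have "(\<integral>\<^sup>+ \<xi>. ennreal (norm (indicator {0..y} \<xi> * exp (- g \<xi>))) \<partial>lborel) < \<infinity>"
      unfolding integrable_iff_bounded by simp
    also have "(\<lambda>\<xi>. ennreal (norm (indicator {0..y} \<xi> * exp (- g \<xi>))))
        = (\<lambda>\<xi>. indicator {0..y} \<xi> * ennreal (exp (- g \<xi>)))"
      by (auto simp: indicator_def)
    finally show ?thesis .
  qed
  have split: "?I 0 \<le> (\<integral>\<^sup>+ \<xi>. indicator {0..y} \<xi> * ennreal (exp (- g \<xi>)) \<partial>lborel) + ?I y" for y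
  proof -
    have "?I 0 \<le> (\<integral>\<^sup>+ \<xi>. indicator {0..y} \<xi> * ennreal (exp (- g \<xi>)) +
        indicator {y..} \<xi> * ennreal (exp (- g \<xi>)) \<partial>lborel)"
      by (intro nn_integral_mono) (auto simp: indicator_def)
    also have "\<dots> = (\<integral>\<^sup>+ \<xi>. indicator {0..y} \<xi> * ennreal (exp (- g \<xi>)) \<partial>lborel) + ?I y"
      by (subst nn_integral_add) auto
    finally show ?thesis .
  qed
  have "?I 0 \<noteq> \<infinity>"
  proof
    assume inf: "?I 0 = \<infinity>"
    have I: "?I y = \<infinity>" for y
      using split[of y] fin[of y] inf by (auto simp: top_unique)
    have "(\<infinity>::ennreal) = (\<integral>\<^sup>+ y. indicator {0..1::real} y * \<infinity> \<partial>lborel)"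
      by (subst nn_integral_multc) (auto simp: ennreal_mult_top)
    also have "\<dots> \<le> (\<integral>\<^sup>+ y. indicator {0..} y * ennreal (exp (g y)) * ?I y \<partial>lborel)"
    proof (intro nn_integral_mono)
      fix y :: real
      show "indicator {0..1} y * \<infinity> \<le> indicator {0..} y * ennreal (exp (g y)) * ?I y"
        unfolding I by (cases "y \<in> {0..1}") (auto simp: ennreal_mult_top)
    qed
    finally show False using h1 unfolding H1_def by (simp add: top_unique)
  qed
  then have "integrable lborel (\<lambda>\<xi>. indicator {0..} \<xi> * exp (- g \<xi>))"
  proof (intro integrableI_bounded)
    have "(\<lambda>\<xi>. ennreal (norm (indicator {0..} \<xi> * exp (- g \<xi>)))) =
        (\<lambda>\<xi>. indicator {0..} \<xi> * ennreal (exp (- g \<xi>)))"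
      by (auto simp: indicator_def)
    with \<open>?I 0 \<noteq> \<infinity>\<close>
    show "(\<integral>\<^sup>+ \<xi>. ennreal (norm (indicator {0..} \<xi> * exp (- g \<xi>))) \<partial>lborel) < \<infinity>"
      by (simp add: less_top)
  qed measurable
  then have "set_integrable lborel {0..} (\<lambda>y. exp (- g y))" by (simp add: set_integrable_def)
  then show ?thesis by (rule set_integrable_subset) auto
qed

lemma exp_minus_g_cont: "continuous_on {0..} (\<lambda>y. exp (- g y))"
  by (intro continuous_intros)

lemma exp_g_cont: "continuous_on {0..} (\<lambda>y. exp (g y))"
  by (intro continuous_intros)

lemma K_cont: "continuous_on UNIV K"
  unfolding K_def using primitive_cont[OF exp_minus_g_cont] by (intro continuous_intros)

lemma K_deriv: "x > 0 \<Longrightarrow> (K has_real_derivative - exp (- g x)) (at x)"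
  unfolding K_def using primitive_deriv[OF exp_minus_g_cont]
  by (auto intro!: derivative_eq_intros)

lemma K_tendsto: "(K \<longlongrightarrow> 0) at_top"
  unfolding K_def
  by (rule tendsto_eq_rhs[OF tendsto_diff[OF tendsto_const primitive_tendsto_LINT[OF exp_minus_g_integrable]]]) simp

lemma K_strict_antimono: "0 \<le> x \<Longrightarrow> x < y \<Longrightarrow> K y < K x"
  using less_of_deriv_pos[of x y "\<lambda>x. - K x" "\<lambda>x. exp (- g x)"]
  by (force intro!: continuous_intros continuous_on_subset[OF K_cont] derivative_eq_intros K_deriv)

lemma K_pos: "x \<ge> 0 \<Longrightarrow> K x > 0"
proof -
  assume x: "x \<ge> 0"
  have "K (x + 1) \<ge> 0"
  proof (rule tendsto_upperbound[OF K_tendsto])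
    show "\<forall>\<^sub>F y in at_top. K y \<le> K (x + 1)"
      using K_strict_antimono[of "x + 1"] x
      by (intro eventually_mono[OF eventually_gt_at_top[of "x + 1"]]) (auto simp: less_imp_le)
  qed simp
  then show ?thesis using K_strict_antimono[of x "x + 1"] x by simp
qed

lemma K_cont' [continuous_intros]:
  "continuous_on A f \<Longrightarrow> continuous_on A (\<lambda>x. K (f x))"
  by (rule continuous_on_compose2[OF K_cont]) auto

lemma T'_cont: "continuous_on {0..} (\<lambda>y. 2 * exp (g y) * K y)"
  by (intro continuous_intros)

lemma T_cont: "continuous_on UNIV T"
  unfolding T_def using primitive_cont[OF T'_cont] .

lemma T_cont' [continuous_intros]:
  "continuous_on A f \<Longrightarrow> continuous_on A (\<lambda>x. T (f x))"
  by (rule continuous_on_compose2[OF T_cont]) auto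

lemma T_deriv: "x > 0 \<Longrightarrow> (T has_real_derivative 2 * exp (g x) * K x) (at x)"
  unfolding T_def using primitive_deriv[OF T'_cont] .

lemma T_0: "T 0 = 0"
  by (simp add: T_def)

lemma T_strict_mono: "0 \<le> x \<Longrightarrow> x < y \<Longrightarrow> T x < T y"
  by (rule less_of_deriv_pos[where f' = "\<lambda>x. 2 * exp (g x) * K x"])
    (auto intro!: T_deriv continuous_on_subset[OF T_cont] mult_pos_pos K_pos)

lemma T_mono: "0 \<le> x \<Longrightarrow> x \<le> y \<Longrightarrow> T x \<le> T y"
  using T_strict_mono[of x y] by (cases "x = y") auto

lemma T_pos: "x > 0 \<Longrightarrow> T x > 0"
  using T_strict_mono[of 0 x] by (simp add: T_0)

lemma nn_integral_tail:
  assumes "y > 0"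
  shows "(\<integral>\<^sup>+ \<xi>. indicator {y..} \<xi> * ennreal (exp (- g \<xi>)) \<partial>lborel) = ennreal (K y)"
proof -
  have "(\<integral>\<^sup>+ x. ennreal (exp (- g x)) * indicator {y..} x \<partial>lborel) = 0 - (- K y)"
    by (rule nn_integral_FTC_atLeast[where F = "\<lambda>x. - K x"])
      (use assms tendsto_minus[OF K_tendsto] in \<open>auto intro!: derivative_eq_intros K_deriv\<close>)
  then show ?thesis by (simp add: mult.commute)
qed

text \<open>The increments of \<open>T / 2\<close> are parts of the double integral in (H1). The
  estimate starts at 1 because the derivative of \<open>T\<close> is available only away from
  0.\<close>

lemma T_bounded: "\<exists>B. \<forall>x\<ge>0. T x \<le> B"
proof -
  let ?N = "\<integral>\<^sup>+ y. indicator {0..} y * ennreal (exp (g y)) *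
        (\<integral>\<^sup>+ \<xi>. indicator {y..} \<xi> * ennreal (exp (- g \<xi>)) \<partial>lborel) \<partial>lborel"
  have le: "T b - T a \<le> 2 * enn2real ?N" if ab: "0 < a" "a \<le> b" for a b
  proof -
    have "(\<integral>\<^sup>+ x. ennreal (exp (g x) * K x) * indicator {a..b} x \<partial>lborel) = ennreal (T b / 2 - T a / 2)"
    proof (rule nn_integral_FTC_Icc[where F = "\<lambda>x. T x / 2"])
      show "(\<lambda>x. exp (g x) * K x) \<in> borel_measurable borel"
        by (intro borel_measurable_continuous_onI continuous_intros)
      fix x assume x: "x \<in> {a..b}"
      show "((\<lambda>x. T x / 2) has_real_derivative exp (g x) * K x) (at x)"
        using DERIV_cdivide[OF T_deriv[of x], of 2] x ab by simp
      show "0 \<le> exp (g x) * K x"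
        using K_pos[of x] x ab by simp
    qed (use ab in auto)
    then have "ennreal (T b / 2 - T a / 2) = (\<integral>\<^sup>+ x. ennreal (exp (g x) * K x) * indicator {a..b} x \<partial>lborel)"
      by simp
    also have "\<dots> \<le> ?N"
    proof (intro nn_integral_mono)
      fix x :: real
      show "ennreal (exp (g x) * K x) * indicator {a..b} x \<le> indicator {0..} x * ennreal (exp (g x)) *
        (\<integral>\<^sup>+ \<xi>. indicator {x..} \<xi> * ennreal (exp (- g \<xi>)) \<partial>lborel)"
      proof (cases "x \<in> {a..b}")
        case True
        with ab have "x > 0" by simp
        with True show ?thesis by (simp add: nn_integral_tail ennreal_mult')
      qed simp
    qed
    finally have le: "ennreal (T b / 2 - T a / 2) \<le> ?N" .
    have "?N < \<infinity>" using h1 by (simp add: H1_def)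
    then have "?N = ennreal (enn2real ?N)" by simp
    with le have "ennreal (T b / 2 - T a / 2) \<le> ennreal (enn2real ?N)" by simp
    then have "T b / 2 - T a / 2 \<le> enn2real ?N" by (simp add: ennreal_le_iff)
    then show ?thesis by simp
  qed
  have "T x \<le> T 1 + 2 * enn2real ?N" if "x \<ge> 0" for x
  proof (cases "x \<ge> 1")
    case True
    then show ?thesis using le[of 1 x] by simp
  next
    case False
    then have "T x \<le> T 1" using T_mono[of x 1] that by simp
    moreover have "enn2real ?N \<ge> 0" by (rule enn2real_nonneg)
    ultimately show ?thesis by linarith
  qed
  then show ?thesis by blast
qed

lemma T_tendsto: "(T \<longlongrightarrow> Tinf) at_top"
proof -
  obtain B where B: "\<And>x. x \<ge> 0 \<Longrightarrow> T x \<le> B" using T_bounded by blast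
  obtain L where L: "(T \<longlongrightarrow> L) at_top"
    using mono_bounded_convergent_at_top[of 0 T B] T_mono B by blast
  then show ?thesis unfolding Tinf_def by (subst tendsto_Lim[OF _ L]) auto
qed

lemma T_le_Tinf: "x \<ge> 0 \<Longrightarrow> T x \<le> Tinf"
  by (rule tendsto_lowerbound[OF T_tendsto])
    (auto intro!: T_mono eventually_mono[OF eventually_ge_at_top[of x]])

lemma Tinf_pos: "Tinf > 0"
  using T_pos[of 1] T_le_Tinf[of 1] by simp

lemma Lam_cont: "continuous_on UNIV Lam"
  unfolding Lam_def using primitive_cont[OF exp_g_cont] .

lemma Lam_cont' [continuous_intros]:
  "continuous_on A f \<Longrightarrow> continuous_on A (\<lambda>x. Lam (f x))"
  by (rule continuous_on_compose2[OF Lam_cont]) auto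

lemma Lam_deriv: "x > 0 \<Longrightarrow> (Lam has_real_derivative exp (g x)) (at x)"
  unfolding Lam_def using primitive_deriv[OF exp_g_cont] .

lemma Lam_0: "Lam 0 = 0"
  by (simp add: Lam_def)

lemma Lam_strict_mono: "0 \<le> x \<Longrightarrow> x < y \<Longrightarrow> Lam x < Lam y"
  by (rule less_of_deriv_pos[where f' = "\<lambda>x. exp (g x)"])
    (auto intro!: Lam_deriv continuous_on_subset[OF Lam_cont])

lemma Lam_mono: "0 \<le> x \<Longrightarrow> x \<le> y \<Longrightarrow> Lam x \<le> Lam y"
  using Lam_strict_mono[of x y] by (cases "x = y") auto

lemma Lam_pos: "x > 0 \<Longrightarrow> Lam x > 0"
  using Lam_strict_mono[of 0 x] by (simp add: Lam_0)

lemma Lam_nonneg: "x \<ge> 0 \<Longrightarrow> Lam x \<ge> 0"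
  using Lam_mono[of 0 x] by (simp add: Lam_0)

text \<open>Since \<open>g\<close> tends to infinity, \<open>exp (g x)\<close> is eventually at
  least 1 and \<open>f\<close> grows at least linearly. Serves for \<open>Lam\<close> and later to
  rule out a nonzero limit of the flux of a bounded eigenfunction.\<close>

lemma primitive_exp_g_at_top:
  fixes f :: "real \<Rightarrow> real"
  assumes f: "\<And>x. x \<ge> a \<Longrightarrow> (f has_real_derivative f' x) (at x)"
    and ge: "\<And>x. x \<ge> a \<Longrightarrow> f' x \<ge> c * exp (g x)" and c: "c > 0"
  shows "filterlim f at_top at_top"
proof -
  have "\<forall>\<^sub>F x in at_top. g x \<ge> 0 \<and> x \<ge> a"
    using g_at_top eventually_ge_at_top[of a] by (auto simp: filterlim_at_top intro: eventually_conj)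
  then obtain X where X: "X \<ge> a" "\<And>x. x \<ge> X \<Longrightarrow> g x \<ge> 0"
    unfolding eventually_at_top_linorder by (metis order_refl)
  have "f x - c * x \<ge> f X - c * X" if "x \<ge> X" for x
  proof (rule le_of_deriv_nonneg'[where f = "\<lambda>x. f x - c * x" and f' = "\<lambda>x. f' x - c"])
    fix y assume y: "X \<le> y" "y \<le> x"
    have "c * 1 \<le> c * exp (g y)" using X y c by (intro mult_left_mono) auto
    also have "\<dots> \<le> f' y" using ge X y by simp
    finally show "0 \<le> f' y - c" by simp
    show "((\<lambda>x. f x - c * x) has_real_derivative f' y - c) (at y)"
      using f[of y] X y by (auto intro!: derivative_eq_intros)
  qed (use that in auto)
  then have "\<forall>\<^sub>F x in at_top. f X - c * X + c * x \<le> f x"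
    by (intro eventually_mono[OF eventually_ge_at_top[of X]]) force
  moreover have "filterlim (\<lambda>x. f X - c * X + c * x) at_top at_top"
    using c by (intro filterlim_tendsto_add_at_top[OF tendsto_const] filterlim_tendsto_pos_mult_at_top[OF tendsto_const] filterlim_ident) auto
  ultimately show ?thesis by (rule filterlim_at_top_mono[rotated])
qed

lemma Lam_at_top: "filterlim Lam at_top at_top"
  by (rule primitive_exp_g_at_top[where a = 1 and c = 1]) (auto intro!: Lam_deriv)

text \<open>The trace of the Green operator, cut off at \<open>R\<close>. In the derivative of
  \<open>T x - 2 * Lam x * K x\<close> the terms containing \<open>exp (g x) * K x\<close> cancel,
  which leaves the integrand.\<close>

lemma Lam_trace: "R \<ge> 0 \<Longrightarrow> integral {0..R} (\<lambda>x. mu_dens q x * Lam x) = T R - 2 * Lam R * K R"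
proof -
  assume R: "R \<ge> 0"
  have "((\<lambda>x. mu_dens q x * Lam x) has_integral (T R - 2 * Lam R * K R) - (T 0 - 2 * Lam 0 * K 0)) {0..R}"
  proof (rule fundamental_theorem_of_calculus_interior[OF R])
    show "continuous_on {0..R} (\<lambda>x. T x - 2 * Lam x * K x)"
      by (intro continuous_intros)
    show "((\<lambda>x. T x - 2 * Lam x * K x) has_vector_derivative mu_dens q x * Lam x) (at x)"
      if "x \<in> {0<..<R}" for x
      using that unfolding has_real_derivative_iff_has_vector_derivative[symmetric]
      by (auto intro!: derivative_eq_intros T_deriv Lam_deriv K_deriv simp: mu_dens_def exp_minus)
  qed
  then show ?thesis by (simp add: T_0 Lam_0 integral_unique)
qed

lemma mu_cont: "continuous_on UNIV (mu_dens q)"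
  unfolding mu_dens_def by (intro continuous_intros)

lemma mu_cont' [continuous_intros]:
  "continuous_on A f \<Longrightarrow> continuous_on A (\<lambda>x. mu_dens q (f x))"
  by (rule continuous_on_compose2[OF mu_cont]) auto

lemma mu_pos: "mu_dens q x > 0"
  by (simp add: mu_dens_def)

lemma mu_Lam_integrable: "set_integrable lborel {0<..} (\<lambda>x. mu_dens q x * Lam x)"
proof (rule nonneg_bounded_set_integrable[where B = Tinf])
  show "integral {0..R} (\<lambda>x. mu_dens q x * Lam x) \<le> Tinf" if "R \<ge> 0" for R
  proof -
    have "0 \<le> 2 * Lam R * K R"
      using that Lam_nonneg[of R] K_pos[of R] by (intro mult_nonneg_nonneg) auto
    then show ?thesis using Lam_trace[OF that] T_le_Tinf[OF that] by linarith
  qed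
qed (auto intro!: continuous_intros mult_nonneg_nonneg Lam_nonneg simp: less_imp_le mu_pos)

lemma mu_integrable: "set_integrable lborel {0<..} (mu_dens q)"
  using exp_minus_g_integrable unfolding mu_dens_def by (rule set_integrable_mult_right)

section \<open>Asymptotics of the tail and growth of the scale function under (H2) and (H3)\<close>

lemma H2_eventually: "\<exists>X>0. \<forall>x\<ge>X. q x \<ge> 1 \<and> \<bar>q' x / (q x)\<^sup>2\<bar> \<le> 1"
proof -
  have "\<forall>\<^sub>F x in at_top. \<bar>q' x / (q x)\<^sup>2\<bar> < 1"
    using h2 unfolding H2_def tendsto_iff by (auto dest: spec[of _ 1])
  then have "\<forall>\<^sub>F x in at_top. q x \<ge> 1 \<and> \<bar>q' x / (q x)\<^sup>2\<bar> \<le> 1 \<and> x > 0"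
    using q_at_top[unfolded filterlim_at_top, rule_format, of 1] eventually_gt_at_top[of 0]
    by eventually_elim auto
  then show ?thesis 
  proof (elim eventually_at_top_linorder[THEN iffD1, elim_format] exE)
    fix N assume N: "\<forall>n\<ge>N. q n \<ge> 1 \<and> \<bar>q' n / (q n)\<^sup>2\<bar> \<le> 1 \<and> n > 0"
    then show ?thesis by (intro exI[of _ "N"]) blast
  qed
qed

text \<open>Both \<open>K x\<close> and \<open>exp (- g x) / q x\<close> vanish at infinity, and by
  (H2) their derivatives differ by the factor \<open>2 + q' x / (q x)\<^sup>2\<close>, which lies
  between 1 and 3. Comparison from infinity shows that the derivative of \<open>T\<close> is of the
  order of \<open>1 / q x\<close>.\<close>

lemma K_bounds:
  "\<exists>X>0. \<forall>x\<ge>X. q x \<ge> 1 \<and> 2 * exp (g x) * K x \<le> 2 / q x \<and> 2 * exp (g x) * K x \<ge> 2 / (3 * q x)"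
proof -
  obtain X where X: "X > 0" "\<And>x. x \<ge> X \<Longrightarrow> q x \<ge> 1" "\<And>x. x \<ge> X \<Longrightarrow> \<bar>q' x / (q x)\<^sup>2\<bar> \<le> 1"
    using H2_eventually by blast
  let ?B = "\<lambda>x. exp (- g x) / q x"
  have B': "(?B has_real_derivative - (exp (- g x) * (2 + q' x / (q x)\<^sup>2))) (at x)" if "x \<ge> X" for x
  proof -
    have q: "q x \<noteq> 0" using X(2)[OF that] by simp
    have "(?B has_real_derivative (exp (- g x) * (- (2 * q x)) * q x - exp (- g x) * q' x) / (q x * q x)) (at x)"
      using that X(1) q by (auto intro!: derivative_eq_intros q_deriv)
    also have "(exp (- g x) * (- (2 * q x)) * q x - exp (- g x) * q' x) / (q x * q x)
        = - (exp (- g x) * (2 + q' x / (q x)\<^sup>2))"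
      using q by (simp add: field_simps power2_eq_square)
    finally show ?thesis .
  qed
  have B0: "(?B \<longlongrightarrow> 0) at_top"
  proof (rule tendsto_0_le[where K = 1 and f = "\<lambda>x. exp (- g x)"])
    show "((\<lambda>x. exp (- g x)) \<longlongrightarrow> 0) at_top"
      by (intro filterlim_compose[OF exp_at_bot] filterlim_compose[OF filterlim_uminus_at_bot_at_top] g_at_top)
    show "\<forall>\<^sub>F x in at_top. norm (?B x) \<le> norm (exp (- g x)) * 1"
    proof (rule eventually_mono[OF eventually_ge_at_top[of X]])
      fix x assume "X \<le> x"
      then have "1 \<le> \<bar>q x\<bar>" "q x \<noteq> 0" using X(2)[of x] by auto
      then show "norm (?B x) \<le> norm (exp (- g x)) * 1" by (simp add: field_simps)
    qed
  qed
  have up: "K x - ?B x \<le> 0" if "x \<ge> X" for x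
  proof (rule nondecreasing_le_at_top[where a = X and f = "\<lambda>x. K x - ?B x" and f' = "\<lambda>x. - exp (- g x) + exp (- g x) * (2 + q' x / (q x)\<^sup>2)"])
    show "((\<lambda>x. K x - ?B x) \<longlongrightarrow> 0) at_top"
      using tendsto_diff[OF K_tendsto B0] by simp
    fix y assume y: "X \<le> y"
    show "((\<lambda>x. K x - ?B x) has_real_derivative - exp (- g y) + exp (- g y) * (2 + q' y / (q y)\<^sup>2)) (at y)"
      using DERIV_diff[OF K_deriv B'[OF y]] X(1) y by simp
    have "exp (- g y) * 1 \<le> exp (- g y) * (2 + q' y / (q y)\<^sup>2)"
      using X(3)[OF y] unfolding abs_le_iff by (intro mult_left_mono) (linarith, simp)
    then show "0 \<le> - exp (- g y) + exp (- g y) * (2 + q' y / (q y)\<^sup>2)" by simp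
  qed (use that in auto)
  have low: "?B x - 3 * K x \<le> 0" if "x \<ge> X" for x
  proof (rule nondecreasing_le_at_top[where a = X and f = "\<lambda>x. ?B x - 3 * K x" and f' = "\<lambda>x. 3 * exp (- g x) - exp (- g x) * (2 + q' x / (q x)\<^sup>2)"])
    show "((\<lambda>x. ?B x - 3 * K x) \<longlongrightarrow> 0) at_top"
      using tendsto_diff[OF B0 tendsto_mult_left[OF K_tendsto, of 3]] by simp
    fix y assume y: "X \<le> y"
    show "((\<lambda>x. ?B x - 3 * K x) has_real_derivative 3 * exp (- g y) - exp (- g y) * (2 + q' y / (q y)\<^sup>2)) (at y)"
      using DERIV_diff[OF B'[OF y] DERIV_cmult[OF K_deriv, of y 3]] X(1) y by simp
    have "exp (- g y) * (2 + q' y / (q y)\<^sup>2) \<le> exp (- g y) * 3"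
      using X(3)[OF y] unfolding abs_le_iff by (intro mult_left_mono) (linarith, simp)
    then show "0 \<le> 3 * exp (- g y) - exp (- g y) * (2 + q' y / (q y)\<^sup>2)" by simp
  qed (use that in auto)
  have "q x \<ge> 1 \<and> 2 * exp (g x) * K x \<le> 2 / q x \<and> 2 * exp (g x) * K x \<ge> 2 / (3 * q x)" if "x \<ge> X" for x
  proof -
    have q: "q x > 0" using X(2)[OF that] by simp
    have "K x \<le> exp (- g x) / q x" "exp (- g x) / q x \<le> 3 * K x"
      using up[OF that] low[OF that] by auto
    then have "exp (g x) * K x \<le> exp (g x) * (exp (- g x) / q x)"
        "exp (g x) * (exp (- g x) / q x) \<le> exp (g x) * (3 * K x)"
      by (simp_all only: mult_left_mono exp_ge_zero)
    moreover have "exp (g x) * (exp (- g x) / q x) = 1 / q x" by (simp add: exp_minus)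
    ultimately have "exp (g x) * K x \<le> 1 / q x" "1 / q x \<le> 3 * (exp (g x) * K x)" by argo+
    moreover have "2 / (3 * q x) = 2 / 3 * (1 / q x)" "2 / q x = 2 * (1 / q x)" by simp_all
    ultimately show ?thesis using X(2)[OF that] by linarith
  qed
  then show ?thesis using X(1) by blast
qed

text \<open>By (H3) the integral of \<open>1 / q\<close> over \<open>[x/2, x]\<close>, which tends to \<open>0\<close> by (H1),
  is at least a constant times \<open>x / q x\<close>.\<close>

lemma id_over_q_small:
  assumes \<delta>: "\<delta> > 0"
  shows "\<forall>\<^sub>F x in at_top. x \<le> \<delta> * q x"
proof -
  obtain a x0 where a: "a > 0" and x0: "x0 \<ge> 0" and qa: "\<And>x y. x \<ge> x0 \<Longrightarrow> y \<ge> x \<Longrightarrow> q y \<ge> a * q x"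
    using h3 unfolding H3_def by blast
  obtain X where X: "X > 0" "\<And>x. x \<ge> X \<Longrightarrow> q x \<ge> 1"
      "\<And>x. x \<ge> X \<Longrightarrow> 2 * exp (g x) * K x \<ge> 2 / (3 * q x)"
    using K_bounds by blast
  have "\<forall>\<^sub>F x in at_top. T x > Tinf - a * \<delta> / 3"
    using a \<delta> by (intro order_tendstoD(1)[OF T_tendsto]) simp
  then obtain Y where Y: "\<And>x. x \<ge> Y \<Longrightarrow> T x > Tinf - a * \<delta> / 3"
    unfolding eventually_at_top_linorder by blast
  define Z where "Z = 2 * max (max X x0) (max Y 1)"
  have "x \<le> \<delta> * q x" if "x \<ge> Z" for x
  proof -
    have x: "x / 2 \<ge> X" "x / 2 \<ge> x0" "x / 2 \<ge> Y" "x \<ge> 2" using that by (auto simp: Z_def)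
    have qx: "q x \<ge> 1" using X(2)[of x] x by simp
    \<comment> \<open>By (H3), \<open>a * q y \<le> q x\<close> for \<open>y\<close> in
      \<open>{x / 2..x}\<close>, so \<open>?c\<close> bounds the derivative of \<open>T\<close> from
      below there. The resulting increment is \<open>a * x / (3 * q x)\<close>, which explains the
      threshold \<open>a * \<delta> / 3\<close>.\<close>
    let ?c = "2 * a / (3 * q x)"
    have "T (x / 2) - ?c * (x / 2) \<le> T x - ?c * x"
    proof (rule le_of_deriv_nonneg'[where f = "\<lambda>y. T y - ?c * y" and f' = "\<lambda>y. 2 * exp (g y) * K y - ?c"])
      fix y assume y: "x / 2 \<le> y" "y \<le> x"
      show "((\<lambda>y. T y - ?c * y) has_real_derivative 2 * exp (g y) * K y - ?c) (at y)"
        using DERIV_diff[OF T_deriv DERIV_cmult_Id, of y ?c] y x by simp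
      have qy: "q y \<ge> 1" using X(2)[of y] x y by simp
      have "a * q y \<le> q x" using qa[of y x] x y by simp
      then have "?c \<le> 2 / (3 * q y)"
        using qx qy a by (simp add: field_simps)
      then show "0 \<le> 2 * exp (g y) * K y - ?c"
        using X(3)[of y] x y by simp
    qed (use x in auto)
    moreover have "T x \<le> Tinf" using x by (intro T_le_Tinf) simp
    moreover have "T (x / 2) > Tinf - a * \<delta> / 3" using Y x by simp
    ultimately have "?c * x - ?c * (x / 2) < a * \<delta> / 3" by linarith
    then have "a * x / (3 * q x) < a * \<delta> / 3" by (simp add: field_simps)
    then show ?thesis using a qx by (simp add: field_simps)
  qed
  then show ?thesis unfolding eventually_at_top_linorder by blast
qed

text \<open>With \<open>l\<close> an eigenvalue, \<open>X\<close> separates the region where the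
  eigenfunction is bounded through \<open>Lam X\<close> from the one where a supersolution works. It
  is chosen with \<open>q X\<close> of order \<open>sqrt l\<close>; then \<open>X\<close> is small
  compared with \<open>sqrt l\<close>, so \<open>g\<close> gains at most a small multiple of
  \<open>l\<close> up to \<open>X\<close>.\<close>

lemma Lam_subexponential:
  assumes \<epsilon>: "\<epsilon> > 0"
  shows "\<forall>\<^sub>F l in at_top. \<exists>X>0. (\<forall>x\<ge>X. 2 * l * (2 * exp (g x) * K x)\<^sup>2 \<le> 1) \<and>
    Lam X \<le> exp (\<epsilon> * l) \<and> Tinf - T X \<le> \<epsilon>"
proof -
  obtain a x0 where a: "a > 0" and x0: "x0 \<ge> 0" and qa: "\<And>x y. x \<ge> x0 \<Longrightarrow> y \<ge> x \<Longrightarrow> q y \<ge> a * q x"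
    using h3 unfolding H3_def by blast
  obtain X where X: "X > 0" "\<And>x. x \<ge> X \<Longrightarrow> q x \<ge> 1"
      "\<And>x. x \<ge> X \<Longrightarrow> 2 * exp (g x) * K x \<le> 2 / q x"
    using K_bounds by blast
  \<comment> \<open>Makes the growth bound \<open>2 * \<delta> / a * v\<^sup>2\<close> with
    \<open>v\<^sup>2 = 8 * l / a\<^sup>2\<close> equal to \<open>\<epsilon> / 2 * l\<close>.\<close>
  define \<delta> where "\<delta> = \<epsilon> * a ^ 3 / 32"
  have \<delta>: "\<delta> > 0" using \<epsilon> a by (simp add: \<delta>_def)
  have "\<forall>\<^sub>F x in at_top. T x > Tinf - \<epsilon>"
    using \<epsilon> by (intro order_tendstoD(1)[OF T_tendsto]) simp
  then have "\<forall>\<^sub>F x in at_top. T x > Tinf - \<epsilon> \<and> x \<le> \<delta> * q x"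
    using id_over_q_small[OF \<delta>] by (rule eventually_conj)
  then obtain Y where Y: "\<And>x. x \<ge> Y \<Longrightarrow> T x > Tinf - \<epsilon>" "\<And>x. x \<ge> Y \<Longrightarrow> x \<le> \<delta> * q x"
    unfolding eventually_at_top_linorder by blast
  define x1 where "x1 = max (max X x0) (max Y 1)"
  have x1: "x1 \<ge> X" "x1 \<ge> x0" "x1 \<ge> Y" "x1 \<ge> 1" by (auto simp: x1_def)
  \<comment> \<open>Collects the factors of the bound on \<open>Lam Z\<close> that do not depend on
    \<open>l\<close>; the 3 comes from \<open>sqrt (8 * l) \<le> 3 * (1 + l)\<close>.\<close>
  define A where "A = Lam x1 + \<delta> / a * exp (g x1) * 3"
  have ex: "\<exists>X>0. (\<forall>x\<ge>X. 2 * l * (2 * exp (g x) * K x)\<^sup>2 \<le> 1) \<and>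
      Lam X \<le> exp (\<epsilon> * l) \<and> Tinf - T X \<le> \<epsilon>"
    if l: "l \<ge> 1" "sqrt (8 * l) / a \<ge> q x1" "A * (1 + l) \<le> exp (\<epsilon> / 2 * l)" for l
  proof -
    define v where "v = sqrt (8 * l) / a"
    have v: "v > 0" "a * v = sqrt (8 * l)" "v\<^sup>2 = 8 * l / a\<^sup>2"
      using l a by (auto simp: v_def power_divide)
    \<comment> \<open>Fixing the value of \<open>q\<close> at \<open>Z\<close> lets (H3) work in
      both directions: beyond \<open>Z\<close>, \<open>q\<close> is at least
      \<open>a * v = sqrt (8 * l)\<close>, and between \<open>x1\<close> and \<open>Z\<close> it is
      at most \<open>v / a\<close>.\<close>
    obtain Z where Z: "Z \<ge> x1" "q Z = v"
    proof -
      have "\<forall>\<^sub>F x in at_top. q x \<ge> v \<and> x \<ge> x1"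
        using q_at_top[unfolded filterlim_at_top, rule_format, of v] eventually_ge_at_top[of x1]
        by (rule eventually_conj)
      then obtain W where W: "q W \<ge> v" "W \<ge> x1"
        using eventually_happens'[OF trivial_limit_at_top_linorder] by blast
      have "\<exists>x\<ge>x1. x \<le> W \<and> q x = v"
        using W l x1 by (intro IVT') (auto simp: v_def intro!: continuous_on_subset[OF q_cont])
      then show ?thesis using that by blast
    qed
    have Zpos: "Z > 0" using Z x1 by simp
    have small: "2 * l * (2 * exp (g x) * K x)\<^sup>2 \<le> 1" if "x \<ge> Z" for x
    proof -
      have q: "q x \<ge> sqrt (8 * l)" using qa[of Z x] that Z x1 v by simp
      have s: "sqrt (8 * l) > 0" using l by simp
      have "2 * exp (g x) * K x \<le> 2 / q x" using X(3)[of x] that Z x1 by simp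
      also have "\<dots> \<le> 2 / sqrt (8 * l)" using q s by (intro divide_left_mono mult_pos_pos less_le_trans[OF s q]) auto
      finally have "(2 * exp (g x) * K x)\<^sup>2 \<le> (2 / sqrt (8 * l))\<^sup>2"
        using K_pos[of x] that Zpos by (intro power_mono) auto
      also have "\<dots> = 1 / (2 * l)" using l by (simp add: power_divide)
      finally show ?thesis using l by (simp add: field_simps)
    qed
    have gle: "g y \<le> g x1 + \<epsilon> / 2 * l" if y: "x1 \<le> y" "y \<le> Z" for y
    proof -
      have "2 * v / a * x1 - g x1 \<le> 2 * v / a * y - g y"
      proof (rule le_of_deriv_nonneg'[where f = "\<lambda>y. 2 * v / a * y - g y" and f' = "\<lambda>y. 2 * v / a - 2 * q y"])
        fix w assume w: "x1 \<le> w" "w \<le> y"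
        show "((\<lambda>y. 2 * v / a * y - g y) has_real_derivative 2 * v / a - 2 * q w) (at w)"
          using DERIV_diff[OF DERIV_cmult_Id g_deriv, of w "2 * v / a"] w x1 by simp
        have "a * q w \<le> v" using qa[of w Z] w y x1 Z by simp
        then show "0 \<le> 2 * v / a - 2 * q w" using a by (simp add: field_simps)
      qed (use y in auto)
      then have "g y \<le> g x1 + 2 * v / a * (y - x1)" by (simp add: right_diff_distrib)
      also have "2 * v / a * (y - x1) \<le> 2 * v / a * Z" using v a y x1 by (intro mult_left_mono) auto
      also have "2 * v / a * Z \<le> 2 * v / a * (\<delta> * v)"
        using Y(2)[of Z] Z x1 v a by (intro mult_left_mono) auto
      also have "2 * v / a * (\<delta> * v) = 2 * \<delta> / a * v\<^sup>2" by (simp add: power2_eq_square)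
      also have "\<dots> = \<epsilon> / 2 * l" using a unfolding v(3) by (simp add: \<delta>_def field_simps power2_eq_square power3_eq_cube)
      finally show ?thesis by simp
    qed
    define E where "E = exp (g x1 + \<epsilon> / 2 * l)"
    have "Lam Z - E * Z \<le> Lam x1 - E * x1"
    proof -
      have "E * x1 - Lam x1 \<le> E * Z - Lam Z"
      proof (rule le_of_deriv_nonneg'[where f = "\<lambda>y. E * y - Lam y" and f' = "\<lambda>y. E - exp (g y)"])
        fix w assume w: "x1 \<le> w" "w \<le> Z"
        show "((\<lambda>y. E * y - Lam y) has_real_derivative E - exp (g w)) (at w)"
          using DERIV_diff[OF DERIV_cmult_Id Lam_deriv, of w E] w x1 by simp
        show "0 \<le> E - exp (g w)" using gle[OF w] by (simp add: E_def)
      qed (use Z in auto)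
      then show ?thesis by simp
    qed
    moreover have "E * x1 \<ge> 0" using x1 by (simp add: E_def)
    ultimately have "Lam Z \<le> Lam x1 + E * Z" by linarith
    also have "E * Z \<le> E * (\<delta> * v)" using Y(2)[of Z] Z x1 by (intro mult_left_mono) (auto simp: E_def)
    also have "E * (\<delta> * v) = \<delta> / a * exp (g x1) * sqrt (8 * l) * exp (\<epsilon> / 2 * l)"
      by (simp add: E_def v_def exp_add)
    also have "\<dots> \<le> \<delta> / a * exp (g x1) * (3 * (1 + l)) * exp (\<epsilon> / 2 * l)"
    proof -
      have "sqrt (8 * l) \<le> 3 * (1 + l)"
        using l by (intro real_le_lsqrt) (auto simp: power2_eq_square algebra_simps)
      then show ?thesis using \<delta> a by (intro mult_right_mono mult_left_mono) auto
    qed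
    also have "Lam x1 + \<dots> \<le> A * (1 + l) * exp (\<epsilon> / 2 * l)"
    proof -
      have "1 * 1 \<le> (1 + l) * exp (\<epsilon> / 2 * l)"
        using l \<epsilon> by (intro mult_mono) auto
      then have "Lam x1 * 1 \<le> Lam x1 * ((1 + l) * exp (\<epsilon> / 2 * l))"
        using Lam_nonneg[of x1] x1 by (intro mult_left_mono) auto
      then show ?thesis by (simp add: A_def algebra_simps add_divide_distrib)
    qed
    also have "\<dots> \<le> exp (\<epsilon> / 2 * l) * exp (\<epsilon> / 2 * l)"
      using l by (intro mult_right_mono) auto
    also have "\<dots> = exp (\<epsilon> * l)" by (simp flip: exp_add)
    finally have "Lam Z \<le> exp (\<epsilon> * l)" by simp
    moreover have "Tinf - T Z \<le> \<epsilon>" using Y(1)[of Z] Z x1 by simp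
    ultimately show ?thesis using small Zpos by blast
  qed
  have "\<forall>\<^sub>F l in at_top. A * (1 + l) \<le> exp (\<epsilon> / 2 * l)"
  proof -
    \<comment> \<open>With \<open>y = \<epsilon> / 2 * l\<close> this expression is
      \<open>A * (1 + l) / exp y\<close>, split into powers over the exponential.\<close>
    have "((\<lambda>y. A * (y ^ 0 / exp y) + 2 * A / \<epsilon> * (y ^ 1 / exp y)) \<longlongrightarrow> A * 0 + 2 * A / \<epsilon> * 0) at_top"
      by (intro tendsto_intros tendsto_power_div_exp_0)
    then have "\<forall>\<^sub>F y in at_top. A * (y ^ 0 / exp y) + 2 * A / \<epsilon> * (y ^ 1 / exp y) < 1"
      by (rule order_tendstoD) simp
    moreover have "filterlim (\<lambda>l. \<epsilon> / 2 * l) at_top at_top"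
      using \<epsilon> by (intro filterlim_tendsto_pos_mult_at_top[OF tendsto_const] filterlim_ident) auto
    ultimately have "\<forall>\<^sub>F l in at_top. A * ((\<epsilon> / 2 * l) ^ 0 / exp (\<epsilon> / 2 * l)) +
        2 * A / \<epsilon> * ((\<epsilon> / 2 * l) ^ 1 / exp (\<epsilon> / 2 * l)) < 1"
      by (rule eventually_compose_filterlim)
    then show ?thesis
      by eventually_elim (use \<epsilon> in \<open>simp add: field_simps\<close>)
  qed
  moreover have "\<forall>\<^sub>F l in at_top. sqrt (8 * l) / a \<ge> q x1"
  proof -
    have "filterlim (\<lambda>l. 1 / a * sqrt (8 * l)) at_top at_top"
      using a by (intro filterlim_tendsto_pos_mult_at_top[OF tendsto_const]
        filterlim_compose[OF sqrt_at_top] filterlim_ident) auto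
    then show ?thesis unfolding filterlim_at_top by simp
  qed
  ultimately show ?thesis using eventually_ge_at_top[of 1]
    by eventually_elim (use ex in auto)
qed

end

lemma tendsto_at_right_0:
  fixes f :: "real \<Rightarrow> real"
  assumes "continuous_on UNIV f"
  shows "(f \<longlongrightarrow> f 0) (at_right 0)"
proof -
  have "isCont f 0" using assms by (simp add: continuous_on_eq_continuous_at)
  then show ?thesis unfolding isCont_def by (rule filterlim_mono) (auto intro: at_le)
qed

section \<open>Eigenfunctions: fluxes, energy and sup norm\<close>

locale entrance_spectrum = entrance_drift +
  fixes lam :: "nat \<Rightarrow> real" and psi :: "nat \<Rightarrow> real \<Rightarrow> real"
  assumes spec: "spectral_system q lam psi"
    and bdd: "\<And>k. bounded (psi k ` {0..})"
    and lim: "\<And>k. \<exists>L. (psi k \<longlongrightarrow> L) at_top"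
begin

abbreviation mu :: "real \<Rightarrow> real" where "mu \<equiv> mu_dens q"

text \<open>The derivative of \<open>psi k\<close> with respect to the scale function, which removes
  the first-order term from the eigenvalue equation. It is picked by \<open>SOME\<close> because the
  spectral system asserts the derivatives only existentially.\<close>

definition flux :: "nat \<Rightarrow> real \<Rightarrow> real" where
  "flux k = (SOME D. \<forall>x>0. (psi k has_real_derivative exp (g x) * D x) (at x) \<and>
     (D has_real_derivative - (lam k * mu x * psi k x)) (at x))"

definition M :: "nat \<Rightarrow> real" where
  "M k = (SUP x\<in>{0..}. \<bar>psi k x\<bar>)"

lemma lam_pos: "lam k > 0"
proof -
  have "lam 0 \<le> lam k"
    using spec unfolding spectral_system_def by (simp add: strict_mono_less_eq)
  moreover have "0 < lam 0" using spec unfolding spectral_system_def by blast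
  ultimately show ?thesis by simp
qed

lemma lam_mono: "strict_mono lam"
  using spec unfolding spectral_system_def by blast

lemma psi_cont: "continuous_on {0..} (psi k)"
  using spec unfolding spectral_system_def by blast

lemma psi_0: "psi k 0 = 0"
  using spec unfolding spectral_system_def by blast

lemma orthonormal:
  "set_integrable lborel {0<..} (\<lambda>x. mu x * psi j x * psi k x)"
  "(LINT x:{0<..}|lborel. mu x * psi j x * psi k x) = (if j = k then 1 else 0)"
  using spec unfolding spectral_system_def by blast+

lemma complete:
  assumes "f \<in> borel_measurable lborel" "set_integrable lborel {0<..} (\<lambda>x. mu x * (f x)\<^sup>2)"
    and "\<And>k. (LINT x:{0<..}|lborel. mu x * f x * psi k x) = 0"
  shows "AE x in lborel. x > 0 \<longrightarrow> f x = 0"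
  using spec assms unfolding spectral_system_def by blast

lemma flux_ex: "\<forall>x>0. (psi k has_real_derivative exp (g x) * flux k x) (at x) \<and>
     (flux k has_real_derivative - (lam k * mu x * psi k x)) (at x)"
proof -
  obtain d1 d2 where d: "\<And>x. x > 0 \<Longrightarrow> (psi k has_real_derivative d1 x) (at x)"
      "\<And>x. x > 0 \<Longrightarrow> (d1 has_real_derivative d2 x) (at x)"
      "\<And>x. x > 0 \<Longrightarrow> d2 x / 2 - q x * d1 x = - lam k * psi k x"
    using spec unfolding spectral_system_def by blast
  have "\<forall>x>0. (psi k has_real_derivative exp (g x) * (exp (- g x) * d1 x)) (at x) \<and>
     ((\<lambda>x. exp (- g x) * d1 x) has_real_derivative - (lam k * mu x * psi k x)) (at x)"
  proof (intro allI impI conjI)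
    fix x :: real assume x: "x > 0"
    show "(psi k has_real_derivative exp (g x) * (exp (- g x) * d1 x)) (at x)"
    proof -
      have "exp (g x) * (exp (- g x) * d1 x) = d1 x"
        by (simp add: exp_minus)
      then show ?thesis using d(1)[OF x] by (simp only:)
    qed
    have "((\<lambda>x. exp (- g x) * d1 x) has_real_derivative
        (exp (- g x) * (- (2 * q x))) * d1 x + d2 x * exp (- g x)) (at x)"
      by (rule DERIV_mult) (use x in \<open>auto intro!: derivative_eq_intros d(2)\<close>)
    also have "(exp (- g x) * (- (2 * q x))) * d1 x + d2 x * exp (- g x)
        = 2 * exp (- g x) * (d2 x / 2 - q x * d1 x)"
      by (simp add: algebra_simps)
    also have "\<dots> = - (lam k * mu x * psi k x)"
      unfolding d(3)[OF x] by (simp add: mu_dens_def)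
    finally show "((\<lambda>x. exp (- g x) * d1 x) has_real_derivative - (lam k * mu x * psi k x)) (at x)" .
  qed
  then show ?thesis unfolding flux_def by (rule someI[of "\<lambda>D. \<forall>x>0. (psi k has_real_derivative exp (g x) * D x) (at x) \<and>
     (D has_real_derivative - (lam k * mu x * psi k x)) (at x)"])
qed

lemma psi_deriv: "x > 0 \<Longrightarrow> (psi k has_real_derivative exp (g x) * flux k x) (at x)"
  and flux_deriv: "x > 0 \<Longrightarrow> (flux k has_real_derivative - (lam k * mu x * psi k x)) (at x)"
  using flux_ex[of k] by simp_all

lemma psi_le_M: "x \<ge> 0 \<Longrightarrow> \<bar>psi k x\<bar> \<le> M k"
proof -
  assume x: "x \<ge> 0"
  obtain B where B: "\<And>y. y \<in> psi k ` {0..} \<Longrightarrow> norm y \<le> B"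
    using bdd[of k] unfolding bounded_iff by blast
  have "bdd_above ((\<lambda>x. \<bar>psi k x\<bar>) ` {0..})"
    using B by (intro bdd_aboveI2[of _ _ B]) auto
  then show ?thesis unfolding M_def using x by (intro cSUP_upper) auto
qed

lemma M_leI: "(\<And>x. x \<ge> 0 \<Longrightarrow> \<bar>psi k x\<bar> \<le> B) \<Longrightarrow> M k \<le> B"
  unfolding M_def by (intro cSUP_least) auto

lemma M_nonneg: "M k \<ge> 0"
  using psi_le_M[of 0 k] by simp

lemma psi_le_M': "x \<ge> 0 \<Longrightarrow> psi k x \<le> M k" "x \<ge> 0 \<Longrightarrow> - psi k x \<le> M k"
  using psi_le_M[of x k] by (auto simp: abs_le_iff)

lemma psi_at_right: "(psi k \<longlongrightarrow> 0) (at_right 0)"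
proof -
  have "(psi k \<longlongrightarrow> psi k 0) (at 0 within {0..})"
    using psi_cont[of k] unfolding continuous_on_def by auto
  then have "(psi k \<longlongrightarrow> psi k 0) (at_right 0)"
    by (rule tendsto_within_subset) auto
  then show ?thesis by (simp add: psi_0)
qed

text \<open>A nonzero limit of the flux would make the eigenfunction grow like the scale function.\<close>

lemma flux_tendsto: "(flux k \<longlongrightarrow> 0) at_top"
proof -
  \<comment> \<open>Chosen so that the derivative of \<open>?c * K x\<close> dominates that of the
    flux in absolute value. Then \<open>flux k - ?c * K\<close> increases,
    \<open>flux k + ?c * K\<close> decreases, and the flux converges.\<close>
  let ?c = "2 * lam k * M k"
  have mono1: "flux k x - ?c * K x \<le> flux k y - ?c * K y" if "1 \<le> x" "x \<le> y" for x y
  proof (rule le_of_deriv_nonneg'[where f = "\<lambda>x. flux k x - ?c * K x" and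
        f' = "\<lambda>x. - (lam k * mu x * psi k x) - ?c * (- exp (- g x))"])
    fix z assume z: "x \<le> z" "z \<le> y"
    show "((\<lambda>x. flux k x - ?c * K x) has_real_derivative
        - (lam k * mu z * psi k z) - ?c * (- exp (- g z))) (at z)"
      using z that by (intro DERIV_diff DERIV_cmult flux_deriv K_deriv) auto
    have "lam k * mu z * psi k z \<le> lam k * mu z * M k"
      using lam_pos[of k] mu_pos[of z] z that by (intro mult_left_mono psi_le_M') auto
    then show "0 \<le> - (lam k * mu z * psi k z) - ?c * (- exp (- g z))"
      by (simp add: mu_dens_def mult_ac)
  qed (use that in auto)
  have mono2: "flux k y + ?c * K y \<le> flux k x + ?c * K x" if "1 \<le> x" "x \<le> y" for x y
  proof -
    have "- flux k x - ?c * K x \<le> - flux k y - ?c * K y"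
    proof (rule le_of_deriv_nonneg'[where f = "\<lambda>x. - flux k x - ?c * K x" and
          f' = "\<lambda>x. - (- (lam k * mu x * psi k x)) - ?c * (- exp (- g x))"])
      fix z assume z: "x \<le> z" "z \<le> y"
      show "((\<lambda>x. - flux k x - ?c * K x) has_real_derivative
          - (- (lam k * mu z * psi k z)) - ?c * (- exp (- g z))) (at z)"
        using z that by (intro DERIV_diff DERIV_minus DERIV_cmult flux_deriv K_deriv) auto
      have "lam k * mu z * (- psi k z) \<le> lam k * mu z * M k"
        using lam_pos[of k] mu_pos[of z] z that by (intro mult_left_mono psi_le_M') auto
      then show "0 \<le> - (- (lam k * mu z * psi k z)) - ?c * (- exp (- g z))"
        by (simp add: mu_dens_def mult_ac)
    qed (use that in auto)
    then show ?thesis by simp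
  qed
  have "flux k x - ?c * K x \<le> flux k 1 + ?c * K 1" if "1 \<le> x" for x
  proof -
    have "0 \<le> ?c * K x" using lam_pos[of k] M_nonneg[of k] K_pos[of x] that by simp
    then show ?thesis using mono2[of 1 x] that by linarith
  qed
  then obtain L where "((\<lambda>x. flux k x - ?c * K x) \<longlongrightarrow> L) at_top"
    using mono_bounded_convergent_at_top[of 1 "\<lambda>x. flux k x - ?c * K x"] mono1 by blast
  from tendsto_add[OF this tendsto_mult_left[OF K_tendsto, of ?c]]
  have L: "(flux k \<longlongrightarrow> L) at_top" by simp
  \<comment> \<open>\<open>s\<close> is the sign of the supposed limit. The derivative of
    \<open>s * psi k x\<close> would eventually exceed \<open>c / 2 * exp (g x)\<close>, forcing the
    bounded \<open>psi k\<close> to infinity.\<close>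
  have no_limit: False
    if s: "\<bar>s\<bar> = 1" "((\<lambda>x. s * flux k x) \<longlongrightarrow> c) at_top" "c > 0" for s c
  proof -
    have "\<forall>\<^sub>F x in at_top. s * flux k x > c / 2 \<and> x > 0"
      using order_tendstoD(1)[OF s(2), of "c / 2"] s(3) eventually_gt_at_top[of 0]
      by (simp add: eventually_conj)
    then obtain X where X: "\<And>x. x \<ge> X \<Longrightarrow> s * flux k x > c / 2" "\<And>x. x \<ge> X \<Longrightarrow> x > 0"
      unfolding eventually_at_top_linorder by blast
    have "filterlim (\<lambda>x. s * psi k x) at_top at_top"
    proof (rule primitive_exp_g_at_top[where a = X and c = "c / 2" and f' = "\<lambda>x. s * (exp (g x) * flux k x)"])
      fix x assume x: "x \<ge> X"
      show "((\<lambda>x. s * psi k x) has_real_derivative s * (exp (g x) * flux k x)) (at x)"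
        using X(2)[OF x] by (intro DERIV_cmult psi_deriv)
      have "c / 2 * exp (g x) \<le> (s * flux k x) * exp (g x)"
        using X(1)[OF x] by (intro mult_right_mono) auto
      then show "c / 2 * exp (g x) \<le> s * (exp (g x) * flux k x)" by (simp add: mult_ac)
    qed (use s in auto)
    then have "\<forall>\<^sub>F x in at_top. M k + 1 \<le> s * psi k x"
      unfolding filterlim_at_top by blast
    then have "\<forall>\<^sub>F x in at_top. M k + 1 \<le> s * psi k x \<and> x \<ge> 0"
      using eventually_ge_at_top[of 0] by (rule eventually_conj)
    then obtain x where x: "M k + 1 \<le> s * psi k x" "x \<ge> 0"
      using eventually_happens'[OF trivial_limit_at_top_linorder] by blast
    have "s * psi k x \<le> \<bar>s * psi k x\<bar>" by simp
    also have "\<dots> = \<bar>psi k x\<bar>" using s(1) by (simp add: abs_mult)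
    also have "\<dots> \<le> M k" using x(2) by (rule psi_le_M)
    finally show False using x(1) by simp
  qed
  have "\<not> L > 0" using no_limit[of 1 L] L by auto
  moreover have "\<not> L < 0" using no_limit[of "-1" "- L"] tendsto_minus[OF L] by auto
  ultimately have "L = 0" by simp
  with L show ?thesis by simp
qed

text \<open>Where the derivative of the flux is dominated by the rate of decrease of
  \<open>W\<close>, both \<open>flux k - W\<close> and \<open>- flux k - W\<close> are
  nondecreasing. As the flux vanishes at infinity and \<open>W\<close> is nonnegative, neither can
  be positive.\<close>

lemma flux_compare:
  assumes X: "X > 0" and W: "\<And>x. x \<ge> X \<Longrightarrow> (W has_real_derivative - W' x) (at x)"
    and le: "\<And>x. x \<ge> X \<Longrightarrow> lam k * mu x * \<bar>psi k x\<bar> \<le> W' x"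
    and nn: "\<And>x. x \<ge> X \<Longrightarrow> W x \<ge> 0" and x: "x \<ge> X"
  shows "\<bar>flux k x\<bar> \<le> W x"
proof -
  have *: "s * flux k x \<le> W x" if s: "s = 1 \<or> s = -1" for s :: real
  proof (rule tendsto_lowerbound)
    show "((\<lambda>y. s * flux k y + W x) \<longlongrightarrow> W x) at_top"
      using tendsto_add[OF tendsto_mult_left[OF flux_tendsto, of s k] tendsto_const[of "W x"]] by simp
    show "\<forall>\<^sub>F y in at_top. s * flux k x \<le> s * flux k y + W x"
    proof (rule eventually_mono[OF eventually_ge_at_top[of x]])
      fix y assume y: "x \<le> y"
      have "s * flux k x - W x \<le> s * flux k y - W y"
      proof (rule le_of_deriv_nonneg'[where f = "\<lambda>x. s * flux k x - W x" and
            f' = "\<lambda>x. s * (- (lam k * mu x * psi k x)) - (- W' x)"])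
        fix z assume z: "x \<le> z" "z \<le> y"
        show "((\<lambda>x. s * flux k x - W x) has_real_derivative
            s * (- (lam k * mu z * psi k z)) - (- W' z)) (at z)"
          using z x X by (intro DERIV_diff DERIV_cmult flux_deriv W) auto
        have "lam k * mu z * (s * psi k z) \<le> lam k * mu z * \<bar>psi k z\<bar>"
          using lam_pos[of k] mu_pos[of z] s by (intro mult_left_mono) auto
        then show "0 \<le> s * (- (lam k * mu z * psi k z)) - (- W' z)"
          using le[of z] z x by (simp add: mult_ac)
      qed (use y in auto)
      then show "s * flux k x \<le> s * flux k y + W x" using nn[of y] x y by simp
    qed
  qed simp
  show ?thesis using *[of 1] *[of "-1"] by simp
qed

lemma flux_bound: "x > 0 \<Longrightarrow> \<bar>flux k x\<bar> \<le> 2 * lam k * M k * K x"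
proof (rule flux_compare[where X = x and W' = "\<lambda>x. 2 * lam k * M k * exp (- g x)"])
  fix y assume x: "x > 0" and y: "y \<ge> x"
  show "((\<lambda>x. 2 * lam k * M k * K x) has_real_derivative - (2 * lam k * M k * exp (- g y))) (at y)"
    using DERIV_cmult[OF K_deriv, of y "2 * lam k * M k"] x y by simp
  have "lam k * mu y * \<bar>psi k y\<bar> \<le> lam k * mu y * M k"
    using lam_pos[of k] mu_pos[of y] x y by (intro mult_left_mono psi_le_M) auto
  then show "lam k * mu y * \<bar>psi k y\<bar> \<le> 2 * lam k * M k * exp (- g y)"
    by (simp add: mu_dens_def mult_ac)
  show "0 \<le> 2 * lam k * M k * K y"
    using lam_pos[of k] M_nonneg[of k] K_pos[of y] x y by simp
qed auto

lemma psi_cont': "a \<ge> 0 \<Longrightarrow> continuous_on {a..b} (psi k)"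
  by (rule continuous_on_subset[OF psi_cont]) auto

text \<open>The flux bound makes the derivative of \<open>psi k\<close> at most
  \<open>lam k * M k\<close> times that of \<open>T\<close>. Taking \<open>x = 0\<close>, or letting
  \<open>y\<close> tend to infinity, yields the two factors of the final error estimate.\<close>

lemma psi_diff: 
  assumes "0 \<le> x" "x \<le> y"
  shows "\<bar>psi k y - psi k x\<bar> \<le> lam k * M k * (T y - T x)"
proof -
  let ?c = "lam k * M k"
  have *: "?c * T x - s * psi k x \<le> ?c * T y - s * psi k y" if s: "s = 1 \<or> s = -1" for s :: real
  proof (rule le_of_deriv_nonneg[where f = "\<lambda>x. ?c * T x - s * psi k x" and
        f' = "\<lambda>x. ?c * (2 * exp (g x) * K x) - s * (exp (g x) * flux k x)"])
    show "continuous_on {x..y} (\<lambda>x. ?c * T x - s * psi k x)"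
      using assms by (intro continuous_intros psi_cont')
    fix z assume z: "x < z" "z < y"
    show "((\<lambda>x. ?c * T x - s * psi k x) has_real_derivative
        ?c * (2 * exp (g z) * K z) - s * (exp (g z) * flux k z)) (at z)"
      using z assms by (intro DERIV_diff DERIV_cmult psi_deriv T_deriv) auto
    have "s * flux k z \<le> \<bar>flux k z\<bar>" using s by auto
    also have "\<dots> \<le> 2 * ?c * K z" using flux_bound[of z k] z assms by simp
    finally have "exp (g z) * (s * flux k z) \<le> exp (g z) * (2 * ?c * K z)"
      by (intro mult_left_mono) auto
    then show "0 \<le> ?c * (2 * exp (g z) * K z) - s * (exp (g z) * flux k z)"
      by (simp add: mult_ac)
  qed (use assms in auto)
  show ?thesis using *[of 1] *[of "-1"] by (simp add: algebra_simps abs_le_iff)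
qed

lemma psi_le_T: "x \<ge> 0 \<Longrightarrow> \<bar>psi k x\<bar> \<le> lam k * M k * T x"
  using psi_diff[of 0 x k] by (simp add: psi_0 T_0)

lemma psi_tendsto: "(psi k \<longlongrightarrow> psi_inf psi k) at_top"
proof -
  obtain L where L: "(psi k \<longlongrightarrow> L) at_top" using lim by blast
  then show ?thesis unfolding psi_inf_def by (subst tendsto_Lim[OF _ L]) auto
qed

lemma psi_inf_le_M: "\<bar>psi_inf psi k\<bar> \<le> M k"
  by (rule tendsto_upperbound[OF tendsto_rabs[OF psi_tendsto]])
    (auto intro!: psi_le_M eventually_mono[OF eventually_ge_at_top[of 0]])

lemma psi_inf_diff:
  assumes "0 \<le> x"
  shows "\<bar>psi_inf psi k - psi k x\<bar> \<le> lam k * M k * (Tinf - T x)"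
proof (rule tendsto_le)
  show "((\<lambda>y. \<bar>psi k y - psi k x\<bar>) \<longlongrightarrow> \<bar>psi_inf psi k - psi k x\<bar>) at_top"
    by (intro tendsto_intros psi_tendsto)
  show "((\<lambda>y. lam k * M k * (T y - T x)) \<longlongrightarrow> lam k * M k * (Tinf - T x)) at_top"
    by (intro tendsto_intros T_tendsto)
  show "\<forall>\<^sub>F y in at_top. \<bar>psi k y - psi k x\<bar> \<le> lam k * M k * (T y - T x)"
    using assms by (intro eventually_mono[OF eventually_ge_at_top[of x]] psi_diff)
qed simp

lemma mu_psi_cont: "continuous_on {0..} (\<lambda>x. mu x * psi k x)"
  by (intro continuous_intros psi_cont)

text \<open>No derivative of \<open>psi k\<close> at 0 is given. But the flux plus
  \<open>lam k\<close> times the primitive of \<open>mu x * psi k x\<close> is constant on the open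
  half-line, and that primitive is continuous at 0.\<close>

lemma flux_at_right: "\<exists>c. (flux k \<longlongrightarrow> c) (at_right 0)"
proof -
  let ?P = "\<lambda>x. integral {0..x} (\<lambda>x. mu x * psi k x)"
  have "\<exists>c. \<forall>x\<in>{0<..}. flux k x + lam k * ?P x = c"
  proof (rule has_field_derivative_zero_constant)
    fix x :: real assume x: "x \<in> {0<..}"
    have "((\<lambda>x. flux k x + lam k * ?P x) has_real_derivative
        - (lam k * mu x * psi k x) + lam k * (mu x * psi k x)) (at x)"
      using x by (intro DERIV_add DERIV_cmult flux_deriv primitive_deriv[OF mu_psi_cont]) auto
    then have "((\<lambda>x. flux k x + lam k * ?P x) has_real_derivative 0) (at x)"
      by (simp add: mult_ac)
    then show "((\<lambda>x. flux k x + lam k * ?P x) has_real_derivative 0) (at x within {0<..})"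
      by (rule has_field_derivative_at_within)
  qed auto
  then obtain c where c: "\<And>x. x > 0 \<Longrightarrow> flux k x = c - lam k * ?P x"
    by (auto simp: algebra_simps)
  have "(?P \<longlongrightarrow> ?P 0) (at_right 0)"
    by (rule tendsto_at_right_0[OF primitive_cont[OF mu_psi_cont]])
  then have "((\<lambda>x. c - lam k * ?P x) \<longlongrightarrow> c - lam k * ?P 0) (at_right 0)"
    by (intro tendsto_intros)
  moreover have "\<forall>\<^sub>F x in at_right 0. c - lam k * ?P x = flux k x"
    using c by (intro eventually_mono[OF eventually_at_right_less[of 0]]) auto
  ultimately show ?thesis by (auto dest: Lim_transform_eventually)
qed

text \<open>L'Hopital's rule: in the quotient of derivatives \<open>exp (g x)\<close> cancels,
  leaving flux over \<open>2 * K x\<close>. The limits form the coefficient sequence of the rescaled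
  boundary point 0.\<close>

lemma psi_over_T_tendsto: "\<exists>c. ((\<lambda>x. psi k x / T x) \<longlongrightarrow> c) (at_right 0)"
proof -
  obtain c where c: "(flux k \<longlongrightarrow> c) (at_right 0)" using flux_at_right by blast
  have T0: "(T \<longlongrightarrow> 0) (at_right 0)" and K0: "(K \<longlongrightarrow> K 0) (at_right 0)"
    using tendsto_at_right_0[OF T_cont] tendsto_at_right_0[OF K_cont] by (simp_all add: T_0)
  have "((\<lambda>x. psi k x / T x) \<longlongrightarrow> c / (2 * K 0)) (at_right 0)"
  proof (rule lhopital_right_0[where f' = "\<lambda>x. exp (g x) * flux k x" and g' = "\<lambda>x. 2 * exp (g x) * K x"])
    show "(psi k \<longlongrightarrow> 0) (at_right 0)" by (rule psi_at_right)
    show "(T \<longlongrightarrow> 0) (at_right 0)" by (rule T0)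
    show "\<forall>\<^sub>F x in at_right 0. T x \<noteq> 0"
      using T_pos by (intro eventually_mono[OF eventually_at_right_less[of 0]]) force
    show "\<forall>\<^sub>F x in at_right 0. 2 * exp (g x) * K x \<noteq> 0"
      by (intro eventually_mono[OF eventually_at_right_less[of 0]]) (use K_pos in \<open>simp add: less_imp_le order_less_imp_not_eq2\<close>)
    show "\<forall>\<^sub>F x in at_right 0. (psi k has_real_derivative exp (g x) * flux k x) (at x)"
      by (intro eventually_mono[OF eventually_at_right_less[of 0]] psi_deriv)
    show "\<forall>\<^sub>F x in at_right 0. (T has_real_derivative 2 * exp (g x) * K x) (at x)"
      by (intro eventually_mono[OF eventually_at_right_less[of 0]] T_deriv)
    have "((\<lambda>x. flux k x / (2 * K x)) \<longlongrightarrow> c / (2 * K 0)) (at_right 0)"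
      using K_pos[of 0] by (intro tendsto_intros c K0) auto
    then show "((\<lambda>x. exp (g x) * flux k x / (2 * exp (g x) * K x)) \<longlongrightarrow> c / (2 * K 0)) (at_right 0)"
      by simp
  qed
  then show ?thesis by blast
qed

section \<open>Energy form, Bessel's inequality and the trace bound\<close>

lemma orthonormal_has:
  "has_bochner_integral lborel (\<lambda>x. indicator {0<..} x *\<^sub>R (mu x * psi j x * psi k x)) (if j = k then 1 else 0)"
  using orthonormal[of j k]
  by (simp add: has_bochner_integral_iff set_integrable_def set_lebesgue_integral_def)

lemma orthonormal_sums:
  assumes A: "finite A"
  shows "set_integrable lborel {0<..} (\<lambda>x. mu x * (\<Sum>j\<in>A. a j * psi j x) * (\<Sum>k\<in>A. b k * psi k x))" (is ?I)
    and "(LINT x:{0<..}|lborel. mu x * (\<Sum>j\<in>A. a j * psi j x) * (\<Sum>k\<in>A. b k * psi k x)) = (\<Sum>k\<in>A. a k * b k)" (is ?E)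
proof -
  have "has_bochner_integral lborel
      (\<lambda>x. \<Sum>j\<in>A. \<Sum>k\<in>A. (a j * b k) * (indicator {0<..} x *\<^sub>R (mu x * psi j x * psi k x)))
      (\<Sum>j\<in>A. \<Sum>k\<in>A. (a j * b k) * (if j = k then 1 else 0))"
    by (intro has_bochner_integral_sum has_bochner_integral_mult_right orthonormal_has)
  also have "(\<Sum>j\<in>A. \<Sum>k\<in>A. (a j * b k) * (if j = k then 1 else 0)) = (\<Sum>k\<in>A. a k * b k)"
    using A by (intro sum.cong refl) (simp add: if_distrib cong: if_cong)
  also have "(\<lambda>x. \<Sum>j\<in>A. \<Sum>k\<in>A. (a j * b k) * (indicator {0<..} x *\<^sub>R (mu x * psi j x * psi k x)))
      = (\<lambda>x. indicator {0<..} x *\<^sub>R (mu x * (\<Sum>j\<in>A. a j * psi j x) * (\<Sum>k\<in>A. b k * psi k x)))"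
    by (simp add: sum_product sum_distrib_left sum_distrib_right mult_ac)
  finally show ?I ?E
    by (simp_all add: has_bochner_integral_iff set_integrable_def set_lebesgue_integral_def)
qed

text \<open>Completing the square in the energy of a finite combination, against the function
  that represents evaluation at \<open>x\<close>.\<close>

lemma energy:
  assumes A: "finite A" and x: "x > 0"
  shows "2 * c * (\<Sum>k\<in>A. a k * psi k x) - c\<^sup>2 * Lam x \<le> (\<Sum>k\<in>A. lam k * (a k)\<^sup>2)"
proof -
  define u where "u = (\<lambda>x. \<Sum>k\<in>A. a k * psi k x)"
  define v where "v = (\<lambda>x. \<Sum>k\<in>A. (lam k * a k) * psi k x)"
  define D where "D = (\<lambda>x. \<Sum>k\<in>A. a k * flux k x)"
  define Q where "Q = (\<lambda>x. integral {0..x} (\<lambda>x. mu x * u x * v x))"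
  \<comment> \<open>By integration by parts this is the energy of \<open>u\<close> on the interval
    from 0 to \<open>x\<close>: its derivative is \<open>exp (g x) * (D x)\<^sup>2\<close> and it
    vanishes at 0.\<close>
  define Z where "Z = (\<lambda>x. D x * u x + Q x)"
  have u': "(u has_real_derivative exp (g y) * D y) (at y)" if "y > 0" for y
  proof -
    have "(u has_real_derivative (\<Sum>k\<in>A. a k * (exp (g y) * flux k y))) (at y)"
      unfolding u_def using that by (intro DERIV_sum DERIV_cmult psi_deriv)
    then show ?thesis by (simp add: D_def sum_distrib_left mult_ac)
  qed
  have D': "(D has_real_derivative - (mu y * v y)) (at y)" if "y > 0" for y
  proof -
    have "(D has_real_derivative (\<Sum>k\<in>A. a k * (- (lam k * mu y * psi k y)))) (at y)"
      unfolding D_def using that by (intro DERIV_sum DERIV_cmult flux_deriv)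
    then show ?thesis by (simp add: v_def sum_distrib_left sum_negf mult_ac)
  qed
  have cont: "continuous_on {0..} (\<lambda>x. mu x * u x * v x)"
    unfolding u_def v_def by (intro continuous_intros psi_cont)
  have Z': "(Z has_real_derivative exp (g y) * (D y)\<^sup>2) (at y)" if "y > 0" for y
  proof -
    have "(Z has_real_derivative (- (mu y * v y)) * u y + (exp (g y) * D y) * D y + mu y * u y * v y) (at y)"
      unfolding Z_def Q_def using that
      by (intro DERIV_add DERIV_mult u' D' primitive_deriv[OF cont])
    then show ?thesis by (simp add: power2_eq_square algebra_simps)
  qed
  have u0: "(u \<longlongrightarrow> 0) (at_right 0)"
    unfolding u_def by (rule tendsto_eq_intros psi_at_right refl | simp)+
  obtain d where d: "\<And>k. (flux k \<longlongrightarrow> d k) (at_right 0)" using flux_at_right by metis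
  have D0: "(D \<longlongrightarrow> (\<Sum>k\<in>A. a k * d k)) (at_right 0)"
    unfolding D_def by (intro tendsto_intros d)
  have Q0: "(Q \<longlongrightarrow> 0) (at_right 0)"
    using tendsto_at_right_0[OF primitive_cont[OF cont]] by (simp add: Q_def)
  have L0: "(Lam \<longlongrightarrow> 0) (at_right 0)"
    using tendsto_at_right_0[OF Lam_cont] by (simp add: Lam_0)
  have "((\<lambda>x. Z x - 2 * c * u x + c\<^sup>2 * Lam x) \<longlongrightarrow>
      ((\<Sum>k\<in>A. a k * d k) * 0 + 0) - 2 * c * 0 + c\<^sup>2 * 0) (at_right 0)"
    unfolding Z_def by (intro tendsto_intros u0 D0 Q0 L0)
  then have lim0: "((\<lambda>x. Z x - 2 * c * u x + c\<^sup>2 * Lam x) \<longlongrightarrow> 0) (at_right 0)" by simp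
  have "0 \<le> Z x - 2 * c * u x + c\<^sup>2 * Lam x"
  proof (rule nondecreasing_nonneg_at_right[OF _ _ lim0 x])
    fix y :: real assume y: "y > 0"
    have "((\<lambda>x. Z x - 2 * c * u x + c\<^sup>2 * Lam x) has_real_derivative
        exp (g y) * (D y)\<^sup>2 - 2 * c * (exp (g y) * D y) + c\<^sup>2 * exp (g y)) (at y)"
      using y by (intro DERIV_add DERIV_diff DERIV_cmult Z' u' Lam_deriv)
    also have "exp (g y) * (D y)\<^sup>2 - 2 * c * (exp (g y) * D y) + c\<^sup>2 * exp (g y) = exp (g y) * (D y - c)\<^sup>2"
      by (simp add: power2_eq_square algebra_simps)
    finally show "((\<lambda>x. Z x - 2 * c * u x + c\<^sup>2 * Lam x) has_real_derivative exp (g y) * (D y - c)\<^sup>2) (at y)" .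
  qed auto
  \<comment> \<open>The energy increases towards its value on the whole half-line, where the
    boundary term \<open>D * u\<close> vanishes and orthonormality evaluates
    \<open>Q\<close>.\<close>
  moreover have "Z x \<le> (\<Sum>k\<in>A. lam k * (a k)\<^sup>2)"
  proof (rule nondecreasing_le_at_top[where f = Z and a = x])
    fix y assume y: "y \<ge> x"
    show "(Z has_real_derivative exp (g y) * (D y)\<^sup>2) (at y)" using y x by (intro Z') simp
  next
    have Du: "((\<lambda>y. D y * u y) \<longlongrightarrow> 0) at_top"
    proof -
      have "(D \<longlongrightarrow> (\<Sum>k\<in>A. a k * 0)) at_top"
        unfolding D_def by (intro tendsto_intros flux_tendsto)
      moreover have "(u \<longlongrightarrow> (\<Sum>k\<in>A. a k * psi_inf psi k)) at_top"
        unfolding u_def by (intro tendsto_intros psi_tendsto)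
      ultimately show ?thesis using tendsto_mult by fastforce
    qed
    have "(Q \<longlongrightarrow> (\<Sum>k\<in>A. a k * (lam k * a k))) at_top"
      using primitive_tendsto_LINT[OF orthonormal_sums(1)[OF A, of a "\<lambda>k. lam k * a k"]]
      unfolding orthonormal_sums(2)[OF A, of a "\<lambda>k. lam k * a k"] Q_def u_def v_def .
    from tendsto_add[OF Du this]
    show "(Z \<longlongrightarrow> (\<Sum>k\<in>A. lam k * (a k)\<^sup>2)) at_top"
      unfolding Z_def by (simp add: power2_eq_square mult_ac)
  qed auto
  ultimately show ?thesis unfolding u_def by linarith
qed

text \<open>The best choice of \<open>c\<close> in \<open>energy\<close>: point evaluation at
  \<open>x\<close> is bounded in the energy norm, with squared norm at most
  \<open>Lam x\<close>.\<close>

lemma energy_square: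
  assumes A: "finite A" and x: "x > 0"
  shows "(\<Sum>k\<in>A. a k * psi k x)\<^sup>2 \<le> Lam x * (\<Sum>k\<in>A. lam k * (a k)\<^sup>2)"
proof -
  let ?u = "\<Sum>k\<in>A. a k * psi k x"
  have L: "Lam x > 0" using x by (rule Lam_pos)
  have "2 * (?u / Lam x) * ?u - (?u / Lam x)\<^sup>2 * Lam x \<le> (\<Sum>k\<in>A. lam k * (a k)\<^sup>2)"
    by (rule energy[OF A x])
  also have "2 * (?u / Lam x) * ?u - (?u / Lam x)\<^sup>2 * Lam x = ?u\<^sup>2 / Lam x"
    using L by (simp add: field_simps power2_eq_square)
  finally show ?thesis using L by (simp add: field_simps)
qed

text \<open>The coefficients \<open>psi k x / lam k\<close> are those of the Green function with
  pole \<open>x\<close>; for them the energy sum and the value at \<open>x\<close> coincide.\<close>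

lemma bessel:
  assumes A: "finite A" and x: "x > 0"
  shows "(\<Sum>k\<in>A. (psi k x)\<^sup>2 / lam k) \<le> Lam x"
proof -
  have eq: "lam k * (psi k x / lam k)\<^sup>2 = (psi k x)\<^sup>2 / lam k" for k
    using lam_pos[of k] by (simp add: field_simps power2_eq_square)
  show ?thesis using energy[OF A x, of 1 "\<lambda>k. psi k x / lam k"]
    by (simp add: eq) (simp add: power2_eq_square)
qed

lemma psi_square_le: "x > 0 \<Longrightarrow> (psi k x)\<^sup>2 \<le> lam k * Lam x"
  using bessel[of "{k}" x] lam_pos[of k] by (simp add: field_simps)

lemma trace_le:
  assumes A: "finite A"
  shows "(\<Sum>k\<in>A. 1 / lam k) \<le> Tinf"
proof -
  let ?s = "\<lambda>x. \<Sum>k\<in>A. (1 / lam k) * (psi k x)\<^sup>2"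
  have "has_bochner_integral lborel (\<lambda>x. \<Sum>k\<in>A. (1 / lam k) * (indicator {0<..} x *\<^sub>R (mu x * psi k x * psi k x)))
      (\<Sum>k\<in>A. (1 / lam k) * (if k = k then 1 else 0))"
    by (intro has_bochner_integral_sum has_bochner_integral_mult_right orthonormal_has)
  also have "(\<lambda>x. \<Sum>k\<in>A. (1 / lam k) * (indicator {0<..} x *\<^sub>R (mu x * psi k x * psi k x)))
      = (\<lambda>x. indicator {0<..} x *\<^sub>R (mu x * ?s x))"
    by (simp add: sum_distrib_left power2_eq_square mult_ac)
  finally have I: "set_integrable lborel {0<..} (\<lambda>x. mu x * ?s x)"
      "(LINT x:{0<..}|lborel. mu x * ?s x) = (\<Sum>k\<in>A. 1 / lam k)"
    by (simp_all add: has_bochner_integral_iff set_integrable_def set_lebesgue_integral_def)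
  have "((\<lambda>R. integral {0..R} (\<lambda>x. mu x * ?s x)) \<longlongrightarrow> (\<Sum>k\<in>A. 1 / lam k)) at_top"
    using primitive_tendsto_LINT[OF I(1)] unfolding I(2) .
  then show ?thesis
  proof (rule tendsto_upperbound)
    show "\<forall>\<^sub>F R in at_top. integral {0..R} (\<lambda>x. mu x * ?s x) \<le> Tinf"
    proof (rule eventually_mono[OF eventually_ge_at_top[of 0]])
      fix R :: real assume R: "0 \<le> R"
      have "integral {0..R} (\<lambda>x. mu x * ?s x) \<le> integral {0..R} (\<lambda>x. mu x * Lam x)"
      proof (rule integral_le)
        show "(\<lambda>x. mu x * ?s x) integrable_on {0..R}"
          by (intro integrable_continuous_interval continuous_intros psi_cont') simp
        show "(\<lambda>x. mu x * Lam x) integrable_on {0..R}"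
          by (intro integrable_continuous_interval continuous_intros)
        fix x assume x: "x \<in> {0..R}"
        show "mu x * ?s x \<le> mu x * Lam x"
        proof (cases "x = 0")
          case False
          then show ?thesis using bessel[OF A, of x] mu_pos[of x] x by (intro mult_left_mono) auto
        qed (simp add: psi_0 Lam_0)
      qed
      also have "\<dots> = T R - 2 * Lam R * K R" using R by (rule Lam_trace)
      also have "\<dots> \<le> Tinf"
      proof -
        have "0 \<le> 2 * Lam R * K R"
          using R Lam_nonneg[of R] K_pos[of R] by (intro mult_nonneg_nonneg) auto
        then show ?thesis using T_le_Tinf[OF R] by linarith
      qed
      finally show "integral {0..R} (\<lambda>x. mu x * ?s x) \<le> Tinf" .
    qed
  qed simp
qed

lemma summable_trace: "summable (\<lambda>k. 1 / lam k)"
proof (rule bounded_imp_summable)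
  show "1 / lam k \<ge> 0" for k using lam_pos[of k] by simp
  show "(\<Sum>k\<le>n. 1 / lam k) \<le> Tinf" for n by (rule trace_le) simp
qed

lemma lam_at_top: "filterlim lam at_top sequentially"
proof -
  have "(\<lambda>k. inverse (lam k)) \<longlonglongrightarrow> 0"
    using summable_LIMSEQ_zero[OF summable_trace] by (simp add: inverse_eq_divide)
  then have "filterlim (\<lambda>k. inverse (inverse (lam k))) at_top sequentially"
    using lam_pos by (intro filterlim_inverse_at_top) auto
  then show ?thesis by simp
qed

text \<open>In the region where \<open>q\<^sup>2\<close> dominates \<open>lam k\<close> the function \<open>exp (2 lam (T - T X))\<close> is a
  supersolution of the eigenvalue equation.\<close>

lemma psi_exp_bound:
  assumes X: "X > 0" and small: "\<And>x. x \<ge> X \<Longrightarrow> 2 * lam k * (2 * exp (g x) * K x)\<^sup>2 \<le> 1" and x: "x \<ge> X"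
  shows "\<bar>psi k x\<bar> \<le> \<bar>psi k X\<bar> * exp (2 * lam k * (Tinf - T X))"
proof -
  let ?l = "lam k"
  define w where "w = (\<lambda>x. exp (2 * ?l * (T x - T X)))"
  \<comment> \<open>Weighted sup norm, finite because \<open>psi k\<close> is bounded and
    \<open>w\<close> is at least 1. The aim is to show that it is at most
    \<open>\<bar>psi k X\<bar>\<close>.\<close>
  define m where "m = (SUP x\<in>{X..}. \<bar>psi k x\<bar> / w x)"
  have wpos: "w x > 0" for x by (simp add: w_def)
  have w1: "w x \<ge> 1" if "x \<ge> X" for x
    using T_mono[of X x] that X lam_pos[of k] by (simp add: w_def)
  have bd: "bdd_above ((\<lambda>x. \<bar>psi k x\<bar> / w x) ` {X..})"
  proof (rule bdd_aboveI2[of _ _ "M k"])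
    fix x assume x: "x \<in> {X..}"
    have "\<bar>psi k x\<bar> / w x \<le> \<bar>psi k x\<bar> / 1"
      using w1[of x] x by (intro divide_left_mono) auto
    also have "\<dots> \<le> M k" using psi_le_M[of x k] x X by simp
    finally show "\<bar>psi k x\<bar> / w x \<le> M k" .
  qed
  have m_le: "\<bar>psi k x\<bar> \<le> m * w x" if "x \<ge> X" for x
  proof -
    have "\<bar>psi k x\<bar> / w x \<le> m" unfolding m_def using that bd by (intro cSUP_upper) auto
    then show ?thesis using wpos[of x] by (simp add: field_simps)
  qed
  have m0: "m \<ge> 0"
    using m_le[of X] wpos[of X] by (smt (verit) abs_ge_zero mult_neg_pos order_refl)
  have w': "(w has_real_derivative w x * (2 * ?l * (2 * exp (g x) * K x))) (at x)" if "x \<ge> X" for x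
    unfolding w_def using that X by (auto intro!: derivative_eq_intros T_deriv)
  \<comment> \<open>This is the flux of \<open>m * w\<close>, that is, \<open>exp (- g x)\<close>
    times its derivative. In \<open>- ?W\<close> differentiated once more, the smallness condition
    keeps at least half of the main term, which is exactly what
    \<open>\<bar>psi k x\<bar> \<le> m * w x\<close> requires.\<close>
  let ?W = "\<lambda>x. m * (4 * ?l * (K x * w x))"
  let ?W' = "\<lambda>x. - (m * (4 * ?l * (- exp (- g x) * w x + w x * (2 * ?l * (2 * exp (g x) * K x)) * K x)))"
  have fl: "\<bar>flux k y\<bar> \<le> ?W y" if y: "y \<ge> X" for y
  proof (rule flux_compare[OF X, where W = ?W and W' = ?W'])
    fix x assume x: "x \<ge> X"
    have "(?W has_real_derivative m * (4 * ?l * (- exp (- g x) * w x + w x * (2 * ?l * (2 * exp (g x) * K x)) * K x))) (at x)"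
      using x X by (intro DERIV_cmult DERIV_mult w' K_deriv) auto
    then show "(?W has_real_derivative - ?W' x) (at x)" by simp
    have eq: "- (- exp (- g x) * w x + w x * (2 * ?l * (2 * exp (g x) * K x)) * K x)
        = exp (- g x) * w x * (1 - ?l * (2 * exp (g x) * K x)\<^sup>2)"
    proof -
      have S: "exp (- g x) * (2 * exp (g x) * K x)\<^sup>2 = 4 * exp (g x) * (K x)\<^sup>2"
        by (simp add: power_mult_distrib exp_minus power2_eq_square)
      have "exp (- g x) * w x * (1 - ?l * (2 * exp (g x) * K x)\<^sup>2)
          = exp (- g x) * w x - ?l * w x * (exp (- g x) * (2 * exp (g x) * K x)\<^sup>2)"
        by (simp only: right_diff_distrib mult_1_right mult_ac)
      then show ?thesis unfolding S by (simp add: power2_eq_square)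
    qed
    have "?l * mu x * \<bar>psi k x\<bar> \<le> ?l * mu x * (m * w x)"
      using m_le[OF x] lam_pos[of k] mu_pos[of x] by (intro mult_left_mono) auto
    also have "\<dots> = m * (4 * ?l * (exp (- g x) * w x * (1 / 2)))"
      by (simp add: mu_dens_def)
    also have "\<dots> \<le> m * (4 * ?l * (exp (- g x) * w x * (1 - ?l * (2 * exp (g x) * K x)\<^sup>2)))"
    proof (intro mult_left_mono)
      show "1 / 2 \<le> 1 - ?l * (2 * exp (g x) * K x)\<^sup>2" using small[OF x] by linarith
    qed (use lam_pos[of k] m0 wpos[of x] in \<open>simp_all add: less_imp_le\<close>)
    also have "\<dots> = ?W' x" by (subst eq[symmetric]) (simp only: mult_minus_right)
    finally show "?l * mu x * \<bar>psi k x\<bar> \<le> ?W' x" .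
    show "0 \<le> ?W x" using m0 lam_pos[of k] K_pos[of x] x X wpos[of x] by simp
  qed (rule y)
  have step: "\<bar>psi k x - psi k X\<bar> \<le> m * (w x - 1)" if x: "x \<ge> X" for x
  proof -
    have *: "m * w X - s * psi k X \<le> m * w x - s * psi k x" if s: "s = 1 \<or> s = -1" for s :: real
    proof (rule le_of_deriv_nonneg'[where f = "\<lambda>x. m * w x - s * psi k x" and
          f' = "\<lambda>x. m * (w x * (2 * ?l * (2 * exp (g x) * K x))) - s * (exp (g x) * flux k x)"])
      fix z assume z: "X \<le> z" "z \<le> x"
      show "((\<lambda>x. m * w x - s * psi k x) has_real_derivative
          m * (w z * (2 * ?l * (2 * exp (g z) * K z))) - s * (exp (g z) * flux k z)) (at z)"
        using z X by (intro DERIV_diff DERIV_cmult w' psi_deriv) auto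
      have "s * flux k z \<le> \<bar>flux k z\<bar>" using s by auto
      also have "\<dots> \<le> ?W z" using fl z by simp
      finally have "exp (g z) * (s * flux k z) \<le> exp (g z) * ?W z"
        by (intro mult_left_mono) auto
      then show "0 \<le> m * (w z * (2 * ?l * (2 * exp (g z) * K z))) - s * (exp (g z) * flux k z)"
        by (simp add: mult_ac)
    qed (use x in auto)
    have "w X = 1" by (simp add: w_def)
    then show ?thesis using *[of 1] *[of "-1"] by (simp add: algebra_simps abs_le_iff)
  qed
  let ?A = "\<bar>psi k X\<bar>"
  define E where "E = exp (2 * ?l * (Tinf - T X))"
  have wE: "w x \<le> E" if "x \<ge> X" for x
    using T_le_Tinf[of x] that X lam_pos[of k] by (simp add: w_def E_def)
  have E1: "E \<ge> 1" using w1[of X] wE[of X] by simp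
  \<comment> \<open>If \<open>m\<close> exceeded \<open>?A\<close>, the increment bound
    \<open>step\<close> would keep \<open>\<bar>psi k x\<bar> / w x\<close> below \<open>m\<close>
    by at least \<open>(m - ?A) / E\<close>, uniformly in \<open>x\<close>, so \<open>m\<close>
    could not be the supremum.\<close>
  have "m \<le> ?A"
  proof (rule ccontr)
    assume "\<not> m \<le> ?A"
    then have mA: "m - ?A > 0" by simp
    have "m \<le> m - (m - ?A) / E"
      unfolding m_def
    proof (fold m_def, rule cSUP_least[of "{X..}" "\<lambda>x. \<bar>psi k x\<bar> / w x" "m - (m - ?A) / E", folded m_def])
      fix x assume "x \<in> {X..}"
      then have x: "x \<ge> X" by simp
      have "\<bar>psi k x\<bar> \<le> ?A + m * (w x - 1)" using step[OF x] by simp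
      then have "\<bar>psi k x\<bar> / w x \<le> (?A + m * (w x - 1)) / w x"
        using wpos[of x] by (simp add: divide_right_mono)
      also have "\<dots> = m - (m - ?A) / w x" using wpos[of x] by (simp add: field_simps)
      also have "\<dots> \<le> m - (m - ?A) / E"
        using mA wE[OF x] wpos[of x] by (simp add: divide_left_mono)
      finally show "\<bar>psi k x\<bar> / w x \<le> m - (m - ?A) / E" .
    qed auto
    moreover have "(m - ?A) / E > 0" using mA E1 by simp
    ultimately show False by simp
  qed
  then have "m * w x \<le> ?A * E"
    using wE[OF x] wpos[of x] m0 by (intro mult_mono) auto
  then show ?thesis using m_le[OF x] by (simp add: E_def)
qed

section \<open>Growth of the sup norms and convergence of the weighted spectral series\<close>

lemma M_subexponential:
  assumes \<epsilon>: "\<epsilon> > 0"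
  shows "\<forall>\<^sub>F k in sequentially. (M k)\<^sup>2 \<le> lam k * exp (\<epsilon> * lam k)"
proof -
  \<comment> \<open>The fraction \<open>\<epsilon> / 5\<close> suffices: after squaring,
    \<open>Lam X\<close> contributes one fifth of the exponent and
    \<open>exp (2 * lam k * (\<epsilon> / 5))\<close> four fifths.\<close>
  have "\<forall>\<^sub>F k in sequentially. \<exists>X>0. (\<forall>x\<ge>X. 2 * lam k * (2 * exp (g x) * K x)\<^sup>2 \<le> 1) \<and>
      Lam X \<le> exp (\<epsilon> / 5 * lam k) \<and> Tinf - T X \<le> \<epsilon> / 5"
    using \<epsilon> by (intro eventually_compose_filterlim[OF Lam_subexponential lam_at_top]) auto
  then show ?thesis
  proof eventually_elim
    case (elim k)
    then obtain X where X: "X > 0" "\<And>x. x \<ge> X \<Longrightarrow> 2 * lam k * (2 * exp (g x) * K x)\<^sup>2 \<le> 1"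
        "Lam X \<le> exp (\<epsilon> / 5 * lam k)" "Tinf - T X \<le> \<epsilon> / 5" by blast
    define a where "a = sqrt (lam k * exp (\<epsilon> / 5 * lam k))"
    have le1: "\<bar>psi k x\<bar> \<le> a" if x: "0 \<le> x" "x \<le> X" for x
    proof (cases "x = 0")
      case False
      then have "(psi k x)\<^sup>2 \<le> lam k * Lam x" using x by (intro psi_square_le) simp
      also have "\<dots> \<le> lam k * exp (\<epsilon> / 5 * lam k)"
        using lam_pos[of k] Lam_mono[OF x] X(3) by (intro mult_left_mono) auto
      finally show ?thesis unfolding a_def by (intro real_le_rsqrt) simp
    qed (simp add: psi_0 a_def lam_pos less_imp_le)
    have a0: "a \<ge> 0" by (simp add: a_def lam_pos less_imp_le)
    have "M k \<le> a * exp (2 * lam k * (\<epsilon> / 5))"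
    proof (rule M_leI)
      fix x :: real assume x: "x \<ge> 0"
      show "\<bar>psi k x\<bar> \<le> a * exp (2 * lam k * (\<epsilon> / 5))"
      proof (cases "x \<le> X")
        case True
        have "a * 1 \<le> a * exp (2 * lam k * (\<epsilon> / 5))"
          using a0 \<epsilon> lam_pos[of k] by (intro mult_left_mono) auto
        then show ?thesis using le1[OF x True] by simp
      next
        case False
        have "\<bar>psi k x\<bar> \<le> \<bar>psi k X\<bar> * exp (2 * lam k * (Tinf - T X))"
          using False by (intro psi_exp_bound X) auto
        also have "\<dots> \<le> a * exp (2 * lam k * (\<epsilon> / 5))"
          using le1[of X] X(1,4) a0 lam_pos[of k] by (intro mult_mono) auto
        finally show ?thesis .
      qed
    qed
    then have "(M k)\<^sup>2 \<le> (a * exp (2 * lam k * (\<epsilon> / 5)))\<^sup>2"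
      using M_nonneg[of k] by (intro power_mono)
    also have "\<dots> = lam k * (exp (\<epsilon> / 5 * lam k) * exp (2 * lam k * (\<epsilon> / 5)) * exp (2 * lam k * (\<epsilon> / 5)))"
      using lam_pos[of k] by (simp add: a_def power_mult_distrib power2_eq_square)
    also have "\<dots> = lam k * exp (\<epsilon> * lam k)"
      by (simp flip: exp_add add: algebra_simps)
    finally show ?case .
  qed
qed

text \<open>One bound for both \<open>M k\<close> and \<open>lam k * M k\<close>, so that values of
  eigenfunctions and quotients \<open>psi k x / T x\<close> share a majorant.\<close>

definition B :: "nat \<Rightarrow> real" where
  "B k = (1 + lam k) * (1 + M k)"

lemma B_ge: "M k \<le> B k" "lam k * M k \<le> B k" "0 \<le> B k"
  using lam_pos[of k] M_nonneg[of k] mult_nonneg_nonneg[of "lam k" "M k"]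
  by (auto simp: B_def algebra_simps)

text \<open>The growth of \<open>(M k)\<^sup>2\<close> uses up half of the decay
  \<open>exp (- lam k * t)\<close>; the other half beats every power of \<open>lam k\<close>, and
  comparison with \<open>1 / lam k\<close> finishes.\<close>

lemma summable_B:
  assumes t: "t > 0"
  shows "summable (\<lambda>k. exp (- lam k * t) * (B k)\<^sup>2)"
proof (rule summable_comparison_test_ev[OF _ summable_trace])
  \<comment> \<open>At \<open>y = t / 2 * lam k\<close> the factor \<open>(2 / t) ^ 4\<close>
    restores \<open>lam k ^ 4\<close>. The estimate below needs only the constant 16, so 64 leaves
    room.\<close>
  have "((\<lambda>y. 64 * (2 / t) ^ 4 * (y ^ 4 / exp y)) \<longlongrightarrow> 64 * (2 / t) ^ 4 * 0) at_top"
    by (intro tendsto_intros tendsto_power_div_exp_0)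
  then have "\<forall>\<^sub>F y in at_top. 64 * (2 / t) ^ 4 * (y ^ 4 / exp y) < 1"
    by (rule order_tendstoD) simp
  moreover have "filterlim (\<lambda>k. t / 2 * lam k) at_top sequentially"
    using t by (intro filterlim_tendsto_pos_mult_at_top[OF tendsto_const] lam_at_top) auto
  ultimately have "\<forall>\<^sub>F k in sequentially. 64 * (2 / t) ^ 4 * ((t / 2 * lam k) ^ 4 / exp (t / 2 * lam k)) < 1"
    by (rule eventually_compose_filterlim)
  moreover have "\<forall>\<^sub>F k in sequentially. lam k \<ge> 1"
    using lam_at_top unfolding filterlim_at_top by blast
  moreover have "\<forall>\<^sub>F k in sequentially. (M k)\<^sup>2 \<le> lam k * exp (t / 2 * lam k)"
    using t by (intro M_subexponential) simp
  ultimately show "\<forall>\<^sub>F k in sequentially. norm (exp (- lam k * t) * (B k)\<^sup>2) \<le> 1 / lam k"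
  proof eventually_elim
    case (elim k)
    let ?l = "lam k" and ?e = "exp (t / 2 * lam k)"
    have e1: "?e \<ge> 1" using t lam_pos[of k] by simp
    have "(1 + M k)\<^sup>2 \<le> 2 + 2 * (M k)\<^sup>2"
      using sum_squares_bound[of 1 "M k"] by (simp add: power2_sum)
    also have "\<dots> \<le> 4 * (?l * ?e)"
    proof -
      have "1 * 1 \<le> ?l * ?e" using elim(2) e1 by (intro mult_mono) auto
      then show ?thesis using elim(3) by simp
    qed
    finally have M: "(1 + M k)\<^sup>2 \<le> 4 * (?l * ?e)" .
    have "(1 + ?l)\<^sup>2 \<le> (2 * ?l)\<^sup>2" using elim(2) by (intro power_mono) auto
    then have "(B k)\<^sup>2 \<le> (2 * ?l)\<^sup>2 * (4 * (?l * ?e))"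
      unfolding B_def power_mult_distrib[of "1 + ?l"] using M by (intro mult_mono) auto
    then have "exp (- ?l * t) * (B k)\<^sup>2 \<le> exp (- ?l * t) * ((2 * ?l)\<^sup>2 * (4 * (?l * ?e)))"
      by (intro mult_left_mono) auto
    also have "\<dots> = 1 / (?e * ?e) * ((2 * ?l)\<^sup>2 * (4 * (?l * ?e)))"
      by (simp add: exp_minus inverse_eq_divide flip: exp_add)
    also have "1 / (?e * ?e) * ((2 * ?l)\<^sup>2 * (4 * (?l * ?e))) = 16 * ?l ^ 4 / ?e / ?l"
      using lam_pos[of k] by (simp add: field_simps power2_eq_square power4_eq_xxxx)
    also have "\<dots> \<le> 1 / ?l"
    proof (rule divide_right_mono)
      have "(2 / t) ^ 4 * (t / 2 * ?l) ^ 4 = ?l ^ 4"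
        using t by (simp flip: power_mult_distrib)
      then have "64 * (2 / t) ^ 4 * ((t / 2 * ?l) ^ 4 / ?e) = 64 * (?l ^ 4 / ?e)"
        by (simp only: times_divide_eq_right mult.assoc)
      moreover have "?l ^ 4 / ?e \<ge> 0" by simp
      ultimately show "16 * ?l ^ 4 / ?e \<le> 1" using elim(1) unfolding times_divide_eq_right[symmetric] by linarith
    qed (use lam_pos[of k] in auto)
    finally show ?case by simp
  qed
qed

end

lemma set_integrable_bound_cont:
  fixes f h :: "real \<Rightarrow> real"
  assumes f: "continuous_on {0<..} f" and h: "set_integrable lborel {0<..} h"
    and le: "\<And>x. x > 0 \<Longrightarrow> \<bar>f x\<bar> \<le> h x"
  shows "set_integrable lborel {0<..} f"
  unfolding set_integrable_def
proof (rule Bochner_Integration.integrable_bound[OF h[unfolded set_integrable_def]])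
  show "(\<lambda>x. indicator {0<..} x *\<^sub>R f x) \<in> borel_measurable lborel"
    using borel_measurable_continuous_on_indicator[OF _ f] by simp
  show "AE x in lborel. norm (indicator {0<..} x *\<^sub>R f x) \<le> norm (indicator {0<..} x *\<^sub>R h x)"
    by (intro AE_I2) (auto simp: indicator_def intro: order.trans[OF le])
qed

context entrance_spectrum
begin

section \<open>Kernels\<close>

definition ker :: "real \<Rightarrow> (nat \<Rightarrow> real) \<Rightarrow> (nat \<Rightarrow> real) \<Rightarrow> real" where
  "ker t a b = (\<Sum>k. exp (- lam k * t) * a k * b k)"

text \<open>Besides the values at finite points, the sequences \<open>a\<close> of interest are the values at \<open>\<infinity>\<close>
  and the limits of \<open>psi k x / T x\<close> at \<open>0\<close>.\<close>

definition adm :: "(nat \<Rightarrow> real) \<Rightarrow> bool" where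
  "adm a \<longleftrightarrow> (\<forall>k. \<bar>a k\<bar> \<le> B k)"

lemma adm_psi: "x \<ge> 0 \<Longrightarrow> adm (\<lambda>k. psi k x)"
  unfolding adm_def using psi_le_M B_ge(1) order.trans by blast

lemma adm_psi_inf: "adm (psi_inf psi)"
  unfolding adm_def using psi_inf_le_M B_ge(1) order.trans by blast

lemma ker_term_le:
  assumes "\<bar>a k\<bar> \<le> B k" "\<bar>b k\<bar> \<le> B k"
  shows "\<bar>exp (- lam k * t) * a k * b k\<bar> \<le> exp (- lam k * t) * (B k)\<^sup>2"
proof -
  have "\<bar>a k\<bar> * \<bar>b k\<bar> \<le> B k * B k"
    using assms B_ge(3)[of k] by (intro mult_mono) auto
  then show ?thesis by (simp add: abs_mult power2_eq_square mult.assoc)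
qed

lemma summable_ker:
  assumes "adm a" "adm b" "t > 0"
  shows "summable (\<lambda>k. exp (- lam k * t) * a k * b k)"
proof (rule summable_comparison_test'[OF summable_B[OF assms(3)]])
  show "norm (exp (- lam k * t) * a k * b k) \<le> exp (- lam k * t) * (B k)\<^sup>2" for k
    using ker_term_le[of a k b t] assms by (simp add: adm_def)
qed

lemma partial_ker_le:
  assumes "adm a" "adm b" "t > 0"
  shows "\<bar>\<Sum>k<n. exp (- lam k * t) * a k * b k\<bar> \<le> (\<Sum>k. exp (- lam k * t) * (B k)\<^sup>2)"
proof -
  have "\<bar>\<Sum>k<n. exp (- lam k * t) * a k * b k\<bar> \<le> (\<Sum>k<n. exp (- lam k * t) * (B k)\<^sup>2)"
    using ker_term_le[of a _ b t] assms by (intro order.trans[OF sum_abs] sum_mono) (simp add: adm_def)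
  also have "\<dots> \<le> (\<Sum>k. exp (- lam k * t) * (B k)\<^sup>2)"
    by (intro sum_le_suminf summable_B assms) auto
  finally show ?thesis .
qed

lemma ker_abs_le:
  assumes "adm a" "adm b" "t > 0"
  shows "\<bar>ker t a b\<bar> \<le> (\<Sum>k. exp (- lam k * t) * (B k)\<^sup>2)"
proof (rule tendsto_upperbound)
  show "(\<lambda>n. \<bar>\<Sum>k<n. exp (- lam k * t) * a k * b k\<bar>) \<longlonglongrightarrow> \<bar>ker t a b\<bar>"
    unfolding ker_def by (intro tendsto_rabs summable_LIMSEQ summable_ker assms)
  show "\<forall>\<^sub>F n in sequentially. \<bar>\<Sum>k<n. exp (- lam k * t) * a k * b k\<bar> \<le> (\<Sum>k. exp (- lam k * t) * (B k)\<^sup>2)"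
    by (intro always_eventually allI partial_ker_le assms)
qed (rule sequentially_bot)

lemma ker_commute: "ker t a b = ker t b a"
  unfolding ker_def by (intro suminf_cong) (simp add: mult_ac)

text \<open>Tannery's theorem with the majorant of \<open>summable_B\<close>. The filter is left
  general to cover approach to 0, to a finite point and to infinity.\<close>

lemma ker_tendsto:
  assumes lim: "\<And>k. ((\<lambda>n. a n k) \<longlongrightarrow> a' k) F" and ev: "\<forall>\<^sub>F n in F. adm (a n)"
    and b: "adm b" and t: "t > 0" and F: "F \<noteq> bot"
  shows "((\<lambda>n. ker t (a n) b) \<longlongrightarrow> ker t a' b) F"
proof -
  have "((\<lambda>n. \<Sum>k. exp (- lam k * t) * a n k * b k) \<longlongrightarrow> (\<Sum>k. exp (- lam k * t) * a' k * b k)) F"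
  proof (rule tannerys_theorem[THEN conjunct2, THEN conjunct2])
    show "((\<lambda>n. exp (- lam k * t) * a n k * b k) \<longlongrightarrow> exp (- lam k * t) * a' k * b k) F" for k
      by (intro tendsto_intros lim)
    have "\<forall>\<^sub>F x in at_top \<times>\<^sub>F F. True \<and> adm (a (snd x))"
      using eventually_prodI[OF eventually_True ev] .
    then show "\<forall>\<^sub>F (k, n) in at_top \<times>\<^sub>F F. norm (exp (- lam k * t) * a n k * b k) \<le> exp (- lam k * t) * (B k)\<^sup>2"
    proof eventually_elim
      case (elim x)
      then show ?case using ker_term_le[of "a (snd x)" "fst x" b t] b
        by (simp add: adm_def split_beta)
    qed
  qed (use summable_B[OF t] F in auto)
  then show ?thesis by (simp add: ker_def)
qed

lemma ker_cont:
  assumes a: "adm a" and t: "t > 0"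
  shows "continuous_on {0..} (\<lambda>z. ker t a (\<lambda>k. psi k z))"
proof -
  have "uniform_limit {0..} (\<lambda>n z. \<Sum>k<n. exp (- lam k * t) * a k * psi k z)
      (\<lambda>z. \<Sum>k. exp (- lam k * t) * a k * psi k z) sequentially"
  proof (rule Weierstrass_m_test[OF _ summable_B[OF t]])
    fix k and z :: real assume "z \<in> {0..}"
    then show "norm (exp (- lam k * t) * a k * psi k z) \<le> exp (- lam k * t) * (B k)\<^sup>2"
      using ker_term_le[of a k "\<lambda>k. psi k z" t] a adm_psi[of z] by (simp add: adm_def)
  qed
  then show ?thesis unfolding ker_def
    by (rule uniform_limit_theorem[rotated])
      (auto intro!: always_eventually continuous_intros psi_cont)
qed

lemma ker_cont': "adm a \<Longrightarrow> t > 0 \<Longrightarrow> continuous_on {0<..} (\<lambda>z. ker t a (\<lambda>k. psi k z))"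
  by (rule continuous_on_subset[OF ker_cont]) auto

section \<open>Term-by-term integration and the semigroup property\<close>

lemma psi_cont_open: "continuous_on {0<..} (psi k)"
  by (rule continuous_on_subset[OF psi_cont]) auto

text \<open>Nothing is assumed about \<open>psi k\<close> on the negative reals, hence the
  indicator.\<close>

lemma psi_measurable [measurable]: "(\<lambda>x. indicat_real {0<..} x * psi k x) \<in> borel_measurable borel"
  using borel_measurable_continuous_on_indicator[OF _ psi_cont_open[of k]] by simp

lemma mu_measurable [measurable]: "mu \<in> borel_measurable borel"
  using mu_cont by (rule borel_measurable_continuous_onI)

text \<open>Dominated convergence for the partial sums; \<open>w\<close> has to bound all of them
  simultaneously.\<close>

lemma integral_expansion:
  assumes h: "(\<lambda>x. indicat_real {0<..} x * h x) \<in> borel_measurable borel"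
    and sm: "\<And>x. x > 0 \<Longrightarrow> summable (\<lambda>k. c k * psi k x)"
    and le: "\<And>x n. x > 0 \<Longrightarrow> \<bar>mu x * h x * (\<Sum>k<n. c k * psi k x)\<bar> \<le> w x"
    and w: "set_integrable lborel {0<..} w"
    and int: "\<And>k. set_integrable lborel {0<..} (\<lambda>x. mu x * h x * psi k x)"
  shows "set_integrable lborel {0<..} (\<lambda>x. mu x * h x * (\<Sum>k. c k * psi k x))" (is ?I)
    and "(\<lambda>k. c k * (LINT x:{0<..}|lborel. mu x * h x * psi k x)) sums
      (LINT x:{0<..}|lborel. mu x * h x * (\<Sum>k. c k * psi k x))" (is ?S)
proof -
  let ?i = "indicat_real {0<..}"
  let ?f = "\<lambda>x. ?i x *\<^sub>R (mu x * h x * (\<Sum>k. c k * psi k x))"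
  let ?s = "\<lambda>n x. ?i x *\<^sub>R (mu x * h x * (\<Sum>k<n. c k * psi k x))"
  \<comment> \<open>The indicator is moved into each factor, since only the functions cut off to the
    half-line are known to be measurable.\<close>
  have eq: "?s n x = mu x * (?i x * h x) * (\<Sum>k<n. c k * (?i x * psi k x))" for n x
    by (simp add: indicator_def)
  have s_meas: "?s n \<in> borel_measurable lborel" for n
    unfolding eq using h by measurable
  have conv: "(\<lambda>n. ?s n x) \<longlonglongrightarrow> ?f x" for x
  proof (cases "x > 0")
    case True
    then show ?thesis using summable_LIMSEQ[OF sm[OF True]] by (auto intro!: tendsto_intros)
  qed simp
  have f_meas: "?f \<in> borel_measurable lborel"
    using s_meas conv by (rule borel_measurable_LIMSEQ_real[rotated])
  have dom: "norm (?s n x) \<le> ?i x *\<^sub>R w x" for n x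
    using le[of x n] by (simp add: indicator_def)
  note dc = f_meas s_meas w[unfolded set_integrable_def] AE_I2[OF conv] AE_I2[OF dom]
  show ?I unfolding set_integrable_def by (rule integrable_dominated_convergence[OF dc])
  have "(\<lambda>n. integral\<^sup>L lborel (?s n)) \<longlonglongrightarrow> integral\<^sup>L lborel ?f"
    by (rule integral_dominated_convergence[OF dc])
  moreover have "integral\<^sup>L lborel (?s n) = (\<Sum>k<n. c k * (LINT x:{0<..}|lborel. mu x * h x * psi k x))" for n
  proof -
    have "?s n = (\<lambda>x. \<Sum>k<n. c k * (?i x *\<^sub>R (mu x * h x * psi k x)))"
      by (simp add: sum_distrib_left mult_ac)
    then show ?thesis unfolding set_lebesgue_integral_def
      using int by (simp only: set_integrable_def Bochner_Integration.integral_sum integrable_mult_right integral_mult_right_zero)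
  qed
  ultimately show ?S unfolding sums_def set_lebesgue_integral_def by simp
qed

lemma ker_integral_expansion:
  assumes a: "adm a" and t: "t > 0"
    and h: "continuous_on {0<..} h" and hb: "\<And>x. x > 0 \<Longrightarrow> \<bar>h x\<bar> \<le> C"
  shows "set_integrable lborel {0<..} (\<lambda>x. mu x * h x * ker t a (\<lambda>k. psi k x))" (is ?I)
    and "(\<lambda>k. exp (- lam k * t) * a k * (LINT x:{0<..}|lborel. mu x * h x * psi k x)) sums
      (LINT x:{0<..}|lborel. mu x * h x * ker t a (\<lambda>k. psi k x))" (is ?S)
proof -
  let ?Z = "\<Sum>k. exp (- lam k * t) * (B k)\<^sup>2"
  have S0: "?Z \<ge> 0" by (intro suminf_nonneg summable_B t) auto
  have C0: "C \<ge> 0" using hb[of 1] by simp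
  have hm: "(\<lambda>x. indicat_real {0<..} x * h x) \<in> borel_measurable borel"
    using borel_measurable_continuous_on_indicator[OF _ h] by simp
  have w: "set_integrable lborel {0<..} (\<lambda>x. C * ?Z * mu x)"
    by (intro set_integrable_mult_right mu_integrable)
  have le: "\<bar>mu x * h x * (\<Sum>k<n. (exp (- lam k * t) * a k) * psi k x)\<bar> \<le> C * ?Z * mu x" if "x > 0" for x n
  proof -
    have "\<bar>h x\<bar> * \<bar>\<Sum>k<n. (exp (- lam k * t) * a k) * psi k x\<bar> \<le> C * ?Z"
      using hb[OF that] partial_ker_le[OF a adm_psi t, of x n] that C0 by (intro mult_mono) auto
    then have "mu x * (\<bar>h x\<bar> * \<bar>\<Sum>k<n. (exp (- lam k * t) * a k) * psi k x\<bar>) \<le> mu x * (C * ?Z)"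
      using mu_pos[of x] by (intro mult_left_mono) auto
    then show ?thesis using mu_pos[of x] by (simp add: abs_mult mult_ac)
  qed
  have int: "set_integrable lborel {0<..} (\<lambda>x. mu x * h x * psi k x)" for k
  proof (rule set_integrable_bound_cont)
    show "continuous_on {0<..} (\<lambda>x. mu x * h x * psi k x)"
      by (intro continuous_intros h psi_cont_open)
    show "set_integrable lborel {0<..} (\<lambda>x. C * M k * mu x)"
      by (intro set_integrable_mult_right mu_integrable)
    fix x :: real assume x: "x > 0"
    have "\<bar>h x\<bar> * \<bar>psi k x\<bar> \<le> C * M k"
      using hb[OF x] psi_le_M[of x k] x C0 by (intro mult_mono) auto
    then have "mu x * (\<bar>h x\<bar> * \<bar>psi k x\<bar>) \<le> mu x * (C * M k)"
      using mu_pos[of x] by (intro mult_left_mono) auto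
    then show "\<bar>mu x * h x * psi k x\<bar> \<le> C * M k * mu x"
      using mu_pos[of x] by (simp add: abs_mult mult_ac)
  qed
  have sm: "summable (\<lambda>k. (exp (- lam k * t) * a k) * psi k x)" if "x > 0" for x
    using summable_ker[OF a adm_psi t, of x] that by simp
  show ?I ?S
    using integral_expansion[OF hm sm le w int] by (simp_all add: ker_def)
qed

lemma ker_coefficient:
  assumes a: "adm a" and t: "t > 0"
  shows "(LINT x:{0<..}|lborel. mu x * ker t a (\<lambda>k. psi k x) * psi j x) = exp (- lam j * t) * a j"
proof -
  have "(\<lambda>k. exp (- lam k * t) * a k * (LINT x:{0<..}|lborel. mu x * psi j x * psi k x)) sums
      (LINT x:{0<..}|lborel. mu x * psi j x * ker t a (\<lambda>k. psi k x))"
    by (rule ker_integral_expansion[OF a t psi_cont_open]) (auto intro!: psi_le_M)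
  moreover have "(\<lambda>k. exp (- lam k * t) * a k * (LINT x:{0<..}|lborel. mu x * psi j x * psi k x)) sums
      (exp (- lam j * t) * a j)"
    using sums_If_finite[of "\<lambda>k. k = j" "\<lambda>k. exp (- lam k * t) * a k"]
    by (simp add: orthonormal(2) if_distrib eq_commute[of j] cong: if_cong)
  ultimately show ?thesis by (simp add: sums_unique2 mult_ac)
qed

text \<open>Expands the second kernel against the first, whose coefficients
  \<open>ker_coefficient\<close> has already computed.\<close>

lemma semigroup:
  assumes a: "adm a" and b: "adm b" and s: "s > 0" and t: "t > 0"
  shows "set_integrable lborel {0<..} (\<lambda>x. mu x * ker s a (\<lambda>k. psi k x) * ker t b (\<lambda>k. psi k x))" (is ?I)
    and "(LINT x:{0<..}|lborel. mu x * ker s a (\<lambda>k. psi k x) * ker t b (\<lambda>k. psi k x)) = ker (s + t) a b" (is ?E)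
proof -
  note e = ker_integral_expansion[OF b t ker_cont'[OF a s], of "\<Sum>k. exp (- lam k * s) * (B k)\<^sup>2"]
  have le: "\<bar>ker s a (\<lambda>k. psi k x)\<bar> \<le> (\<Sum>k. exp (- lam k * s) * (B k)\<^sup>2)" if "x > 0" for x
    using that by (intro ker_abs_le a s adm_psi) auto
  show ?I using e(1) le by blast
  have "(\<lambda>k. exp (- lam k * t) * b k * (exp (- lam k * s) * a k)) sums
      (LINT x:{0<..}|lborel. mu x * ker s a (\<lambda>k. psi k x) * ker t b (\<lambda>k. psi k x))"
    using e(2) le unfolding ker_coefficient[OF a s] by blast
  moreover have "(\<lambda>k. exp (- lam k * t) * b k * (exp (- lam k * s) * a k)) = (\<lambda>k. exp (- lam k * (s + t)) * a k * b k)"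
    by (simp add: distrib_left exp_add mult_ac exp_diff exp_minus field_simps)
  ultimately show ?E unfolding ker_def by (simp add: sums_iff)
qed

section \<open>The Green kernel\<close>

lemma flux_primitive:
  assumes "0 < x" "x \<le> y"
  shows "lam k * integral {x..y} (\<lambda>z. mu z * psi k z) = flux k x - flux k y"
proof -
  have "((\<lambda>z. - (lam k * mu z * psi k z)) has_integral (flux k y - flux k x)) {x..y}"
    using assms by (intro fundamental_theorem_of_calculus)
      (auto intro!: has_field_derivative_at_within flux_deriv simp flip: has_real_derivative_iff_has_vector_derivative)
  then have "integral {x..y} (\<lambda>z. - (lam k * mu z * psi k z)) = flux k y - flux k x"
    by (rule integral_unique)
  moreover have "(\<lambda>z. - (lam k * mu z * psi k z)) = (\<lambda>z. - lam k * (mu z * psi k z))" by auto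
  ultimately show ?thesis by simp
qed

lemma mu_Lam_psi_cont: "continuous_on {0..} (\<lambda>x. mu x * Lam x * psi k x)"
  by (intro continuous_intros psi_cont)

text \<open>The derivative of \<open>psi k x - Lam x * flux k x\<close> is
  \<open>lam k * mu x * Lam x * psi k x\<close>, and the expression vanishes at 0 because the flux
  stays bounded there.\<close>

lemma psi_primitive:
  assumes x: "0 < x"
  shows "lam k * integral {0..x} (\<lambda>z. mu z * Lam z * psi k z) = psi k x - Lam x * flux k x"
proof -
  let ?P = "\<lambda>x. integral {0..x} (\<lambda>z. mu z * Lam z * psi k z)"
  let ?N = "\<lambda>x. lam k * ?P x + Lam x * flux k x - psi k x"
  have "\<exists>c. \<forall>x\<in>{0<..}. ?N x = c"
  proof (rule has_field_derivative_zero_constant)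
    fix y :: real assume y: "y \<in> {0<..}"
    have "(?N has_real_derivative lam k * (mu y * Lam y * psi k y) +
        (exp (g y) * flux k y + (- (lam k * mu y * psi k y)) * Lam y) - exp (g y) * flux k y) (at y)"
      using y by (intro DERIV_add DERIV_diff DERIV_cmult DERIV_mult flux_deriv psi_deriv Lam_deriv
        primitive_deriv[OF mu_Lam_psi_cont]) auto
    then have "(?N has_real_derivative 0) (at y)" by (simp add: algebra_simps)
    then show "(?N has_real_derivative 0) (at y within {0<..})"
      by (rule has_field_derivative_at_within)
  qed auto
  then obtain c where c: "\<And>y. y > 0 \<Longrightarrow> ?N y = c" by auto
  obtain d where d: "(flux k \<longlongrightarrow> d) (at_right 0)" using flux_at_right by blast
  have "(?N \<longlongrightarrow> lam k * ?P 0 + Lam 0 * d - 0) (at_right 0)"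
    by (intro tendsto_intros d psi_at_right tendsto_at_right_0[OF Lam_cont]
      tendsto_at_right_0[OF primitive_cont[OF mu_Lam_psi_cont]])
  then have "(?N \<longlongrightarrow> 0) (at_right 0)" by (simp add: Lam_0)
  moreover have "(?N \<longlongrightarrow> c) (at_right 0)"
    by (rule tendsto_eventually, rule eventually_mono[OF eventually_at_right_less[of 0]]) (rule c)
  ultimately have "0 = c" by (rule tendsto_unique[rotated]) simp
  with c[OF x] show ?thesis by simp
qed

lemma Lam_min: "0 \<le> x \<Longrightarrow> 0 \<le> y \<Longrightarrow> Lam (min x y) = min (Lam x) (Lam y)"
  using Lam_mono[of x y] Lam_mono[of y x] by (auto simp: min_def)

text \<open>Below \<open>x\<close> the kernel is \<open>Lam y\<close>, above it the constant
  \<open>Lam x\<close>. The flux terms of the two pieces cancel at \<open>x\<close>, and the one at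
  \<open>R\<close> vanishes in the limit.\<close>

lemma green_coefficient:
  assumes x: "x > 0"
  shows "set_integrable lborel {0<..} (\<lambda>y. mu y * Lam (min x y) * psi k y)" (is ?I)
    and "(LINT y:{0<..}|lborel. mu y * Lam (min x y) * psi k y) = psi k x / lam k" (is ?E)
proof -
  let ?f = "\<lambda>y. mu y * Lam (min x y) * psi k y"
  show I: ?I
  proof (rule set_integrable_bound_cont)
    show "continuous_on {0<..} ?f" by (intro continuous_intros psi_cont_open)
    show "set_integrable lborel {0<..} (\<lambda>y. Lam x * M k * mu y)"
      by (intro set_integrable_mult_right mu_integrable)
    fix y :: real assume y: "y > 0"
    have "\<bar>Lam (min x y)\<bar> * \<bar>psi k y\<bar> \<le> Lam x * M k"
      using Lam_mono[of "min x y" x] Lam_nonneg[of "min x y"] psi_le_M[of y k] x y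
      by (intro mult_mono) auto
    then have "mu y * (\<bar>Lam (min x y)\<bar> * \<bar>psi k y\<bar>) \<le> mu y * (Lam x * M k)"
      using mu_pos[of y] by (intro mult_left_mono) auto
    then show "\<bar>?f y\<bar> \<le> Lam x * M k * mu y"
      using mu_pos[of y] by (simp add: abs_mult mult_ac)
  qed
  have eq: "lam k * integral {0..R} ?f = psi k x - Lam x * flux k R" if R: "R \<ge> x" for R
  proof -
    have int: "?f integrable_on {0..R}"
      by (intro integrable_continuous_interval continuous_intros psi_cont') simp
    have "integral {0..R} ?f = integral {0..x} ?f + integral {x..R} ?f"
      using Henstock_Kurzweil_Integration.integral_combine[OF _ R int] x by simp
    moreover have "integral {0..x} ?f = integral {0..x} (\<lambda>z. mu z * Lam z * psi k z)"
      by (rule integral_cong) (simp add: min_absorb2)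
    moreover have "integral {x..R} ?f = integral {x..R} (\<lambda>z. Lam x * (mu z * psi k z))"
      by (rule integral_cong) (auto simp: min_def)
    moreover have "integral {x..R} (\<lambda>z. Lam x * (mu z * psi k z)) = Lam x * integral {x..R} (\<lambda>z. mu z * psi k z)"
      by simp
    ultimately have "lam k * integral {0..R} ?f = lam k * integral {0..x} (\<lambda>z. mu z * Lam z * psi k z) +
        Lam x * (lam k * integral {x..R} (\<lambda>z. mu z * psi k z))"
      by (simp add: algebra_simps)
    then show ?thesis unfolding psi_primitive[OF x] flux_primitive[OF x R] by (simp add: algebra_simps)
  qed
  have "((\<lambda>R. lam k * integral {0..R} ?f) \<longlongrightarrow> lam k * (LINT y:{0<..}|lborel. ?f y)) at_top"
    by (intro tendsto_intros primitive_tendsto_LINT I)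
  moreover have "((\<lambda>R. lam k * integral {0..R} ?f) \<longlongrightarrow> psi k x) at_top"
  proof (rule Lim_transform_eventually)
    show "((\<lambda>R. psi k x - Lam x * flux k R) \<longlongrightarrow> psi k x) at_top"
      using tendsto_diff[OF tendsto_const tendsto_mult_left[OF flux_tendsto, of "Lam x" k], of "psi k x"] by simp
    show "\<forall>\<^sub>F R in at_top. psi k x - Lam x * flux k R = lam k * integral {0..R} ?f"
      by (rule eventually_mono[OF eventually_ge_at_top[of x]]) (simp add: eq)
  qed
  ultimately have "lam k * (LINT y:{0<..}|lborel. ?f y) = psi k x"
    by (rule tendsto_unique[rotated]) simp
  then show ?E using lam_pos[of k] by (simp add: field_simps)
qed

lemma summable_bessel:
  assumes "x > 0"
  shows "summable (\<lambda>k. (psi k x)\<^sup>2 / lam k)"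
proof (rule bounded_imp_summable)
  show "(psi k x)\<^sup>2 / lam k \<ge> 0" for k using lam_pos[of k] by simp
  show "(\<Sum>k\<le>n. (psi k x)\<^sup>2 / lam k) \<le> Lam x" for n by (rule bessel) (use assms in auto)
qed

text \<open>Splits each term between the energy of \<open>a\<close> and the Bessel series by the
  weights \<open>sqrt (lam k)\<close> and its inverse, then uses
  \<open>2 * u * v \<le> u\<^sup>2 + v\<^sup>2\<close>.\<close>

lemma summable_weighted:
  assumes a: "summable (\<lambda>k. lam k * (a k)\<^sup>2)" and x: "x > 0"
  shows "summable (\<lambda>k. \<bar>a k * psi k x\<bar>)"
proof (rule summable_comparison_test'[OF summable_add[OF a summable_bessel[OF x]]])
  fix k
  have l: "lam k > 0" by (rule lam_pos)
  have "\<bar>a k * psi k x\<bar> = (sqrt (lam k) * \<bar>a k\<bar>) * (\<bar>psi k x\<bar> / sqrt (lam k))"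
    using l by (simp add: abs_mult)
  also have "2 * \<dots> \<le> (sqrt (lam k) * \<bar>a k\<bar>)\<^sup>2 + (\<bar>psi k x\<bar> / sqrt (lam k))\<^sup>2"
    using sum_squares_bound[of "sqrt (lam k) * \<bar>a k\<bar>" "\<bar>psi k x\<bar> / sqrt (lam k)"] by (simp only: mult.assoc)
  also have "\<dots> = lam k * (a k)\<^sup>2 + (psi k x)\<^sup>2 / lam k"
    using l by (simp add: power_mult_distrib power_divide)
  finally show "norm \<bar>a k * psi k x\<bar> \<le> lam k * (a k)\<^sup>2 + (psi k x)\<^sup>2 / lam k" by simp
qed

text \<open>The series and the Green kernel have the same coefficients, and the squares of both are
  at most \<open>Lam y * Lam x\<close>, so their difference is square integrable and completeness
  applies. Hence the identity only almost everywhere.\<close>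

lemma mercer:
  assumes x: "x > 0"
  shows "AE y in lborel. y > 0 \<longrightarrow> (\<lambda>k. psi k x / lam k * psi k y) sums Lam (min x y)"
proof -
  let ?c = "\<lambda>k. psi k x / lam k"
  let ?F = "\<lambda>y. \<Sum>k. ?c k * psi k y"
  define h where "h = (\<lambda>y. indicat_real {0<..} y * (?F y - Lam (min x y)))"
  have c_eq: "lam k * (?c k)\<^sup>2 = (psi k x)\<^sup>2 / lam k" for k
    using lam_pos[of k] by (simp add: power_divide power2_eq_square)
  have c_sum: "summable (\<lambda>k. lam k * (?c k)\<^sup>2)"
    unfolding c_eq by (rule summable_bessel[OF x])
  have sm: "summable (\<lambda>k. ?c k * psi k y)" if "y > 0" for y
    by (rule summable_rabs_cancel[OF summable_weighted[OF c_sum that]])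
  have sq: "(\<Sum>k<n. ?c k * psi k y)\<^sup>2 \<le> Lam y * Lam x" if y: "y > 0" for y n
  proof -
    have "(\<Sum>k<n. ?c k * psi k y)\<^sup>2 \<le> Lam y * (\<Sum>k<n. lam k * (?c k)\<^sup>2)"
      by (rule energy_square) (use y in auto)
    also have "\<dots> \<le> Lam y * Lam x"
      unfolding c_eq using bessel[of "{..<n}" x] x Lam_nonneg[of y] y by (intro mult_left_mono) auto
    finally show ?thesis .
  qed
  have F_sq: "(?F y)\<^sup>2 \<le> Lam y * Lam x" if y: "y > 0" for y
  proof (rule tendsto_upperbound[OF tendsto_power[OF summable_LIMSEQ[OF sm[OF y]], of 2]])
    show "\<forall>\<^sub>F n in sequentially. (\<Sum>k<n. ?c k * psi k y)\<^sup>2 \<le> Lam y * Lam x"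
      by (intro always_eventually allI sq y)
  qed (rule sequentially_bot)
  \<comment> \<open>A bound linear in \<open>Lam y\<close> is integrable against \<open>mu\<close>
    by the trace identity, so it can dominate the partial sums.\<close>
  have abs_le: "\<bar>\<Sum>k<n. ?c k * psi k y\<bar> \<le> Lam y + Lam x" if y: "y > 0" for y n
  proof -
    have L: "Lam y \<ge> 0" "Lam x \<ge> 0" using Lam_nonneg x y by auto
    have "Lam y * Lam x \<le> (Lam y + Lam x)\<^sup>2"
      using L by (simp add: power2_eq_square algebra_simps)
    then have "(\<Sum>k<n. ?c k * psi k y)\<^sup>2 \<le> (Lam y + Lam x)\<^sup>2"
      using sq[OF y, of n] by (rule order.trans[rotated])
    then have "\<bar>\<Sum>k<n. ?c k * psi k y\<bar> \<le> \<bar>Lam y + Lam x\<bar>"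
      by (simp only: abs_le_square_iff)
    then show ?thesis using L by (simp only: abs_of_nonneg add_nonneg_nonneg)
  qed
  have ex: "set_integrable lborel {0<..} (\<lambda>y. mu y * psi j y * ?F y)"
      "(\<lambda>k. ?c k * (LINT y:{0<..}|lborel. mu y * psi j y * psi k y)) sums
        (LINT y:{0<..}|lborel. mu y * psi j y * ?F y)" for j
  proof -
    have w: "set_integrable lborel {0<..} (\<lambda>y. M j * (mu y * Lam y + Lam x * mu y))"
      by (intro set_integrable_mult_right set_integral_add mu_integrable mu_Lam_integrable)
    have le: "\<bar>mu y * psi j y * (\<Sum>k<n. ?c k * psi k y)\<bar> \<le> M j * (mu y * Lam y + Lam x * mu y)"
      if y: "y > 0" for y n
    proof -
      have "\<bar>psi j y\<bar> * \<bar>\<Sum>k<n. ?c k * psi k y\<bar> \<le> M j * (Lam y + Lam x)"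
        using abs_le[OF y] psi_le_M[of y j] y M_nonneg by (intro mult_mono) auto
      then have "mu y * (\<bar>psi j y\<bar> * \<bar>\<Sum>k<n. ?c k * psi k y\<bar>) \<le> mu y * (M j * (Lam y + Lam x))"
        using mu_pos[of y] by (intro mult_left_mono) auto
      then show ?thesis using mu_pos[of y] by (simp add: abs_mult algebra_simps)
    qed
    show "set_integrable lborel {0<..} (\<lambda>y. mu y * psi j y * ?F y)"
        "(\<lambda>k. ?c k * (LINT y:{0<..}|lborel. mu y * psi j y * psi k y)) sums
        (LINT y:{0<..}|lborel. mu y * psi j y * ?F y)"
      using integral_expansion[OF psi_measurable sm le w orthonormal(1)] by blast+
  qed
  have F_coeff: "(LINT y:{0<..}|lborel. mu y * psi j y * ?F y) = ?c j" for j
  proof -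
    have "(\<lambda>k. ?c k * (LINT y:{0<..}|lborel. mu y * psi j y * psi k y)) sums ?c j"
      using sums_If_finite[of "\<lambda>k. k = j" ?c]
      by (simp add: orthonormal(2) if_distrib eq_commute[of j] cong: if_cong)
    with ex(2)[of j] show ?thesis by (rule sums_unique2)
  qed
  have h_meas: "h \<in> borel_measurable borel"
  proof -
    have "h = (\<lambda>y. (\<Sum>k. ?c k * (indicat_real {0<..} y * psi k y)) - indicat_real {0<..} y * Lam (min x y))"
      by (auto simp: h_def indicator_def)
    moreover have "(\<lambda>y. Lam (min x y)) \<in> borel_measurable borel"
      by (intro borel_measurable_continuous_onI continuous_intros)
    ultimately show ?thesis by simp
  qed
  have "AE y in lborel. y > 0 \<longrightarrow> h y = 0"
  proof (rule complete)
    show "h \<in> borel_measurable lborel" using h_meas by simp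
    show "set_integrable lborel {0<..} (\<lambda>y. mu y * (h y)\<^sup>2)"
      unfolding set_integrable_def
    proof (rule Bochner_Integration.integrable_bound)
      show "integrable lborel (\<lambda>y. indicator {0<..} y *\<^sub>R (4 * Lam x * (mu y * Lam y)))"
        using set_integrable_mult_right[OF mu_Lam_integrable, of "4 * Lam x"] by (simp add: set_integrable_def)
      show "(\<lambda>y. indicator {0<..} y *\<^sub>R (mu y * (h y)\<^sup>2)) \<in> borel_measurable lborel"
        using h_meas by simp
      have "mu y * (h y)\<^sup>2 \<le> 4 * Lam x * (mu y * Lam y)" if y: "y > 0" for y
      proof -
        have m: "(Lam (min x y))\<^sup>2 \<le> Lam y * Lam x"
          unfolding power2_eq_square using x y Lam_nonneg[of "min x y"] Lam_nonneg[of y]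
          by (intro mult_mono Lam_mono) auto
        have "(h y)\<^sup>2 \<le> 2 * (?F y)\<^sup>2 + 2 * (Lam (min x y))\<^sup>2"
          using y sum_squares_bound[of "?F y" "- Lam (min x y)"]
          by (simp add: h_def power2_diff)
        also have "\<dots> \<le> 4 * (Lam y * Lam x)" using F_sq[OF y] m by simp
        finally have "mu y * (h y)\<^sup>2 \<le> mu y * (4 * (Lam y * Lam x))"
          using mu_pos[of y] by (intro mult_left_mono) auto
        then show ?thesis by (simp add: mult_ac)
      qed
      then have "norm (mu y * (h y)\<^sup>2) \<le> norm (4 * Lam x * (mu y * Lam y))" if "y > 0" for y
        using that mu_pos[of y] unfolding real_norm_def
        by (subst abs_of_nonneg) (auto intro: order.trans[OF _ abs_ge_self])
      then show "AE y in lborel. norm (indicator {0<..} y *\<^sub>R (mu y * (h y)\<^sup>2)) \<le>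
          norm (indicator {0<..} y *\<^sub>R (4 * Lam x * (mu y * Lam y)))"
        by (intro AE_I2) (simp add: indicator_def)
    qed
    fix k
    have "(LINT y:{0<..}|lborel. mu y * h y * psi k y)
        = (LINT y:{0<..}|lborel. mu y * psi k y * ?F y - mu y * Lam (min x y) * psi k y)"
      by (rule set_lebesgue_integral_cong) (auto simp: h_def algebra_simps)
    also have "\<dots> = 0"
      unfolding set_integral_diff(2)[OF ex(1) green_coefficient(1)[OF x]] F_coeff green_coefficient(2)[OF x]
      by simp
    finally show "(LINT y:{0<..}|lborel. mu y * h y * psi k y) = 0" .
  qed
  then show ?thesis
  proof eventually_elim
    case (elim y)
    show ?case
    proof
      assume y: "y > 0"
      with elim have "?F y = Lam (min x y)" by (simp add: h_def)
      then show "(\<lambda>k. ?c k * psi k y) sums Lam (min x y)" using sm[OF y] by (simp add: sums_iff)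
    qed
  qed
qed

section \<open>Positivity\<close>

text \<open>\<open>1 + Lam\<close> is harmonic and unbounded, which keeps the minimum of
  \<open>u + \<delta> (1 + Lam + t)\<close> in a bounded region.\<close>

lemma maximum_principle:
  assumes A: "finite A" and \<delta>: "\<delta> > 0"
    and init: "\<And>x. x > 0 \<Longrightarrow> (\<Sum>k\<in>A. a k * psi k x) \<ge> - \<delta> * (1 + Lam x)"
    and t: "t \<ge> 0" and x: "x \<ge> 0"
  shows "(\<Sum>k\<in>A. exp (- lam k * t) * a k * psi k x) \<ge> - \<delta> * (1 + Lam x + t)"
proof (rule ccontr)
  define v where "v = (\<lambda>s y. (\<Sum>k\<in>A. exp (- lam k * s) * a k * psi k y) + \<delta> * (1 + Lam y + s))"
  assume "\<not> ?thesis"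
  then have neg: "v t x < 0" by (simp add: v_def)
  define C where "C = (\<Sum>k\<in>A. \<bar>a k\<bar> * M k)"
  have C: "(\<Sum>k\<in>A. exp (- lam k * s) * a k * psi k y) \<ge> - C" if "s \<ge> 0" "y \<ge> 0" for s y
  proof -
    have "\<bar>\<Sum>k\<in>A. exp (- lam k * s) * a k * psi k y\<bar> \<le> C"
      unfolding C_def
    proof (intro order.trans[OF sum_abs] sum_mono)
      fix k
      have "exp (- lam k * s) * (\<bar>a k\<bar> * \<bar>psi k y\<bar>) \<le> 1 * (\<bar>a k\<bar> * M k)"
        using that lam_pos[of k] psi_le_M[of y k] by (intro mult_mono mult_left_mono) auto
      then show "\<bar>exp (- lam k * s) * a k * psi k y\<bar> \<le> \<bar>a k\<bar> * M k" by (simp add: abs_mult mult.assoc)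
    qed
    then show ?thesis by simp
  qed
  have "\<forall>\<^sub>F R in at_top. C / \<delta> \<le> Lam R \<and> x < R"
    using Lam_at_top[unfolded filterlim_at_top, rule_format, of "C / \<delta>"] eventually_gt_at_top[of x]
    by (rule eventually_conj)
  then obtain R where R: "C / \<delta> \<le> Lam R" "x < R"
    using eventually_happens'[OF trivial_limit_at_top_linorder] by blast
  \<comment> \<open>A negative minimum on this rectangle avoids \<open>y = 0\<close>, where
    \<open>psi k\<close> vanishes, \<open>y = R\<close>, by the choice of \<open>R\<close>, and
    \<open>s = 0\<close>, by the initial condition. The final time is not excluded, so only earlier
    times may be compared.\<close>
  let ?S = "{0..t} \<times> {0..R}"
  have "continuous_on ?S (\<lambda>p. v (fst p) (snd p))"
    unfolding v_def
    by (intro continuous_intros continuous_on_compose2[OF psi_cont]) (auto intro!: continuous_intros)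
  moreover have "compact ?S" by (intro compact_Times) auto
  moreover have "?S \<noteq> {}" using t x R by auto
  ultimately obtain p where p: "p \<in> ?S" "\<And>p'. p' \<in> ?S \<Longrightarrow> v (fst p) (snd p) \<le> v (fst p') (snd p')"
    using continuous_attains_inf[of ?S "\<lambda>p. v (fst p) (snd p)"] by blast
  define s y where "s = fst p" and "y = snd p"
  have sy: "0 \<le> s" "s \<le> t" "0 \<le> y" "y \<le> R" using p(1) by (auto simp: s_def y_def)
  have min: "v s y \<le> v s' y'" if "0 \<le> s'" "s' \<le> t" "0 \<le> y'" "y' \<le> R" for s' y'
    using p(2)[of "(s', y')"] that by (simp add: s_def y_def)
  have vneg: "v s y < 0" using min[of t x] neg t x R by simp
  have "y \<noteq> 0"
  proof
    assume "y = 0"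
    then have "v s y = \<delta> * (1 + s)" by (simp add: v_def psi_0 Lam_0)
    moreover have "\<delta> * (1 + s) > 0" using \<delta> sy by simp
    ultimately show False using vneg by simp
  qed
  then have y0: "y > 0" using sy by simp
  have "y \<noteq> R"
  proof
    assume "y = R"
    have "C \<le> \<delta> * Lam R" using R \<delta> by (simp add: field_simps)
    also have "\<dots> \<le> \<delta> * (1 + Lam R + s)" using \<delta> sy by (intro mult_left_mono) auto
    finally show False using C[of s y] sy vneg \<open>y = R\<close> by (simp add: v_def)
  qed
  then have yR: "y < R" using sy by simp
  have "s \<noteq> 0"
  proof
    assume "s = 0"
    then show False using init[OF y0] vneg by (simp add: v_def)
  qed
  then have s0: "s > 0" using sy by simp
  define W where "W = (\<Sum>k\<in>A. exp (- lam k * s) * a k * (lam k * psi k y))"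
  define D where "D = (\<lambda>y. (\<Sum>k\<in>A. exp (- lam k * s) * a k * flux k y) + \<delta>)"
  have vy: "(v s has_real_derivative exp (g z) * D z) (at z)" if "z > 0" for z
  proof -
    have "(v s has_real_derivative (\<Sum>k\<in>A. exp (- lam k * s) * a k * (exp (g z) * flux k z)) + \<delta> * (0 + exp (g z) + 0)) (at z)"
      unfolding v_def using that
      by (intro DERIV_add DERIV_sum DERIV_cmult psi_deriv Lam_deriv DERIV_const)
    then show ?thesis by (simp add: D_def algebra_simps sum_distrib_left)
  qed
  have Dy: "(D has_real_derivative - (mu y * W)) (at y)"
  proof -
    have "(D has_real_derivative (\<Sum>k\<in>A. exp (- lam k * s) * a k * (- (lam k * mu y * psi k y))) + 0) (at y)"
      unfolding D_def using y0 by (intro DERIV_add DERIV_sum DERIV_cmult flux_deriv DERIV_const)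
    then show ?thesis by (simp add: W_def sum_distrib_left sum_negf mult_ac)
  qed
  have vs: "((\<lambda>s. v s y) has_real_derivative \<delta> - W) (at s)"
    unfolding v_def W_def
    by (auto intro!: derivative_eq_intros simp: sum_negf algebra_simps)
  \<comment> \<open>At the minimum the time derivative \<open>\<delta> - W\<close> cannot be
    positive, or slightly earlier values would be smaller.\<close>
  have W: "W \<ge> \<delta>"
  proof (rule ccontr)
    assume "\<not> W \<ge> \<delta>"
    then have "\<delta> - W > 0" by simp
    then obtain d where d: "d > 0" "\<And>h. 0 < h \<Longrightarrow> h < d \<Longrightarrow> v (s - h) y < v s y"
      using DERIV_pos_inc_left[OF vs] by blast
    define h where "h = min (d / 2) s"
    have "0 < h" "h < d" "h \<le> s" using d s0 by (auto simp: h_def)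
    then show False using d(2)[of h] min[of "s - h" y] sy by simp
  qed
  \<comment> \<open>In space the scale derivative \<open>D\<close> vanishes at the minimum, but
    \<open>W > 0\<close> makes it negative just to the right, so \<open>v s\<close> would decrease
    there.\<close>
  have "exp (g y) * D y = 0"
  proof (rule DERIV_local_min[OF vy[OF y0], of "min y (R - y)"])
    show "0 < min y (R - y)" using y0 yR by simp
    show "\<forall>z. \<bar>y - z\<bar> < min y (R - y) \<longrightarrow> v s y \<le> v s z"
    proof (intro allI impI)
      fix z assume "\<bar>y - z\<bar> < min y (R - y)"
      then have "0 \<le> z" "z \<le> R" by auto
      then show "v s y \<le> v s z" using min[of s z] sy by simp
    qed
  qed
  then have Dy0: "D y = 0" by simp
  have "- (mu y * W) < 0" using mu_pos[of y] W \<delta> by simp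
  then obtain d where d: "d > 0" "\<And>h. 0 < h \<Longrightarrow> h < d \<Longrightarrow> D (y + h) < D y"
    using DERIV_neg_dec_right[OF Dy] by blast
  define h where "h = min (d / 2) (R - y)"
  have h: "0 < h" "h < d" "y + h \<le> R" using d yR by (auto simp: h_def)
  obtain z where z: "y < z" "z < y + h" "v s (y + h) - v s y = (y + h - y) * (exp (g z) * D z)"
    using MVT2[of y "y + h" "v s" "\<lambda>z. exp (g z) * D z"] h y0 vy by auto
  have "D z < 0" using d(2)[of "z - y"] z h Dy0 by simp
  then have "(y + h - y) * (exp (g z) * D z) < 0" using h by (intro mult_pos_neg) auto
  then have "v s (y + h) < v s y" using z(3) by linarith
  then show False using min[of s "y + h"] sy h by simp
qed

text \<open>Each partial sum starts above \<open>- \<delta> N * (1 + Lam y)\<close>, with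
  \<open>\<delta> N\<close> tending to 0 along with the tail energy. The maximum principle carries
  this bound to time \<open>t\<close>, and \<open>N\<close> tends to infinity.\<close>

lemma positivity:
  assumes a: "summable (\<lambda>k. lam k * (a k)\<^sup>2)"
    and f: "AE x in lborel. x > 0 \<longrightarrow> (\<lambda>k. a k * psi k x) sums f x"
    and f0: "\<And>x. x > 0 \<Longrightarrow> f x \<ge> 0"
    and t: "t > 0" and x: "x > 0"
  shows "summable (\<lambda>k. exp (- lam k * t) * a k * psi k x)" (is ?S)
    and "(\<Sum>k. exp (- lam k * t) * a k * psi k x) \<ge> 0" (is ?P)
proof -
  show S: ?S
  proof (rule summable_comparison_test'[OF summable_weighted[OF a x]])
    fix k
    have "exp (- lam k * t) * \<bar>a k * psi k x\<bar> \<le> 1 * \<bar>a k * psi k x\<bar>"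
      using lam_pos[of k] t by (intro mult_right_mono) auto
    then show "norm (exp (- lam k * t) * a k * psi k x) \<le> \<bar>a k * psi k x\<bar>"
      by (simp add: abs_mult mult.assoc)
  qed
  define \<tau> where "\<tau> = (\<lambda>N. \<Sum>k. lam (k + N) * (a (k + N))\<^sup>2)"
  \<comment> \<open>The second summand keeps \<open>\<delta> N\<close> strictly positive even when
    the tail energy is zero.\<close>
  define \<delta> where "\<delta> = (\<lambda>N. sqrt (\<tau> N) + inverse (real (Suc N)))"
  have \<tau>0: "\<tau> N \<ge> 0" for N
    unfolding \<tau>_def using a lam_pos by (intro suminf_nonneg summable_ignore_initial_segment) (auto simp: less_imp_le)
  have \<delta>0: "\<delta> N > 0" for N
    unfolding \<delta>_def using \<tau>0[of N] by (intro add_nonneg_pos) auto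
  have "\<tau> \<longlonglongrightarrow> 0" unfolding \<tau>_def by (rule suminf_exist_split2[OF a])
  then have "(\<lambda>N. sqrt (\<tau> N) + inverse (real (Suc N))) \<longlonglongrightarrow> sqrt 0 + 0"
    by (intro tendsto_intros LIMSEQ_inverse_real_of_nat)
  then have \<delta>lim: "\<delta> \<longlonglongrightarrow> 0" by (simp add: \<delta>_def)
  have init: "(\<Sum>k<N. a k * psi k y) \<ge> - \<delta> N * (1 + Lam y)" if y: "y > 0" for N y
  proof -
    \<comment> \<open>The expansion of \<open>f\<close> holds only almost everywhere, but this
      inequality involves continuous functions alone and so extends to every point.\<close>
    have "- (\<Sum>k<N. a k * psi k y) - \<delta> N * (1 + Lam y) \<le> 0"
    proof (rule AE_le_imp_le[where f = "\<lambda>y. - (\<Sum>k<N. a k * psi k y) - \<delta> N * (1 + Lam y)", OF _ _ y])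
      show "continuous_on {0<..} (\<lambda>y. - (\<Sum>k<N. a k * psi k y) - \<delta> N * (1 + Lam y))"
        by (intro continuous_intros psi_cont_open)
      show "AE y in lborel. y > 0 \<longrightarrow> - (\<Sum>k<N. a k * psi k y) - \<delta> N * (1 + Lam y) \<le> 0"
        using f
      proof eventually_elim
        case (elim y)
        show ?case
        proof
          assume y: "y > 0"
          with elim have s: "(\<lambda>k. a k * psi k y) sums f y" by simp
          have L: "Lam y \<ge> 0" using y by (intro Lam_nonneg) simp
          \<comment> \<open>The error after \<open>N\<close> terms is a limit of finite blocks, each
            controlled through \<open>energy_square\<close> by the tail energy.\<close>
          have "(\<lambda>n. \<Sum>k\<in>{N..<n + N}. a k * psi k y) \<longlonglongrightarrow> f y - (\<Sum>k<N. a k * psi k y)"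
          proof -
            have "(\<lambda>n. \<Sum>k<n + N. a k * psi k y) \<longlonglongrightarrow> f y"
              using s unfolding sums_def by (rule LIMSEQ_ignore_initial_segment)
            then have "(\<lambda>n. (\<Sum>k<n + N. a k * psi k y) - (\<Sum>k<N. a k * psi k y)) \<longlonglongrightarrow> f y - (\<Sum>k<N. a k * psi k y)"
              by (intro tendsto_intros)
            moreover have "(\<Sum>k<n + N. a k * psi k y) - (\<Sum>k<N. a k * psi k y) = (\<Sum>k\<in>{N..<n + N}. a k * psi k y)" for n
              using sum_diff_nat_ivl[of 0 N "n + N" "\<lambda>k. a k * psi k y"] by (simp add: atLeast0LessThan)
            ultimately show ?thesis by simp
          qed
          then have "(\<lambda>n. (\<Sum>k\<in>{N..<n + N}. a k * psi k y)\<^sup>2) \<longlonglongrightarrow> (f y - (\<Sum>k<N. a k * psi k y))\<^sup>2"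
            by (intro tendsto_intros)
          then have "(f y - (\<Sum>k<N. a k * psi k y))\<^sup>2 \<le> Lam y * \<tau> N"
          proof (rule tendsto_upperbound)
            have "(\<Sum>k\<in>{N..<n + N}. a k * psi k y)\<^sup>2 \<le> Lam y * \<tau> N" for n
            proof -
              have "(\<Sum>k\<in>{N..<n + N}. a k * psi k y)\<^sup>2 \<le> Lam y * (\<Sum>k\<in>{N..<n + N}. lam k * (a k)\<^sup>2)"
                by (rule energy_square) (use y in auto)
              also have "(\<Sum>k\<in>{N..<n + N}. lam k * (a k)\<^sup>2) = (\<Sum>k<n. lam (k + N) * (a (k + N))\<^sup>2)"
                using sum.shift_bounds_nat_ivl[of "\<lambda>k. lam k * (a k)\<^sup>2" 0 N n] by (simp add: atLeast0LessThan)
              also have "\<dots> \<le> \<tau> N"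
                unfolding \<tau>_def using a lam_pos
                by (intro sum_le_suminf summable_ignore_initial_segment) (auto simp: less_imp_le)
              finally show ?thesis using L by (simp add: mult_left_mono)
            qed
            then show "\<forall>\<^sub>F n in sequentially. (\<Sum>k\<in>{N..<n + N}. a k * psi k y)\<^sup>2 \<le> Lam y * \<tau> N" by simp
          qed simp
          then have "\<bar>f y - (\<Sum>k<N. a k * psi k y)\<bar> \<le> sqrt (Lam y * \<tau> N)"
            by (intro real_le_rsqrt) simp
          also have "\<dots> = sqrt (Lam y) * sqrt (\<tau> N)" by (rule real_sqrt_mult)
          also have "\<dots> \<le> (1 + Lam y) * \<delta> N"
          proof (rule mult_mono)
            show "sqrt (Lam y) \<le> 1 + Lam y"
              using L by (intro real_le_lsqrt) (auto simp: power2_eq_square algebra_simps)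
            show "sqrt (\<tau> N) \<le> \<delta> N" by (simp add: \<delta>_def)
          qed (use L \<tau>0 in auto)
          finally show "- (\<Sum>k<N. a k * psi k y) - \<delta> N * (1 + Lam y) \<le> 0"
            using f0[OF y] by (simp add: mult.commute)
        qed
      qed
    qed
    then show ?thesis by simp
  qed
  have ge: "(\<Sum>k<N. exp (- lam k * t) * a k * psi k x) \<ge> - \<delta> N * (1 + Lam x + t)" for N
    by (rule maximum_principle[OF _ \<delta>0 init]) (use t x in auto)
  have "(\<lambda>N. - \<delta> N * (1 + Lam x + t)) \<longlonglongrightarrow> - 0 * (1 + Lam x + t)"
    by (intro tendsto_intros \<delta>lim)
  then have "- 0 * (1 + Lam x + t) \<le> (\<Sum>k. exp (- lam k * t) * a k * psi k x)"
    by (rule LIMSEQ_le[OF _ summable_LIMSEQ[OF S]]) (use ge in blast)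
  then show ?P by simp
qed

text \<open>A negative value at \<open>x\<close> would persist nearby and show up against a
  nonnegative bump at \<open>x\<close>. The bump is built from Green kernels, whose expansions are
  known, so \<open>positivity\<close> makes the same integral nonnegative.\<close>

lemma ker_nonneg:
  assumes t: "t > 0" and y: "y > 0" and x: "x > 0"
  shows "ker t (\<lambda>k. psi k y) (\<lambda>k. psi k x) \<ge> 0"
proof (rule ccontr)
  define r where "r = (\<lambda>x. ker t (\<lambda>k. psi k y) (\<lambda>k. psi k x))"
  assume "\<not> ?thesis"
  then have neg: "r x < 0" by (simp add: r_def)
  have r_cont: "continuous_on {0<..} r"
    unfolding r_def using y t by (intro ker_cont' adm_psi) auto
  then have "isCont r x" using x by (simp add: continuous_on_eq_continuous_at)
  then have "\<forall>\<^sub>F z in at x. r z < 0"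
    unfolding isCont_def using neg by (rule order_tendstoD)
  then obtain d where d: "d > 0" "\<And>z. z \<noteq> x \<Longrightarrow> dist z x < d \<Longrightarrow> r z < 0"
    unfolding eventually_at by auto
  define e where "e = min d x / 2"
  have e: "e > 0" "e < d" "e < x" using d x by (auto simp: e_def)
  have rneg: "r z < 0" if "x - e \<le> z" "z \<le> x + e" for z
    using that d(2)[of z] neg e by (cases "z = x") (auto simp: dist_real_def)
  define \<eta> where "\<eta> = min (Lam x - Lam (x - e)) (Lam (x + e) - Lam x)"
  have \<eta>: "\<eta> > 0" using e x Lam_strict_mono[of "x - e" x] Lam_strict_mono[of x "x + e"] by (simp add: \<eta>_def)
  obtain x1 where x1: "x - e \<le> x1" "x1 \<le> x" "Lam x1 = Lam x - \<eta>"
  proof -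
    have "Lam (x - e) \<le> Lam x - \<eta>" by (simp add: \<eta>_def)
    then have "\<exists>z\<ge>x - e. z \<le> x \<and> Lam z = Lam x - \<eta>"
      using e \<eta> by (intro IVT' continuous_on_subset[OF Lam_cont]) auto
    then show ?thesis using that by blast
  qed
  obtain x3 where x3: "x \<le> x3" "x3 \<le> x + e" "Lam x3 = Lam x + \<eta>"
  proof -
    have "Lam x + \<eta> \<le> Lam (x + e)" by (simp add: \<eta>_def)
    then have "\<exists>z\<ge>x. z \<le> x + e \<and> Lam z = Lam x + \<eta>"
      using e \<eta> by (intro IVT' continuous_on_subset[OF Lam_cont]) auto
    then show ?thesis using that by blast
  qed
  have pos: "x1 > 0" "x3 > 0" using x1 x3 e x by auto
  \<comment> \<open>A second difference of Green kernels at points equally spaced in the scale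
    \<open>Lam\<close>; it is nonnegative and vanishes outside the interval between
    \<open>x1\<close> and \<open>x3\<close>.\<close>
  define tent where "tent = (\<lambda>z. 2 * Lam (min x z) - Lam (min x1 z) - Lam (min x3 z))"
  have tent_eq: "tent z = 2 * min (Lam x) (Lam z) - min (Lam x - \<eta>) (Lam z) - min (Lam x + \<eta>) (Lam z)"
    if "z > 0" for z
    using that pos x x1(3) x3(3) by (simp add: tent_def Lam_min)
  have tent0: "tent z \<ge> 0" if "z > 0" for z
    using \<eta> by (simp add: tent_eq[OF that] min_def)
  have tent_supp: "tent z = 0" if z: "z > 0" and out: "\<not> (x - e \<le> z \<and> z \<le> x + e)" for z
  proof -
    consider "z \<le> x1" | "z \<ge> x3" using out x1 x3 by linarith
    then show ?thesis
    proof cases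
      case 1
      then have "Lam z \<le> Lam x - \<eta>" using Lam_mono[of z x1] z x1 by simp
      then show ?thesis using \<eta> by (simp add: tent_eq[OF z] min_def)
    next
      case 2
      then have "Lam z \<ge> Lam x + \<eta>" using Lam_mono[of x3 z] pos x3 by simp
      then show ?thesis using \<eta> by (simp add: tent_eq[OF z] min_def)
    qed
  qed
  have tentx: "tent x > 0" using \<eta> by (simp add: tent_eq[OF x])
  have tent_cont: "continuous_on {0<..} tent" unfolding tent_def by (intro continuous_intros)
  have tent_le: "\<bar>tent z\<bar> \<le> 2 * Lam x" if "z > 0" for z
    using tent0[OF that] Lam_nonneg[of "min x1 z"] Lam_nonneg[of "min x3 z"] Lam_mono[of "min x z" x] that pos x
    by (simp add: tent_def)
  define a where "a = (\<lambda>k. (2 * psi k x - psi k x1 - psi k x3) / lam k)"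
  have tent_coeff: "(LINT z:{0<..}|lborel. mu z * tent z * psi k z) = a k" for k
  proof -
    have "(LINT z:{0<..}|lborel. mu z * tent z * psi k z)
        = (LINT z:{0<..}|lborel. 2 * (mu z * Lam (min x z) * psi k z) - mu z * Lam (min x1 z) * psi k z
            - mu z * Lam (min x3 z) * psi k z)"
      by (rule set_lebesgue_integral_cong) (auto simp: tent_def algebra_simps)
    also have "\<dots> = 2 * (psi k x / lam k) - psi k x1 / lam k - psi k x3 / lam k"
      using green_coefficient[OF x, of k] green_coefficient[OF pos(1), of k] green_coefficient[OF pos(2), of k]
      by (simp add: set_integral_diff set_integrable_mult_right)
    finally show ?thesis by (simp add: a_def diff_divide_distrib)
  qed
  have a_sum: "summable (\<lambda>k. lam k * (a k)\<^sup>2)"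
  proof (rule summable_comparison_test')
    show "summable (\<lambda>k. 12 * ((psi k x)\<^sup>2 / lam k + (psi k x1)\<^sup>2 / lam k + (psi k x3)\<^sup>2 / lam k))"
      using x pos by (intro summable_mult summable_add summable_bessel)
    fix k
    have l: "lam k > 0" by (rule lam_pos)
    have "(2 * p - q - r)\<^sup>2 \<le> 12 * (p\<^sup>2 + q\<^sup>2 + r\<^sup>2)" for p q r :: real
    proof -
      have "12 * (p\<^sup>2 + q\<^sup>2 + r\<^sup>2) - (2 * p - q - r)\<^sup>2 = 2 * (q - r)\<^sup>2 + (2 * p + q + r)\<^sup>2 + 4 * p\<^sup>2 + 8 * q\<^sup>2 + 8 * r\<^sup>2"
        by (simp add: power2_eq_square algebra_simps)
      also have "\<dots> \<ge> 0" by (intro add_nonneg_nonneg mult_nonneg_nonneg) auto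
      finally show ?thesis by linarith
    qed
    then have "(2 * psi k x - psi k x1 - psi k x3)\<^sup>2 / lam k \<le> 12 * ((psi k x)\<^sup>2 + (psi k x1)\<^sup>2 + (psi k x3)\<^sup>2) / lam k"
      using l by (intro divide_right_mono) auto
    moreover have "lam k * (a k)\<^sup>2 = (2 * psi k x - psi k x1 - psi k x3)\<^sup>2 / lam k"
      using l by (simp add: a_def field_simps power2_eq_square)
    ultimately show "norm (lam k * (a k)\<^sup>2) \<le> 12 * ((psi k x)\<^sup>2 / lam k + (psi k x1)\<^sup>2 / lam k + (psi k x3)\<^sup>2 / lam k)"
      using l by (simp add: add_divide_distrib)
  qed
  have a_sums: "AE z in lborel. z > 0 \<longrightarrow> (\<lambda>k. a k * psi k z) sums tent z"
    using mercer[OF x] mercer[OF pos(1)] mercer[OF pos(2)]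
  proof eventually_elim
    case (elim z)
    show ?case
    proof
      assume z: "z > 0"
      have "(\<lambda>k. 2 * (psi k x / lam k * psi k z) - psi k x1 / lam k * psi k z - psi k x3 / lam k * psi k z) sums
          (2 * Lam (min x z) - Lam (min x1 z) - Lam (min x3 z))"
        using elim z by (intro sums_diff sums_mult) auto
      then show "(\<lambda>k. a k * psi k z) sums tent z"
        by (simp add: a_def tent_def diff_divide_distrib left_diff_distrib mult.assoc)
    qed
  qed
  have "(\<lambda>k. exp (- lam k * t) * psi k y * a k) sums (LINT z:{0<..}|lborel. mu z * tent z * r z)"
    using ker_integral_expansion(2)[OF adm_psi t tent_cont tent_le, of y] y unfolding tent_coeff r_def by simp
  then have "(LINT z:{0<..}|lborel. mu z * tent z * r z) = (\<Sum>k. exp (- lam k * t) * a k * psi k y)"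
    by (simp add: sums_iff mult_ac)
  also have "\<dots> \<ge> 0" by (rule positivity(2)[OF a_sum a_sums tent0 t y])
  finally have int0: "(LINT z:{0<..}|lborel. mu z * tent z * r z) \<ge> 0" .
  let ?i = "\<lambda>z. indicator {0<..} z *\<^sub>R (- (mu z * tent z * r z))"
  \<comment> \<open>The integrand has one sign while its integral has the other, so it is zero
    almost everywhere, and by continuity also at \<open>x\<close>, where it is strictly
    negative.\<close>
  have le0: "mu z * tent z * r z \<le> 0" if z: "z > 0" for z
  proof (cases "x - e \<le> z \<and> z \<le> x + e")
    case True
    then show ?thesis using rneg[of z] tent0[OF z] mu_pos[of z]
      by (intro mult_nonneg_nonpos mult_nonneg_nonneg) auto
  qed (simp add: tent_supp[OF z])
  have int: "integrable lborel ?i"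
    using ker_integral_expansion(1)[OF adm_psi t tent_cont tent_le, of y] y
    unfolding r_def set_integrable_def by simp
  have i0: "?i z \<ge> 0" for z using le0[of z] by (simp add: indicator_def)
  have "integral\<^sup>L lborel ?i = - (LINT z:{0<..}|lborel. mu z * tent z * r z)"
    by (simp add: set_lebesgue_integral_def)
  moreover have "integral\<^sup>L lborel ?i \<ge> 0" using i0 by (intro integral_nonneg_AE) auto
  ultimately have "integral\<^sup>L lborel ?i = 0" using int0 by simp
  then have "AE z in lborel. ?i z = 0"
    using integral_nonneg_eq_0_iff_AE[OF int] i0 by simp
  then have "AE z in lborel. z > 0 \<longrightarrow> - (mu z * tent z * r z) \<le> 0"
    by eventually_elim (auto simp: indicator_def)
  then have "- (mu x * tent x * r x) \<le> 0"
    by (intro AE_le_imp_le[where f = "\<lambda>z. - (mu z * tent z * r z)", OF _ _ x])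
       (auto intro!: continuous_intros tent_cont r_cont)
  moreover have "mu x * tent x * r x < 0" using mu_pos[of x] tentx neg by (intro mult_pos_neg mult_pos_pos)
  ultimately show False by simp
qed

end

context entrance_spectrum
begin

section \<open>The ground state\<close>

text \<open>Factoring out the slowest exponential leaves only the ground state term in the limit,
  since all other exponents stay strictly negative.\<close>

lemma ker_leading:
  assumes a: "adm a" and b: "adm b"
  shows "((\<lambda>t. exp (lam 0 * t) * ker t a b) \<longlongrightarrow> a 0 * b 0) at_top"
proof -
  let ?f = "\<lambda>k t. exp (lam 0 * t) * (exp (- lam k * t) * a k * b k)"
  have mono: "lam 0 \<le> lam k" for k using lam_mono by (simp add: strict_mono_less_eq)
  have eq: "?f k t = exp (- ((lam k - lam 0) * t)) * (a k * b k)" for k t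
    by (simp add: left_diff_distrib exp_diff exp_minus field_simps)
  have "((\<lambda>t. suminf (\<lambda>k. ?f k t)) \<longlongrightarrow> (\<Sum>k. if k = 0 then a 0 * b 0 else 0)) at_top"
  proof (rule tannerys_theorem[THEN conjunct2, THEN conjunct2])
    fix k
    show "(?f k \<longlongrightarrow> (if k = 0 then a 0 * b 0 else 0)) at_top"
    proof (cases "k = 0")
      case False
      then have "lam 0 < lam k" using lam_mono by (simp add: strict_mono_less)
      then have "filterlim (\<lambda>t. (lam k - lam 0) * t) at_top at_top"
        by (intro filterlim_tendsto_pos_mult_at_top[OF tendsto_const] filterlim_ident) auto
      then have "((\<lambda>t. exp (- ((lam k - lam 0) * t))) \<longlongrightarrow> 0) at_top"
        by (intro filterlim_compose[OF exp_at_bot] filterlim_compose[OF filterlim_uminus_at_bot_at_top])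
      from tendsto_mult_left_zero[OF this, of "a k * b k"] show ?thesis
        unfolding eq using False by simp
    next
      case True
      then show ?thesis unfolding eq by simp
    qed
  next
    have "\<forall>\<^sub>F x in at_top \<times>\<^sub>F at_top. True \<and> snd x \<ge> (1::real)"
      by (rule eventually_prodI[OF eventually_True eventually_ge_at_top])
    then show "\<forall>\<^sub>F (k, t) in at_top \<times>\<^sub>F at_top. norm (?f k t) \<le> exp (lam 0) * (exp (- lam k * 1) * (B k)\<^sup>2)"
    proof eventually_elim
      case (elim x)
      obtain k t where x: "x = (k, t)" by (cases x)
      have t: "t \<ge> 1" using elim x by simp
      have ab: "\<bar>a k * b k\<bar> \<le> (B k)\<^sup>2"
        using ker_term_le[of a k b 0] a b by (simp add: adm_def)
      \<comment> \<open>For \<open>t \<ge> 1\<close> the decay is at least that at time 1, which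
        gives a majorant free of \<open>t\<close>.\<close>
      have "(lam k - lam 0) * 1 \<le> (lam k - lam 0) * t"
        using mono[of k] t by (intro mult_left_mono) auto
      then have "exp (- ((lam k - lam 0) * t)) * \<bar>a k * b k\<bar> \<le> exp (lam 0 - lam k) * (B k)\<^sup>2"
        using ab by (intro mult_mono) auto
      also have "\<dots> = exp (lam 0) * (exp (- lam k * 1) * (B k)\<^sup>2)"
        by (simp add: exp_diff exp_minus field_simps)
      finally show ?case unfolding x eq prod.case by (simp add: abs_mult)
    qed
  next
    show "summable (\<lambda>k. exp (lam 0) * (exp (- lam k * 1) * (B k)\<^sup>2))"
      by (intro summable_mult summable_B) simp
  qed simp
  moreover have "(\<Sum>k. if k = 0 then a 0 * b 0 else 0) = a 0 * b 0"
    using sums_If_finite[of "\<lambda>k. k = 0" "\<lambda>k. a 0 * b 0"] by (simp add: sums_iff)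
  moreover have "\<forall>\<^sub>F t in at_top. suminf (\<lambda>k. ?f k t) = exp (lam 0 * t) * ker t a b"
    unfolding ker_def
    by (rule eventually_mono[OF eventually_gt_at_top[of 0]]) (intro suminf_mult summable_ker a b)
  ultimately show ?thesis by (simp add: Lim_transform_eventually)
qed

lemma ground_sign:
  assumes "x > 0" "y > 0"
  shows "psi 0 x * psi 0 y \<ge> 0"
proof (rule tendsto_lowerbound)
  show "((\<lambda>t. exp (lam 0 * t) * ker t (\<lambda>k. psi k x) (\<lambda>k. psi k y)) \<longlongrightarrow> psi 0 x * psi 0 y) at_top"
    using assms by (intro ker_leading adm_psi) auto
  show "\<forall>\<^sub>F t in at_top. 0 \<le> exp (lam 0 * t) * ker t (\<lambda>k. psi k x) (\<lambda>k. psi k y)"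
    using assms by (intro eventually_mono[OF eventually_gt_at_top[of 0]] mult_nonneg_nonneg ker_nonneg) auto
qed simp

text \<open>Nonnegativity of the kernel fixes a sign of \<open>psi 0\<close>. Then the flux is
  nonincreasing with limit 0, hence nonnegative, so \<open>\<sigma> * psi 0\<close> is
  nondecreasing; comparison with \<open>T\<close> near 0 gives positivity there and a nonzero
  boundary slope.\<close>

lemma ground_state:
  "\<exists>\<sigma> c X. \<bar>\<sigma>\<bar> = 1 \<and> c > 0 \<and> X > 0 \<and> (\<forall>x. 0 < x \<and> x \<le> X \<longrightarrow> \<sigma> * psi 0 x \<ge> c * T x) \<and>
    (\<forall>x>0. \<sigma> * psi 0 x > 0) \<and> \<sigma> * psi_inf psi 0 > 0"
proof -
  have "\<exists>x>0. psi 0 x \<noteq> 0"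
  proof (rule ccontr)
    assume "\<not> ?thesis"
    then have "(\<lambda>x. indicat_real {0<..} x *\<^sub>R (mu x * psi 0 x * psi 0 x)) = (\<lambda>x. 0)"
      by (auto simp: indicator_def)
    then show False using orthonormal(2)[of 0 0] by (simp add: set_lebesgue_integral_def)
  qed
  then obtain x0 where x0: "x0 > 0" "psi 0 x0 \<noteq> 0" by blast
  define \<sigma> where "\<sigma> = sgn (psi 0 x0)"
  have \<sigma>: "\<bar>\<sigma>\<bar> = 1" using x0 by (simp add: \<sigma>_def abs_sgn_eq)
  have nn: "\<sigma> * psi 0 x \<ge> 0" if "x > 0" for x
    using ground_sign[OF x0(1) that] x0(2) by (auto simp: \<sigma>_def sgn_if zero_le_mult_iff)
  have x0': "\<sigma> * psi 0 x0 > 0" using x0(2) by (simp add: \<sigma>_def sgn_if)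
  have fl_mono: "\<sigma> * flux 0 y \<le> \<sigma> * flux 0 x" if "0 < x" "x \<le> y" for x y
  proof -
    have "- (\<sigma> * flux 0 x) \<le> - (\<sigma> * flux 0 y)"
    proof (rule le_of_deriv_nonneg'[where f = "\<lambda>x. - (\<sigma> * flux 0 x)" and f' = "\<lambda>x. - (\<sigma> * (- (lam 0 * mu x * psi 0 x)))"])
      fix z assume z: "x \<le> z" "z \<le> y"
      show "((\<lambda>x. - (\<sigma> * flux 0 x)) has_real_derivative - (\<sigma> * (- (lam 0 * mu z * psi 0 z)))) (at z)"
        using z that by (intro DERIV_minus DERIV_cmult flux_deriv) auto
      have "0 \<le> lam 0 * mu z * (\<sigma> * psi 0 z)"
        using lam_pos[of 0] mu_pos[of z] nn[of z] z that by (intro mult_nonneg_nonneg[of "lam 0 * mu z"]) auto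
      then show "0 \<le> - (\<sigma> * (- (lam 0 * mu z * psi 0 z)))" by (simp add: mult_ac)
    qed (use that in auto)
    then show ?thesis by simp
  qed
  have fl_lim: "((\<lambda>x. \<sigma> * flux 0 x) \<longlongrightarrow> 0) at_top"
    using tendsto_mult_left[OF flux_tendsto, of \<sigma> 0] by simp
  have fl_nn: "\<sigma> * flux 0 x \<ge> 0" if "x > 0" for x
    by (rule tendsto_upperbound[OF fl_lim])
      (use that in \<open>auto intro!: fl_mono eventually_mono[OF eventually_ge_at_top[of x]]\<close>)
  have ps_mono: "\<sigma> * psi 0 x \<le> \<sigma> * psi 0 y" if "0 < x" "x \<le> y" for x y
  proof (rule le_of_deriv_nonneg'[where f = "\<lambda>x. \<sigma> * psi 0 x" and f' = "\<lambda>x. \<sigma> * (exp (g x) * flux 0 x)"])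
    fix z assume z: "x \<le> z" "z \<le> y"
    show "((\<lambda>x. \<sigma> * psi 0 x) has_real_derivative \<sigma> * (exp (g z) * flux 0 z)) (at z)"
      using z that by (intro DERIV_cmult psi_deriv) auto
    have "0 \<le> exp (g z) * (\<sigma> * flux 0 z)"
      using fl_nn[of z] z that by simp
    then show "0 \<le> \<sigma> * (exp (g z) * flux 0 z)" by (simp add: mult_ac)
  qed (use that in auto)
  have inf: "\<sigma> * psi_inf psi 0 \<ge> \<sigma> * psi 0 x" if "x > 0" for x
    by (rule tendsto_lowerbound[OF tendsto_mult_left[OF psi_tendsto]])
      (use that in \<open>auto intro!: ps_mono eventually_mono[OF eventually_ge_at_top[of x]]\<close>)
  have fl_pos: "\<sigma> * flux 0 x0 > 0"
  proof -
    have "- (\<sigma> * flux 0 x0) < - (\<sigma> * flux 0 (x0 + 1))"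
    proof (rule less_of_deriv_pos[where f = "\<lambda>x. - (\<sigma> * flux 0 x)" and f' = "\<lambda>x. - (\<sigma> * (- (lam 0 * mu x * psi 0 x)))"])
      have d: "((\<lambda>x. - (\<sigma> * flux 0 x)) has_real_derivative - (\<sigma> * (- (lam 0 * mu z * psi 0 z)))) (at z)"
        if "z \<ge> x0" for z
        using that x0 by (intro DERIV_minus DERIV_cmult flux_deriv) auto
      then show "continuous_on {x0..x0 + 1} (\<lambda>x. - (\<sigma> * flux 0 x))"
        by (intro DERIV_atLeastAtMost_imp_continuous_on) blast
      fix z assume z: "x0 < z" "z < x0 + 1"
      show "((\<lambda>x. - (\<sigma> * flux 0 x)) has_real_derivative - (\<sigma> * (- (lam 0 * mu z * psi 0 z)))) (at z)"
        using d z by simp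
      have "0 < lam 0 * mu z * (\<sigma> * psi 0 z)"
        using lam_pos[of 0] mu_pos[of z] ps_mono[of x0 z] x0' x0(1) z
        by (intro mult_pos_pos[of "lam 0 * mu z"]) auto
      then show "0 < - (\<sigma> * (- (lam 0 * mu z * psi 0 z)))" by (simp add: mult_ac)
    qed simp
    then show ?thesis using fl_nn[of "x0 + 1"] x0(1) by simp
  qed
  \<comment> \<open>On the interval up to \<open>x0\<close> the signed flux is at least its value at
    \<open>x0\<close>, and \<open>K\<close> is at most \<open>K 0\<close>; hence the derivative of
    \<open>\<sigma> * psi 0\<close> dominates \<open>c\<close> times that of
    \<open>T\<close>.\<close>
  define c where "c = \<sigma> * flux 0 x0 / (2 * K 0)"
  have K0: "K 0 > 0" by (rule K_pos) simp
  have c: "c > 0" using fl_pos K0 by (simp add: c_def)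
  have low: "c * T x \<le> \<sigma> * psi 0 x" if x: "0 < x" "x \<le> x0" for x
  proof -
    have "\<sigma> * psi 0 0 - c * T 0 \<le> \<sigma> * psi 0 x - c * T x"
    proof (rule le_of_deriv_nonneg[where f = "\<lambda>x. \<sigma> * psi 0 x - c * T x" and
          f' = "\<lambda>x. \<sigma> * (exp (g x) * flux 0 x) - c * (2 * exp (g x) * K x)"])
      show "continuous_on {0..x} (\<lambda>x. \<sigma> * psi 0 x - c * T x)"
        by (intro continuous_intros psi_cont') simp
      fix z assume z: "0 < z" "z < x"
      show "((\<lambda>x. \<sigma> * psi 0 x - c * T x) has_real_derivative
          \<sigma> * (exp (g z) * flux 0 z) - c * (2 * exp (g z) * K z)) (at z)"
        using z by (intro DERIV_diff DERIV_cmult psi_deriv T_deriv)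
      have "c * (2 * K z) \<le> c * (2 * K 0)"
        using c K_strict_antimono[of 0 z] z by (intro mult_left_mono) auto
      also have "\<dots> = \<sigma> * flux 0 x0" using K0 by (simp add: c_def)
      also have "\<dots> \<le> \<sigma> * flux 0 z" using fl_mono[of z x0] z x by simp
      finally have "exp (g z) * (c * (2 * K z)) \<le> exp (g z) * (\<sigma> * flux 0 z)"
        by (intro mult_left_mono) auto
      then show "0 \<le> \<sigma> * (exp (g z) * flux 0 z) - c * (2 * exp (g z) * K z)" by (simp add: mult_ac)
    qed (use x in auto)
    then show ?thesis by (simp add: psi_0 T_0)
  qed
  have pos: "\<sigma> * psi 0 x > 0" if "x > 0" for x
  proof (cases "x \<le> x0")
    case True
    have "0 < c * T x" using c T_pos[OF that] by simp
    then show ?thesis using low[OF that True] by simp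
  next
    case False
    then show ?thesis using ps_mono[of x0 x] x0' x0 by simp
  qed
  have "\<sigma> * psi_inf psi 0 > 0" using inf[OF x0(1)] x0' by simp
  then show ?thesis using \<sigma> c x0(1) low pos by blast
qed

lemma psi_inf_ground: "psi_inf psi 0 \<noteq> 0"
proof -
  obtain \<sigma> :: real where "\<sigma> * psi_inf psi 0 > 0" using ground_state by blast
  then show ?thesis by (metis less_irrefl mult_zero_right)
qed

lemma psi_ground:
  assumes "x > 0"
  shows "psi 0 x \<noteq> 0"
proof -
  obtain \<sigma> :: real where "\<forall>x>0. \<sigma> * psi 0 x > 0" using ground_state by blast
  then have "\<sigma> * psi 0 x > 0" using assms by blast
  then show ?thesis by (metis less_irrefl mult_zero_right)
qed

section \<open>Strict positivity\<close>

text \<open>\<open>t \<mapsto> ker t a b\<close> extends to a holomorphic function on the right half-plane.\<close>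

lemma ker_zero:
  assumes a: "adm a" and b: "adm b" and t0: "t0 > 0"
    and zero: "\<And>s. 0 < s \<Longrightarrow> s < t0 \<Longrightarrow> ker s a b = 0"
  shows "a 0 * b 0 = 0"
proof -
  define F where "F = (\<lambda>z::complex. \<Sum>k. exp (- of_real (lam k) * z) * of_real (a k * b k))"
  let ?S = "{z::complex. Re z > 0}"
  have ab: "\<bar>a k * b k\<bar> \<le> (B k)\<^sup>2" for k
    using ker_term_le[of a k b 0] a b by (simp add: adm_def)
  have F_real: "F (of_real s) = of_real (ker s a b)" if s: "s > 0" for s
  proof -
    have "(\<lambda>k. of_real (exp (- lam k * s) * a k * b k)) sums (of_real (ker s a b) :: complex)"
      unfolding ker_def by (intro sums_of_real summable_sums summable_ker a b s)
    then show ?thesis by (simp add: F_def sums_iff exp_of_real mult.assoc flip: of_real_mult of_real_minus)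
  qed
  have op: "open ?S" by (rule open_halfspace_Re_gt)
  have "F holomorphic_on ?S"
  proof (rule holomorphic_uniform_sequence[OF op])
    show "(\<lambda>z. \<Sum>k<n. exp (- of_real (lam k) * z) * of_real (a k * b k)) holomorphic_on ?S" for n
      by (intro holomorphic_intros)
    fix z :: complex assume z: "z \<in> ?S"
    \<comment> \<open>On the closed disc of this radius the real part stays at least
      \<open>d\<close>, so \<open>summable_B\<close> at time \<open>d\<close> majorises the series
      uniformly.\<close>
    define d where "d = Re z / 2"
    have d: "d > 0" using z by (simp add: d_def)
    have Re: "Re w \<ge> d" if "w \<in> cball z d" for w
    proof -
      have "\<bar>Re (z - w)\<bar> \<le> d" using abs_Re_le_cmod[of "z - w"] that by (simp add: dist_norm)
      then have "Re z - Re w \<le> Re z / 2" unfolding d_def abs_le_iff by simp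
      then show ?thesis by (simp add: d_def)
    qed
    have "uniform_limit (cball z d) (\<lambda>n z. \<Sum>k<n. exp (- of_real (lam k) * z) * of_real (a k * b k)) F sequentially"
      unfolding F_def
    proof (rule Weierstrass_m_test[OF _ summable_B[OF d]])
      fix k w assume w: "w \<in> cball z d"
      have "exp (- (lam k * Re w)) * \<bar>a k * b k\<bar> \<le> exp (- lam k * d) * (B k)\<^sup>2"
        using Re[OF w] lam_pos[of k] ab by (intro mult_mono) auto
      then show "norm (exp (- of_real (lam k) * w) * of_real (a k * b k)) \<le> exp (- lam k * d) * (B k)\<^sup>2"
        by (simp add: norm_mult abs_mult)
    qed
    moreover have "cball z d \<subseteq> ?S" using Re d by force
    ultimately show "\<exists>d>0. cball z d \<subseteq> ?S \<and>
        uniform_limit (cball z d) (\<lambda>n z. \<Sum>k<n. exp (- of_real (lam k) * z) * of_real (a k * b k)) F sequentially"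
      using d by blast
  qed
  moreover have "connected ?S" by (intro convex_connected convex_halfspace_Re_gt)
  moreover have "of_real ` {0<..<t0} \<subseteq> ?S" by auto
  moreover have "of_real (t0 / 2) \<in> ?S" using t0 by simp
  moreover have "(of_real (t0 / 2) :: complex) islimpt of_real ` {0<..<t0}"
    unfolding islimpt_approachable
  proof (intro allI impI)
    fix e :: real assume e: "e > 0"
    define h where "h = min (e / 2) (t0 / 4)"
    have h: "h > 0" "h < e" "t0 / 2 + h < t0" using e t0 by (auto simp: h_def)
    have "dist (of_real (t0 / 2 + h) :: complex) (of_real (t0 / 2)) < e"
      unfolding dist_of_real using h by (simp add: dist_real_def)
    then show "\<exists>x'\<in>of_real ` {0<..<t0}. x' \<noteq> complex_of_real (t0 / 2) \<and> dist x' (complex_of_real (t0 / 2)) < e"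
    proof (intro bexI conjI)
      show "complex_of_real (t0 / 2 + h) \<noteq> complex_of_real (t0 / 2)"
        using h unfolding of_real_eq_iff by simp
      show "complex_of_real (t0 / 2 + h) \<in> of_real ` {0<..<t0}"
        by (rule imageI) (use h t0 in simp)
    qed
  qed
  moreover have "F z = 0" if "z \<in> of_real ` {0<..<t0}" for z
    using that F_real zero by auto
  ultimately have F0: "F w = 0" if "w \<in> ?S" for w
    using analytic_continuation[of F ?S "of_real ` {0<..<t0}" "of_real (t0 / 2)" w] op that by blast
  have "ker s a b = 0" if "s > 0" for s
    using F0[of "of_real s"] F_real[OF that] that by simp
  then have "\<forall>\<^sub>F t in at_top. exp (lam 0 * t) * ker t a b = 0"
    by (intro eventually_mono[OF eventually_gt_at_top[of 0]]) simp
  then have "((\<lambda>t. exp (lam 0 * t) * ker t a b) \<longlongrightarrow> 0) at_top"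
    by (rule tendsto_eventually)
  then show ?thesis using tendsto_unique[OF trivial_limit_at_top_linorder ker_leading[OF a b]] by simp
qed

lemma ker_psi_at_top:
  assumes a: "adm a" and t: "t > 0"
  shows "((\<lambda>z. ker t a (\<lambda>k. psi k z)) \<longlongrightarrow> ker t a (psi_inf psi)) at_top"
proof -
  have "((\<lambda>z. ker t (\<lambda>k. psi k z) a) \<longlongrightarrow> ker t (psi_inf psi) a) at_top"
    by (rule ker_tendsto[OF psi_tendsto _ a t])
      (auto intro!: eventually_mono[OF eventually_ge_at_top[of 0]] adm_psi)
  then show ?thesis by (simp add: ker_commute[of t a])
qed

lemma ker_inf_nonneg:
  assumes a: "adm a" and nn: "\<And>z. z > 0 \<Longrightarrow> ker t a (\<lambda>k. psi k z) \<ge> 0" and t: "t > 0"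
  shows "ker t a (psi_inf psi) \<ge> 0"
  by (rule tendsto_lowerbound[OF ker_psi_at_top[OF a t]])
    (auto intro!: nn eventually_mono[OF eventually_gt_at_top[of 0]])

text \<open>All terms are weighted squares, and the ground state term does not vanish.\<close>

lemma ker_inf_inf_pos:
  assumes t: "t > 0"
  shows "ker t (psi_inf psi) (psi_inf psi) > 0"
proof -
  have "(\<Sum>k\<in>{0}. exp (- lam k * t) * psi_inf psi k * psi_inf psi k) \<le> ker t (psi_inf psi) (psi_inf psi)"
    unfolding ker_def by (intro sum_le_suminf summable_ker adm_psi_inf t) (auto simp: mult.assoc)
  moreover have "(\<Sum>k\<in>{0}. exp (- lam k * t) * psi_inf psi k * psi_inf psi k) > 0"
    using psi_inf_ground by (simp add: mult.assoc flip: power2_eq_square)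
  ultimately show ?thesis by simp
qed

lemma ker_strict_pos:
  assumes a: "adm a" and nn: "\<And>s z. s > 0 \<Longrightarrow> z > 0 \<Longrightarrow> ker s a (\<lambda>k. psi k z) \<ge> 0"
    and a0: "a 0 \<noteq> 0" and t: "t > 0"
  shows "ker t a (psi_inf psi) > 0"
proof (rule ccontr)
  assume "\<not> ?thesis"
  then have zero: "ker t a (psi_inf psi) = 0"
    using ker_inf_nonneg[OF a nn[OF t] t] by simp
  have nn2: "ker s (psi_inf psi) (\<lambda>k. psi k z) \<ge> 0" if "s > 0" "z > 0" for s z
    unfolding ker_commute[of s "psi_inf psi"]
    using that by (intro ker_inf_nonneg adm_psi ker_nonneg) auto
  have "ker s a (psi_inf psi) = 0" if s: "0 < s" "s < t" for s
  proof -
    \<comment> \<open>The semigroup property writes the vanishing kernel at time \<open>t\<close> as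
      the integral of \<open>mu x * ?p x\<close>, with both factors of \<open>?p\<close> nonnegative
      and continuous; hence \<open>?p\<close> vanishes identically.\<close>
    let ?p = "\<lambda>x. ker s a (\<lambda>k. psi k x) * ker (t - s) (psi_inf psi) (\<lambda>k. psi k x)"
    have ts: "t - s > 0" using s by simp
    have int: "integrable lborel (\<lambda>x. indicator {0<..} x *\<^sub>R (mu x * ?p x))"
      using semigroup(1)[OF a adm_psi_inf s(1) ts] by (simp add: set_integrable_def mult.assoc)
    have p0: "?p x \<ge> 0" if "x > 0" for x
      using that s nn nn2 by (intro mult_nonneg_nonneg) auto
    have "(LINT x|lborel. indicator {0<..} x *\<^sub>R (mu x * ?p x)) = 0"
      using semigroup(2)[OF a adm_psi_inf s(1) ts] zero by (simp add: set_lebesgue_integral_def mult.assoc)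
    moreover have "AE x in lborel. 0 \<le> indicator {0<..} x *\<^sub>R (mu x * ?p x)"
    proof (rule AE_I2)
      fix x :: real
      show "0 \<le> indicator {0<..} x *\<^sub>R (mu x * ?p x)"
      proof (cases "x > 0")
        case True
        have "0 \<le> mu x * ?p x" by (rule mult_nonneg_nonneg[OF less_imp_le[OF mu_pos] p0[OF True]])
        then show ?thesis by (simp add: indicator_def)
      qed simp
    qed
    ultimately have "AE x in lborel. indicator {0<..} x *\<^sub>R (mu x * ?p x) = 0"
      using integral_nonneg_eq_0_iff_AE[OF int] by blast
    then have "AE x in lborel. x > 0 \<longrightarrow> mu x * ?p x \<le> 0"
      by eventually_elim (auto simp: indicator_def)
    moreover have "continuous_on {0<..} (\<lambda>x. mu x * ?p x)"
      using a s ts by (intro continuous_intros ker_cont' adm_psi_inf) auto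
    ultimately have le: "mu x * ?p x \<le> 0" if "x > 0" for x
      using AE_le_imp_le that by blast
    have "?p x = 0" if x: "x > 0" for x
    proof (rule order.antisym[OF _ p0[OF x]])
      have "mu x * ?p x \<le> mu x * 0" using le[OF x] by simp
      then show "?p x \<le> 0" by (simp only: mult_le_cancel_left_pos[OF mu_pos])
    qed
    then have "\<forall>\<^sub>F x in at_top. ?p x = 0"
      by (intro eventually_mono[OF eventually_gt_at_top[of 0]])
    then have "(?p \<longlongrightarrow> 0) at_top" by (rule tendsto_eventually)
    \<comment> \<open>Letting \<open>x\<close> tend to infinity turns the second factor into a
      strictly positive number, so the first limit must be 0.\<close>
    moreover have "(?p \<longlongrightarrow> ker s a (psi_inf psi) * ker (t - s) (psi_inf psi) (psi_inf psi)) at_top"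
      by (intro tendsto_intros ker_psi_at_top a s ts adm_psi_inf)
    ultimately have "0 = ker s a (psi_inf psi) * ker (t - s) (psi_inf psi) (psi_inf psi)"
      by (rule tendsto_unique[rotated]) simp
    then show ?thesis using ker_inf_inf_pos[OF ts] by simp
  qed
  then have "a 0 * psi_inf psi 0 = 0" by (rule ker_zero[OF a adm_psi_inf t])
  then show False using a0 psi_inf_ground by simp
qed

section \<open>Uniform lower bound by \<open>T\<close> and the relative error\<close>

lemma ker_psi_over_T:
  assumes "x > 0" "adm b" "t > 0"
  shows "ker t (\<lambda>k. psi k x / T x) b = ker t (\<lambda>k. psi k x) b / T x"
  unfolding ker_def using suminf_divide[OF summable_ker[OF adm_psi assms(2,3), of x], of "T x"] assms(1)
  by simp

lemma adm_psi_over_T: "x > 0 \<Longrightarrow> adm (\<lambda>k. psi k x / T x)"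
  unfolding adm_def
proof
  fix k assume x: "x > 0"
  have "\<bar>psi k x\<bar> \<le> lam k * M k * T x" using x by (intro psi_le_T) simp
  then have "\<bar>psi k x / T x\<bar> \<le> lam k * M k"
    using T_pos[OF x] by (simp add: field_simps)
  then show "\<bar>psi k x / T x\<bar> \<le> B k" using B_ge(2) by (rule order.trans)
qed

lemma ker_inf_lower_bound:
  assumes t: "t > 0"
  shows "\<exists>c>0. \<forall>x>0. ker t (psi_inf psi) (\<lambda>k. psi k x) \<ge> c * T x"
proof -
  \<comment> \<open>Dividing by \<open>T\<close> removes the zero at the origin: \<open>F\<close>
    has positive limits at both ends of the half-line and is positive and continuous in
    between.\<close>
  define F where "F = (\<lambda>x. ker t (\<lambda>k. psi k x / T x) (psi_inf psi))"
  have F_eq: "ker t (psi_inf psi) (\<lambda>k. psi k x) = F x * T x" if "x > 0" for x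
    using T_pos[OF that] by (simp add: F_def ker_psi_over_T[OF that adm_psi_inf t] ker_commute[of t "psi_inf psi"])
  have F_pos: "F x > 0" if x: "x > 0" for x
    unfolding F_def
  proof (rule ker_strict_pos[OF adm_psi_over_T[OF x] _ _ t])
    show "ker s (\<lambda>k. psi k x / T x) (\<lambda>k. psi k z) \<ge> 0" if "s > 0" "z > 0" for s z
      using ker_nonneg[OF that(1) x that(2)] T_pos[OF x] that
      by (simp add: ker_psi_over_T[OF x adm_psi that(1)])
    show "psi 0 x / T x \<noteq> 0" using psi_ground[OF x] T_pos[OF x] by simp
  qed
  have F_cont: "isCont F x" if x: "x > 0" for x
    unfolding isCont_def F_def
  proof (rule ker_tendsto[OF _ _ adm_psi_inf t])
    fix k
    have "isCont (psi k) x" by (rule isCont_halfline[OF psi_cont x])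
    moreover have "isCont T x" using T_cont by (simp add: continuous_on_eq_continuous_at)
    ultimately show "((\<lambda>x. psi k x / T x) \<longlongrightarrow> psi k x / T x) (at x)"
      using T_pos[OF x] unfolding isCont_def by (intro tendsto_divide) auto
  next
    have "\<forall>\<^sub>F z in at x. z > 0"
      using x by (rule order_tendstoD(1)[OF tendsto_ident_at])
    then show "\<forall>\<^sub>F z in at x. adm (\<lambda>k. psi k z / T z)"
      by (rule eventually_mono) (rule adm_psi_over_T)
  qed simp
  obtain e0 where e0: "\<And>k. ((\<lambda>x. psi k x / T x) \<longlongrightarrow> e0 k) (at_right 0)"
    using psi_over_T_tendsto by metis
  have ev0: "\<forall>\<^sub>F x in at_right 0. adm (\<lambda>k. psi k x / T x)"
    by (rule eventually_mono[OF eventually_at_right_less[of 0]]) (rule adm_psi_over_T)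
  have adm0: "adm e0"
    unfolding adm_def
  proof
    fix k
    show "\<bar>e0 k\<bar> \<le> B k"
      by (rule tendsto_upperbound[OF tendsto_rabs[OF e0]])
        (rule eventually_mono[OF ev0], simp_all add: adm_def)
  qed
  have lim0: "((\<lambda>x. ker s (\<lambda>k. psi k x / T x) b) \<longlongrightarrow> ker s e0 b) (at_right 0)"
    if "s > 0" "adm b" for s b
    by (rule ker_tendsto[OF e0 ev0 that(2,1)]) simp
  have F0: "ker t e0 (psi_inf psi) > 0"
  proof (rule ker_strict_pos[OF adm0 _ _ t])
    show "ker s e0 (\<lambda>k. psi k z) \<ge> 0" if "s > 0" "z > 0" for s z
    proof (rule tendsto_lowerbound[OF lim0[OF that(1) adm_psi]])
      show "\<forall>\<^sub>F x in at_right 0. 0 \<le> ker s (\<lambda>k. psi k x / T x) (\<lambda>k. psi k z)"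
      proof (rule eventually_mono[OF eventually_at_right_less[of 0]])
        fix x :: real assume x: "0 < x"
        show "0 \<le> ker s (\<lambda>k. psi k x / T x) (\<lambda>k. psi k z)"
          using ker_nonneg[OF that(1) x that(2)] T_pos[OF x] that
          by (simp add: ker_psi_over_T[OF x adm_psi that(1)])
      qed
    qed (use that in auto)
    \<comment> \<open>The lower bound of the ground state by \<open>c * T x\<close> near 0 survives
      division by \<open>T\<close>, so \<open>e0 0\<close> is not zero, as strict positivity
      requires.\<close>
    obtain \<sigma> c X where gs: "\<bar>\<sigma>\<bar> = 1" "c > 0" "X > 0" "\<forall>x. 0 < x \<and> x \<le> X \<longrightarrow> \<sigma> * psi 0 x \<ge> c * T x"
      using ground_state by (elim exE conjE) (rule that)
    have "c \<le> \<sigma> * e0 0"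
    proof (rule tendsto_lowerbound[OF tendsto_mult_left[OF e0]])
      have "\<forall>\<^sub>F x in at_right 0. x \<in> {0<..<X}" using gs(3) by (rule eventually_at_right_real)
      then show "\<forall>\<^sub>F x in at_right 0. c \<le> \<sigma> * (psi 0 x / T x)"
      proof eventually_elim
        case (elim x)
        then show ?case using gs(4)[rule_format, of x] T_pos[of x] by (simp add: field_simps)
      qed
    qed simp
    then show "e0 0 \<noteq> 0" using gs(2) by auto
  qed
  have Finf: "(F \<longlongrightarrow> ker t (psi_inf psi) (psi_inf psi) / Tinf) at_top"
  proof -
    have "((\<lambda>x. ker t (psi_inf psi) (\<lambda>k. psi k x) / T x) \<longlongrightarrow> ker t (psi_inf psi) (psi_inf psi) / Tinf) at_top"
      using Tinf_pos by (intro tendsto_divide ker_psi_at_top adm_psi_inf t T_tendsto) auto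
    moreover have "\<forall>\<^sub>F x in at_top. ker t (psi_inf psi) (\<lambda>k. psi k x) / T x = F x"
      by (rule eventually_mono[OF eventually_gt_at_top[of 0]])
        (simp add: F_def ker_psi_over_T[OF _ adm_psi_inf t] ker_commute[of t "psi_inf psi"])
    ultimately show ?thesis by (rule Lim_transform_eventually)
  qed
  let ?c0 = "ker t e0 (psi_inf psi) / 2" and ?c1 = "ker t (psi_inf psi) (psi_inf psi) / Tinf / 2"
  have c1: "?c1 > 0" using ker_inf_inf_pos[OF t] Tinf_pos by simp
  have "\<forall>\<^sub>F x in at_right 0. F x > ?c0"
    using order_tendstoD(1)[OF lim0[OF t adm_psi_inf], of ?c0] F0 by (simp add: F_def)
  then obtain d where d: "d > 0" "\<And>x. 0 < x \<Longrightarrow> x < d \<Longrightarrow> F x > ?c0"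
    unfolding eventually_at_right_field by auto
  have "\<forall>\<^sub>F x in at_top. F x > ?c1"
    by (rule order_tendstoD(1)[OF Finf]) (use c1 in simp)
  then obtain R where R: "\<And>x. x \<ge> R \<Longrightarrow> F x > ?c1"
    unfolding eventually_at_top_linorder by blast
  let ?I = "{d..max d R}"
  have "continuous_on ?I F" using d F_cont by (intro continuous_at_imp_continuous_on) auto
  then obtain x1 where x1: "x1 \<in> ?I" "\<And>x. x \<in> ?I \<Longrightarrow> F x1 \<le> F x"
    using continuous_attains_inf[of ?I F] by auto
  define c where "c = min (F x1) (min ?c0 ?c1)"
  have "c > 0" using F_pos[of x1] x1 d F0 c1 by (simp add: c_def)
  have c_le: "c \<le> F x" if x: "x > 0" for x
  proof -
    consider "x < d" | "x \<in> ?I" | "x \<ge> R" by fastforce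
    then show ?thesis
    proof cases
      case 1
      then show ?thesis using d(2)[OF x] by (simp add: c_def)
    next
      case 2
      then show ?thesis using x1(2)[of x] by (simp add: c_def)
    next
      case 3
      then show ?thesis using R[of x] by (simp add: c_def)
    qed
  qed
  have "ker t (psi_inf psi) (\<lambda>k. psi k x) \<ge> c * T x" if x: "x > 0" for x
    unfolding F_eq[OF x] by (rule mult_right_mono[OF c_le[OF x] less_imp_le[OF T_pos[OF x]]])
  with \<open>c > 0\<close> show ?thesis by blast
qed

text \<open>The difference in the first argument gives \<open>B k * (Tinf - T z)\<close> and the
  second factor \<open>B k * T x\<close>. The factor \<open>T x\<close> is what the lower bound can
  absorb uniformly down to \<open>x = 0\<close>.\<close>

lemma ker_inf_diff:
  assumes t: "t > 0" and z: "z \<ge> 0" and x: "x > 0"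
  shows "\<bar>ker t (psi_inf psi) (\<lambda>k. psi k x) - ker t (\<lambda>k. psi k z) (\<lambda>k. psi k x)\<bar>
    \<le> (\<Sum>k. exp (- lam k * t) * (B k)\<^sup>2) * (Tinf - T z) * T x"
proof -
  let ?d = "\<lambda>k. exp (- lam k * t) * psi_inf psi k * psi k x - exp (- lam k * t) * psi k z * psi k x"
  have le: "\<bar>?d k\<bar> \<le> exp (- lam k * t) * (B k)\<^sup>2 * ((Tinf - T z) * T x)" for k
  proof -
    have "\<bar>psi_inf psi k - psi k z\<bar> \<le> B k * (Tinf - T z)"
      using psi_inf_diff[OF z, of k] B_ge(2)[of k] T_le_Tinf[OF z]
      by (meson diff_ge_0_iff_ge mult_right_mono order.trans)
    moreover have "\<bar>psi k x\<bar> \<le> B k * T x"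
      using psi_le_T[of x k] B_ge(2)[of k] T_pos[OF x] x
      by (meson less_imp_le mult_right_mono order.trans)
    ultimately have "\<bar>psi_inf psi k - psi k z\<bar> * \<bar>psi k x\<bar> \<le> (B k * (Tinf - T z)) * (B k * T x)"
      using B_ge(3)[of k] T_le_Tinf[OF z] by (intro mult_mono) auto
    then have "exp (- lam k * t) * (\<bar>psi_inf psi k - psi k z\<bar> * \<bar>psi k x\<bar>)
        \<le> exp (- lam k * t) * ((B k * (Tinf - T z)) * (B k * T x))"
      by (intro mult_left_mono) auto
    moreover have "?d k = exp (- lam k * t) * ((psi_inf psi k - psi k z) * psi k x)"
      by (simp add: algebra_simps)
    ultimately show ?thesis by (simp add: abs_mult power2_eq_square mult_ac)
  qed
  have sm: "summable (\<lambda>k. exp (- lam k * t) * (B k)\<^sup>2 * ((Tinf - T z) * T x))"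
    by (intro summable_mult2 summable_B t)
  have "\<bar>\<Sum>k. ?d k\<bar> \<le> (\<Sum>k. exp (- lam k * t) * (B k)\<^sup>2 * ((Tinf - T z) * T x))"
    using norm_suminf_le[of ?d, OF _ sm] le by (simp only: real_norm_def)
  moreover have "(\<Sum>k. exp (- lam k * t) * (B k)\<^sup>2 * ((Tinf - T z) * T x))
      = (\<Sum>k. exp (- lam k * t) * (B k)\<^sup>2) * (Tinf - T z) * T x"
    using suminf_mult2[OF summable_B[OF t], of "(Tinf - T z) * T x"] by (simp only: mult.assoc)
  moreover have "ker t (psi_inf psi) (\<lambda>k. psi k x) - ker t (\<lambda>k. psi k z) (\<lambda>k. psi k x) = (\<Sum>k. ?d k)"
    unfolding ker_def
    by (rule suminf_diff[OF summable_ker[OF adm_psi_inf _ t] summable_ker[OF _ _ t]])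
      (use x z in \<open>auto intro: adm_psi\<close>)
  ultimately show ?thesis by (simp only:)
qed

lemma ratio_limit:
  assumes t: "t > 0" and \<epsilon>: "\<epsilon> > 0"
  shows "\<forall>\<^sub>F z in at_top. \<forall>x>0. \<bar>rker_inf lam psi t x / rker lam psi t z x - 1\<bar> \<le> \<epsilon>"
proof -
  obtain c where c: "c > 0" "\<And>x. x > 0 \<Longrightarrow> ker t (psi_inf psi) (\<lambda>k. psi k x) \<ge> c * T x"
    using ker_inf_lower_bound[OF t] by blast
  let ?C = "\<Sum>k. exp (- lam k * t) * (B k)\<^sup>2"
  have "((\<lambda>z. ?C * (Tinf - T z)) \<longlongrightarrow> ?C * (Tinf - Tinf)) at_top"
    by (intro tendsto_intros T_tendsto)
  then have "\<forall>\<^sub>F z in at_top. ?C * (Tinf - T z) < c / 2 * min 1 \<epsilon>"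
    by (rule order_tendstoD(2)) (use c \<epsilon> in simp)
  then have "\<forall>\<^sub>F z in at_top. ?C * (Tinf - T z) < c / 2 * min 1 \<epsilon> \<and> z \<ge> 0"
    using eventually_ge_at_top[of 0] by (rule eventually_conj)
  then show ?thesis
  proof (rule eventually_mono, intro allI impI)
    fix z x assume z: "?C * (Tinf - T z) < c / 2 * min 1 \<epsilon> \<and> z \<ge> 0" and x: "(x::real) > 0"
    define r where "r = rker lam psi t z x"
    define ri where "ri = rker_inf lam psi t x"
    define d where "d = ?C * (Tinf - T z)"
    have r_eq: "r = ker t (\<lambda>k. psi k z) (\<lambda>k. psi k x)" "ri = ker t (psi_inf psi) (\<lambda>k. psi k x)"
      by (simp_all add: r_def ri_def rker_def rker_inf_def ker_def)
    have Tx: "T x > 0" using x by (rule T_pos)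
    \<comment> \<open>The 1 in the minimum keeps the denominator \<open>r\<close> above
      \<open>c / 2 * T x\<close>; the \<open>\<epsilon>\<close> then bounds the difference by
      \<open>\<epsilon> * r\<close>.\<close>
    have "c / 2 * min 1 \<epsilon> \<le> c / 2 * 1" "c / 2 * min 1 \<epsilon> \<le> c / 2 * \<epsilon>"
      using c by (intro mult_left_mono, auto)+
    then have d: "d \<le> c / 2" "d \<le> c / 2 * \<epsilon>" using z by (auto simp: d_def)
    have diff: "\<bar>ri - r\<bar> \<le> d * T x"
      unfolding r_eq d_def using ker_inf_diff[OF t _ x, of z] z by blast
    have "d * T x \<le> c / 2 * T x" using d(1) Tx by (intro mult_right_mono) auto
    then have rge: "c / 2 * T x \<le> r"
      using diff c(2)[OF x] unfolding r_eq[symmetric] by (simp add: abs_le_iff)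
    moreover have "c / 2 * T x > 0" using c Tx by simp
    ultimately have rpos: "r > 0" by linarith
    have "\<bar>ri - r\<bar> \<le> c / 2 * \<epsilon> * T x"
      using diff mult_right_mono[OF d(2), of "T x"] Tx by linarith
    also have "\<dots> = \<epsilon> * (c / 2 * T x)" by simp
    also have "\<dots> \<le> \<epsilon> * r" using rge \<epsilon> by (intro mult_left_mono) auto
    finally have "\<bar>ri - r\<bar> / r \<le> \<epsilon>" using rpos by (simp add: field_simps)
    moreover have "ri / r - 1 = (ri - r) / r" using rpos by (simp add: field_simps)
    ultimately show "\<bar>rker_inf lam psi t x / rker lam psi t z x - 1\<bar> \<le> \<epsilon>"
      using rpos by (simp add: r_def ri_def abs_divide)
  qed
qed

end

theorem theorem1p8:
  fixes q q' :: "real \<Rightarrow> real" and lam :: "nat \<Rightarrow> real" and psi :: "nat \<Rightarrow> real \<Rightarrow> real"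
  assumes C1: "C1_deriv q q'"
    and h1: "H1 q" and h2: "H2 q q'" and h3: "H3 q"
    and spec: "spectral_system q lam psi"
    and bdd: "\<And>k. bounded (psi k ` {0..})"
    and lim: "\<And>k. \<exists>L. (psi k \<longlongrightarrow> L) at_top"
    and t: "t > 0"
  shows "\<forall>\<epsilon>>0. \<forall>\<^sub>F z in at_top. \<forall>x>0.
           \<bar>rker_inf lam psi t x / rker lam psi t z x - 1\<bar> \<le> \<epsilon>"
proof -
  interpret entrance_spectrum q q' lam psi
    by unfold_locales (fact C1 h1 h2 h3 spec bdd lim)+
  show ?thesis using ratio_limit[OF t] by blast
qed

end
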